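(* If $G$ is a connected regular graph of order at least $7$, then $D'(G)\leq 2$.
   Context: Graphs are simple and undirected and may be infinite; a graph is regular if all vertices have the same degree (which may be an infinite cardinal). An edge colouring $c$ of $G$ preserves an automorphism $\varphi$ of $G$ if every edge $e$ has the same colour as $\varphi(e)$; $c$ is distinguishing if the only automorphism of $G$ preserved by $c$ is the identity. The distinguishing index $D'(G)$ is the least number of colours in a distinguishing edge colouring of $G$. *)

theory Defs
  imports Main "HOL-Library.Equipollence"
begin

definition simple_graph :: "'a set \<Rightarrow> 'a set set \<Rightarrow> bool" where
  "simple_graph V E \<longleftrightarrow> (\<forall>e\<in>E. \<exists>u v. e = {u, v} \<and> u \<noteq> v \<and> u \<in> V \<and> v \<in> V)"

definition neighbours :: "'a set set \<Rightarrow> 'a \<Rightarrow> 'a set" where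
  "neighbours E u = {v. {u, v} \<in> E}"

text \<open>Regular: all vertices have the same degree (a possibly infinite cardinal),
  i.e. all neighbourhoods are equipollent.\<close>
definition regular_graph :: "'a set \<Rightarrow> 'a set set \<Rightarrow> bool" where
  "regular_graph V E \<longleftrightarrow> (\<forall>u\<in>V. \<forall>v\<in>V. neighbours E u \<approx> neighbours E v)"

definition connected_graph :: "'a set \<Rightarrow> 'a set set \<Rightarrow> bool" where
  "connected_graph V E \<longleftrightarrow> V \<noteq> {} \<and>
     (\<forall>u\<in>V. \<forall>v\<in>V. (\<lambda>x y. {x, y} \<in> E)\<^sup>*\<^sup>* u v)"

definition graph_automorphism :: "'a set \<Rightarrow> 'a set set \<Rightarrow> ('a \<Rightarrow> 'a) \<Rightarrow> bool" where
  "graph_automorphism V E f \<longleftrightarrow> bij_betw f V V \<and>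
     (\<forall>u\<in>V. \<forall>v\<in>V. {u, v} \<in> E \<longleftrightarrow> {f u, f v} \<in> E)"

definition preserves_aut :: "'a set set \<Rightarrow> ('a set \<Rightarrow> 'c) \<Rightarrow> ('a \<Rightarrow> 'a) \<Rightarrow> bool" where
  "preserves_aut E c f \<longleftrightarrow> (\<forall>e\<in>E. c (f ` e) = c e)"

definition distinguishing_edge_colouring :: "'a set \<Rightarrow> 'a set set \<Rightarrow> ('a set \<Rightarrow> 'c) \<Rightarrow> bool" where
  "distinguishing_edge_colouring V E c \<longleftrightarrow>
     (\<forall>f. graph_automorphism V E f \<and> preserves_aut E c f \<longrightarrow> (\<forall>v\<in>V. f v = v))"

definition dist_index_le :: "'a set \<Rightarrow> 'a set set \<Rightarrow> nat \<Rightarrow> bool" where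
  "dist_index_le V E k \<longleftrightarrow>
     (\<exists>c :: 'a set \<Rightarrow> nat. (\<forall>e\<in>E. c e < k) \<and> distinguishing_edge_colouring V E c)"

end

theory Submission
  imports Defs "HOL.Binomial"
begin

text \<open>Let \<open>d\<close> be the degree. If \<open>d\<close> is infinite, it is the cardinality of the graph, and there is
  room for a spanning forest of red trees which are rigid because siblings have distinct ordinal
  ranks. A finite graph in which nonadjacent vertices are twins is complete multipartite and contains
  a spanning spider with three legs of distinct lengths, which is coloured red. In all other
  graphs there is a suitable induced path \<open>r s u\<close>, and we make sure that \<open>r\<close> is the only vertex
  without a blue edge and that \<open>{s, u}\<close> is the only blue edge meeting no other blue edge; hence the
  three vertices are fixed.

  From there the edges are coloured greedily, and one keeps track of the group of automorphisms
  that are still possible. The invariant is that an orbit of this group that has met a coloured edge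
  is a singleton or has at most as many vertices as each of its vertices has uncoloured edges. So if
  all edges are coloured, all orbits are singletons. If two orbits are completely joined by uncoloured
  edges, a half graph between them preserves the invariant. Otherwise, take a smallest orbit \<open>C\<close> that
  has met a coloured edge, and give its vertices distinct red degrees. For another such orbit \<open>C'\<close>,
  each vertex of \<open>C'\<close> with \<open>b\<close> neighbours in \<open>C\<close> has a nonneighbour in \<open>C\<close>, and since \<open>C'\<close> is not
  smaller than \<open>C\<close>, this nonneighbour has at least \<open>b\<close> neighbours in \<open>C'\<close>. Hence \<open>C'\<close> is split into
  orbits that are smaller by at least \<open>b\<close>, which is the number of edges lost.\<close>

section \<open>Automorphisms and orbits\<close>

text \<open>The order 7 is that of the smallest spider with three distinct leg lengths, 1 + 1 + 2 +
  3. Outside the multipartite case it rules out the 5-cycle. The marks at \<open>r\<close> and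
  \<open>{s, u}\<close> have to survive the greedy colouring. A round may leave a vertex without a
  blue edge only if it keeps an uncoloured one, and two adjacent vertices without blue edges must
  never be left with nothing but their common edge: coloured red, it leaves both without blue;
  coloured blue, it becomes a second isolated blue edge. Hence the clauses of the invariant beyond
  the orbit sizes. A second obstacle is that the orbit bound is silent about orbits that have met no
  coloured edge. They may be infinite, and many of their vertices may have the same neighbours in
  \<open>C\<close>. Counting shows that this is harmful only in a rigid configuration, where each
  vertex of \<open>C\<close> sees exactly one of these classes of twins, or misses exactly one;
  there the classes can be split directly. In infinite graphs the rounds are transfinite, and finite
  degrees make the limits harmless.\<close>

lemma simple_graphD:
  assumes "simple_graph V F" "{v, w} \<in> F"
  shows "v \<in> V" "w \<in> V" "v \<noteq> w"
  using assms unfolding simple_graph_def by (metis doubleton_eq_iff)+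

lemma in_neighbours [simp]: "w \<in> neighbours F v \<longleftrightarrow> {v, w} \<in> F"
  by (simp add: neighbours_def)

lemma neighbours_commute: "w \<in> neighbours F v \<longleftrightarrow> v \<in> neighbours F w"
  by (simp add: insert_commute)

lemma neighbours_Diff: "neighbours (F - G) v = neighbours F v - neighbours G v"
  by auto

lemma neighbours_mono: "F \<subseteq> G \<Longrightarrow> neighbours F v \<subseteq> neighbours G v"
  by auto

lemma neighbours_outside: "simple_graph V F \<Longrightarrow> v \<notin> V \<Longrightarrow> neighbours F v = {}"
  using simple_graphD(1) by fastforce

lemma neighbours_subset: "simple_graph V F \<Longrightarrow> neighbours F v \<subseteq> V"
  using simple_graphD(2) by fastforce

lemma simple_graph_mono: "simple_graph V F \<Longrightarrow> G \<subseteq> F \<Longrightarrow> simple_graph V G"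
  unfolding simple_graph_def by blast

lemma automorphism_neighbours:
  assumes "graph_automorphism V F \<phi>" "simple_graph V F" "v \<in> V"
  shows "neighbours F (\<phi> v) = \<phi> ` neighbours F v"
proof
  have bij: "bij_betw \<phi> V V" using assms(1) by (simp add: graph_automorphism_def)
  have edge: "{a, b} \<in> F \<longleftrightarrow> {\<phi> a, \<phi> b} \<in> F" if "a \<in> V" "b \<in> V" for a b
    using assms(1) that by (simp add: graph_automorphism_def)
  show "\<phi> ` neighbours F v \<subseteq> neighbours F (\<phi> v)"
    using edge[OF assms(3)] neighbours_subset[OF assms(2), of v] by auto
  show "neighbours F (\<phi> v) \<subseteq> \<phi> ` neighbours F v"
  proof
    fix w assume w: "w \<in> neighbours F (\<phi> v)"
    then have "w \<in> V" using neighbours_subset[OF assms(2)] by blast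
    then obtain w' where w': "w' \<in> V" "w = \<phi> w'"
      using bij by (auto simp: bij_betw_def)
    then have "w' \<in> neighbours F v" using w edge[OF assms(3) w'(1)] by simp
    then show "w \<in> \<phi> ` neighbours F v" using w' by blast
  qed
qed

lemma automorphism_id: "graph_automorphism V F id"
  by (simp add: graph_automorphism_def)

lemma automorphism_comp:
  assumes "graph_automorphism V F \<phi>" "graph_automorphism V F \<psi>"
  shows "graph_automorphism V F (\<phi> \<circ> \<psi>)"
proof -
  have b: "bij_betw \<phi> V V" "bij_betw \<psi> V V" using assms by (auto simp: graph_automorphism_def)
  have "{u, v} \<in> F \<longleftrightarrow> {(\<phi> \<circ> \<psi>) u, (\<phi> \<circ> \<psi>) v} \<in> F" if "u \<in> V" "v \<in> V" for u v
  proof -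
    have "\<psi> u \<in> V" "\<psi> v \<in> V" using b(2) that bij_betw_apply by fastforce+
    then show ?thesis
      using assms[unfolded graph_automorphism_def] that by (metis comp_apply)
  qed
  then show ?thesis using bij_betw_trans[OF b(2,1)] by (simp add: graph_automorphism_def)
qed

lemma automorphism_inv_into:
  assumes "graph_automorphism V F \<phi>"
  shows "graph_automorphism V F (inv_into V \<phi>)"
proof -
  have bij: "bij_betw \<phi> V V" using assms by (simp add: graph_automorphism_def)
  have "{u, v} \<in> F \<longleftrightarrow> {inv_into V \<phi> u, inv_into V \<phi> v} \<in> F" if "u \<in> V" "v \<in> V" for u v
  proof -
    have "inv_into V \<phi> u \<in> V" "inv_into V \<phi> v \<in> V"
      using bij that by (simp_all add: bij_betw_def inv_into_into)
    then show ?thesis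
      using assms bij that by (simp add: graph_automorphism_def bij_betw_inv_into_right)
  qed
  then show ?thesis using bij by (simp add: graph_automorphism_def bij_betw_inv_into)
qed

lemma automorphism_Diff:
  assumes "graph_automorphism V F \<phi>" "graph_automorphism V G \<phi>"
  shows "graph_automorphism V (F - G) \<phi>"
  using assms by (simp add: graph_automorphism_def)

lemma automorphism_Un:
  assumes "graph_automorphism V F \<phi>" "graph_automorphism V G \<phi>"
  shows "graph_automorphism V (F \<union> G) \<phi>"
  using assms by (simp add: graph_automorphism_def)

section \<open>Orbits of a permutation group and stabilisers of edge sets\<close>

definition orbit :: "('a \<Rightarrow> 'a) set \<Rightarrow> 'a \<Rightarrow> 'a set" where
  "orbit A v = (\<lambda>\<phi>. \<phi> v) ` A"

text \<open>The stabiliser of the edge set \<open>Y\<close>. In a colouring round all of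
  \<open>A\<close> preserves the newly coloured set, so keeping its red part also keeps its blue
  part.\<close>

definition preserving :: "'a set \<Rightarrow> ('a \<Rightarrow> 'a) set \<Rightarrow> 'a set set \<Rightarrow> ('a \<Rightarrow> 'a) set" where
  "preserving V A Y = {\<phi> \<in> A. graph_automorphism V Y \<phi>}"

lemma orbit_mono: "A \<subseteq> B \<Longrightarrow> orbit A v \<subseteq> orbit B v"
  unfolding orbit_def by blast

text \<open>The elements are functions on the whole type of which only the values on
  \<open>V\<close> matter. Hence inverses are taken with \<open>inv_into V\<close>, and they invert
  on \<open>V\<close> only.\<close>

locale permutation_group =
  fixes V :: "'a set" and A :: "('a \<Rightarrow> 'a) set"
  assumes id_mem: "id \<in> A"
    and comp_mem: "\<phi> \<in> A \<Longrightarrow> \<psi> \<in> A \<Longrightarrow> \<phi> \<circ> \<psi> \<in> A"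
    and inv_mem: "\<phi> \<in> A \<Longrightarrow> inv_into V \<phi> \<in> A"
    and bij: "\<phi> \<in> A \<Longrightarrow> bij_betw \<phi> V V"
begin

lemma perm_in: "\<phi> \<in> A \<Longrightarrow> v \<in> V \<Longrightarrow> \<phi> v \<in> V"
  using bij bij_betw_apply by metis

lemma perm_inj: "\<phi> \<in> A \<Longrightarrow> inj_on \<phi> V"
  using bij bij_betw_def by metis

lemma orbit_refl: "v \<in> orbit A v"
  unfolding orbit_def using id_mem by (metis id_apply image_eqI)

lemma orbit_subset: "v \<in> V \<Longrightarrow> orbit A v \<subseteq> V"
  unfolding orbit_def using perm_in by auto

lemma orbit_trans:
  assumes "w \<in> orbit A v" "x \<in> orbit A w"
  shows "x \<in> orbit A v"
proof -
  obtain \<phi> \<psi> where "\<phi> \<in> A" "w = \<phi> v" "\<psi> \<in> A" "x = \<psi> w"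
    using assms unfolding orbit_def by blast
  then have "\<psi> \<circ> \<phi> \<in> A" "x = (\<psi> \<circ> \<phi>) v" using comp_mem by auto
  then show ?thesis unfolding orbit_def by blast
qed

lemma orbit_sym:
  assumes "v \<in> V" "w \<in> orbit A v"
  shows "v \<in> orbit A w"
proof -
  obtain \<phi> where \<phi>: "\<phi> \<in> A" "w = \<phi> v" using assms unfolding orbit_def by blast
  then have "inv_into V \<phi> w = v" using assms(1) bij bij_betw_inv_into_left by metis
  then show ?thesis unfolding orbit_def using inv_mem[OF \<phi>(1)] by (metis image_eqI)
qed

lemma orbit_eq:
  assumes "v \<in> V" "w \<in> orbit A v"
  shows "orbit A w = orbit A v"
  using assms orbit_sym orbit_trans by blast

lemma orbit_closed:
  assumes "\<phi> \<in> A" "w \<in> orbit A v"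
  shows "\<phi> w \<in> orbit A v"
  using assms orbit_trans unfolding orbit_def by blast

lemma orbit_mem_iff:
  assumes "\<phi> \<in> A" "x \<in> V" "v \<in> V"
  shows "\<phi> x \<in> orbit A v \<longleftrightarrow> x \<in> orbit A v"
proof -
  have "\<phi> x \<in> orbit A x" using assms(1) by (auto simp: orbit_def)
  then show ?thesis using orbit_closed[OF assms(1)] orbit_sym[OF assms(2)] orbit_trans by blast
qed

lemma fixed_orbit:
  "(\<And>\<phi>. \<phi> \<in> A \<Longrightarrow> \<phi> v = v) \<Longrightarrow> orbit A v = {v}"
  using orbit_refl unfolding orbit_def by auto

lemma orbit_image:
  assumes "v \<in> V" "\<phi> \<in> A"
  shows "\<phi> ` orbit A v = orbit A v"
proof
  show "\<phi> ` orbit A v \<subseteq> orbit A v" using orbit_closed[OF assms(2)] by blast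
  show "orbit A v \<subseteq> \<phi> ` orbit A v"
  proof
    fix w assume w: "w \<in> orbit A v"
    then have "inv_into V \<phi> w \<in> orbit A v" using orbit_closed inv_mem assms(2) by blast
    moreover have "\<phi> (inv_into V \<phi> w) = w"
      using w orbit_subset[OF assms(1)] bij[OF assms(2)] bij_betw_inv_into_right by fastforce
    ultimately show "w \<in> \<phi> ` orbit A v" by (metis image_eqI)
  qed
qed

lemma orbit_image_Int:
  assumes "v \<in> V" "\<phi> \<in> A" "S \<subseteq> V"
  shows "\<phi> ` (S \<inter> orbit A v) = \<phi> ` S \<inter> orbit A v"
  using inj_on_image_Int[OF perm_inj[OF assms(2)] assms(3) orbit_subset[OF assms(1)]]
    orbit_image[OF assms(1,2)] by simp

lemma preserving_group: "permutation_group V (preserving V A Y)"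
  by unfold_locales
    (auto simp: preserving_def id_mem comp_mem inv_mem bij automorphism_id automorphism_comp
      automorphism_inv_into)

end

lemma preserving_subset: "preserving V A Y \<subseteq> A"
  by (auto simp: preserving_def)

section \<open>Colouring steps\<close>

text \<open>One round of the greedy colouring: \<open>U\<close> are the uncoloured edges, \<open>X\<close> the edges
  coloured in this round, and \<open>Y\<close> the red ones among them.\<close>

definition colouring_step ::
    "'a set \<Rightarrow> 'a set set \<Rightarrow> ('a \<Rightarrow> 'a) set \<Rightarrow> 'a set set \<Rightarrow> 'a set set \<Rightarrow> bool" where
  "colouring_step V U A X Y \<longleftrightarrow> X \<subseteq> U \<and> X \<noteq> {} \<and> Y \<subseteq> X \<and>
     (\<forall>\<phi>\<in>A. graph_automorphism V X \<phi>) \<and>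
     (\<forall>v\<in>V. neighbours X v \<noteq> {} \<longrightarrow> orbit (preserving V A Y) v = {v} \<or>
        finite (orbit (preserving V A Y) v) \<and>
        card (orbit (preserving V A Y) v) \<le> card (neighbours (U - X) v)) \<and>
     (\<forall>v\<in>V. neighbours X v \<noteq> {} \<longrightarrow> neighbours (X - Y) v = {} \<longrightarrow> neighbours (U - X) v \<noteq> {}) \<and>
     (\<forall>x z. {x, z} \<in> X - Y \<longrightarrow> neighbours (X - Y) x = {z} \<longrightarrow> neighbours (X - Y) z = {x} \<longrightarrow>
        neighbours (U - X) x = {} \<longrightarrow> neighbours (U - X) z = {} \<longrightarrow>
        neighbours U x = {z} \<and> neighbours U z = {x}) \<and>
     (\<forall>v w. {v, w} \<in> U - X \<longrightarrow> neighbours X v \<noteq> {} \<longrightarrow> neighbours X w \<noteq> {} \<longrightarrow>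
        neighbours (X - Y) v = {} \<longrightarrow> neighbours (X - Y) w = {} \<longrightarrow>
        \<not> (card (neighbours (U - X) v) = 1 \<and> card (neighbours (U - X) w) = 1))"

text \<open>\<open>U\<close> is the graph of uncoloured edges and \<open>A\<close> the group of the
  automorphisms still possible. The degrees of \<open>U\<close> are finite but in general differ, as
  earlier rounds have removed edges.\<close>

locale acted_graph = permutation_group +
  fixes U :: "'a set set"
  assumes simple: "simple_graph V U"
    and fin: "v \<in> V \<Longrightarrow> finite (neighbours U v)"
    and aut: "\<phi> \<in> A \<Longrightarrow> graph_automorphism V U \<phi>"
begin

lemma perm_edge: "\<phi> \<in> A \<Longrightarrow> v \<in> V \<Longrightarrow> w \<in> V \<Longrightarrow> {\<phi> v, \<phi> w} \<in> U \<longleftrightarrow> {v, w} \<in> U"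
  using aut by (simp add: graph_automorphism_def)

lemma perm_neighbours: "\<phi> \<in> A \<Longrightarrow> v \<in> V \<Longrightarrow> neighbours U (\<phi> v) = \<phi> ` neighbours U v"
  using aut automorphism_neighbours simple by metis

lemma neighbours_in: "neighbours U v \<subseteq> V"
  using neighbours_subset[OF simple] .

lemma degree_orbit:
  assumes "v \<in> V" "w \<in> orbit A v"
  shows "card (neighbours U w) = card (neighbours U v)"
proof -
  obtain \<phi> where "\<phi> \<in> A" "w = \<phi> v" using assms unfolding orbit_def by blast
  then show ?thesis
    using perm_neighbours assms(1) card_image inj_on_subset[OF perm_inj neighbours_in] by metis
qed

lemma perm_neighbours_orbit:
  assumes "\<phi> \<in> A" "v \<in> V" "z \<in> V"
  shows "neighbours U (\<phi> v) \<inter> orbit A z = \<phi> ` (neighbours U v \<inter> orbit A z)"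
  using perm_neighbours[OF assms(1,2)] orbit_image_Int[OF assms(3,1) neighbours_in] by simp

lemma degree_into_orbit:
  assumes "v \<in> V" "w \<in> orbit A v" "z \<in> V"
  shows "card (neighbours U w \<inter> orbit A z) = card (neighbours U v \<inter> orbit A z)"
proof -
  obtain \<phi> where \<phi>: "\<phi> \<in> A" "w = \<phi> v" using assms unfolding orbit_def by blast
  have "inj_on \<phi> (neighbours U v \<inter> orbit A z)"
    using inj_on_subset[OF perm_inj[OF \<phi>(1)]] neighbours_in by blast
  then show ?thesis
    using perm_neighbours_orbit[OF \<phi>(1) assms(1,3)] \<phi>(2) card_image by metis
qed

text \<open>Two completely joined orbits: a half graph gives distinct red degrees to all vertices of the
  smaller orbit, and these cut one vertex after the other off the larger one.\<close>

lemma join_step: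
  assumes x0: "x0 \<in> V" and z0: "z0 \<in> V" and ne: "z0 \<notin> orbit A x0"
    and join: "\<And>x z. x \<in> orbit A x0 \<Longrightarrow> z \<in> orbit A z0 \<Longrightarrow> {x, z} \<in> U"
    and le: "card (orbit A x0) \<le> card (orbit A z0)"
    and le': "card (orbit A z0) \<le> card (neighbours U z0)"
  shows "\<exists>X Y. colouring_step V U A X Y"
proof -
  define C where "C = orbit A x0"
  define C' where "C' = orbit A z0"
  define m where "m = card C"
  define m' where "m' = card C'"
  have CV: "C \<subseteq> V" "C' \<subseteq> V" using orbit_subset x0 z0 by (auto simp: C_def C'_def)
  have x0C: "x0 \<in> C" "z0 \<in> C'" using orbit_refl by (auto simp: C_def C'_def)
  have disj: "C \<inter> C' = {}"
    using ne orbit_eq[OF x0] orbit_sym[OF z0] unfolding C_def C'_def by blast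
  have CU: "{x, z} \<in> U" if "x \<in> C" "z \<in> C'" for x z using join that by (auto simp: C_def C'_def)
  have "C' \<subseteq> neighbours U x0" using CU x0C by auto
  moreover have "C \<subseteq> neighbours U z0" using CU[OF _ x0C(2)] by (auto simp: insert_commute[of z0])
  ultimately have finC: "finite C" "finite C'"
    using finite_subset[OF _ fin[OF x0]] finite_subset[OF _ fin[OF z0]] by auto
  have mpos: "m > 0" "m' > 0" using finC x0C by (auto simp: m_def m'_def card_gt_0_iff)
  have mm: "m \<le> m'" using le by (simp add: m_def m'_def C_def C'_def)
  \<comment> \<open>\<open>p x\<close> is the red degree of \<open>x\<close> and also a threshold:
    \<open>x\<close> is red to the positions below \<open>p x\<close>. The thresholds from 1 to
    \<open>m\<close> cut off the first \<open>m\<close> positions one by one and leave a class of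
    \<open>m' - m\<close>, just what the loss of \<open>m\<close> edges permits. If
    \<open>m = m'\<close>, the threshold \<open>m\<close> would leave a vertex of \<open>C\<close>
    without a blue edge, and those from 0 to \<open>m - 1\<close> already separate all
    positions.\<close>
  define P where "P = (if m < m' then {1..m} else {0..<m})"
  have "card C = card P" "finite P" by (auto simp: P_def m_def)
  from finite_same_card_bij[OF finC(1) this(2,1)] obtain p where p: "bij_betw p C P" by blast
  have "card C' = card {0..<m'}" by (simp add: m'_def)
  from finite_same_card_bij[OF finC(2) _ this] obtain q where q: "bij_betw q C' {0..<m'}" by blast
  have pP: "p x \<in> P" if "x \<in> C" for x using p that bij_betw_apply by metis
  have p_less: "p x < m'" if "x \<in> C" for x
    using pP[OF that] mm mpos by (auto simp: P_def split: if_splits)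
  have q_less: "q z < m'" if "z \<in> C'" for z using q that bij_betw_apply by fastforce
  have p_ex: "\<exists>x\<in>C. p x = k" if "k \<in> P" for k
    using p that by (metis bij_betw_imp_surj_on image_iff)
  have q_ex: "\<exists>z\<in>C'. q z = k" if "k < m'" for k
    using q that by (metis atLeast0LessThan bij_betw_imp_surj_on image_iff lessThan_iff)
  have p_inj: "x = y" if "x \<in> C" "y \<in> C" "p x = p y" for x y
    using p that by (metis bij_betw_def inj_onD)
  have q_inj: "x = y" if "x \<in> C'" "y \<in> C'" "q x = q y" for x y
    using q that by (metis bij_betw_def inj_onD)
  define X where "X = {{x, z} | x z. x \<in> C \<and> z \<in> C'}"
  define Y where "Y = {{x, z} | x z. x \<in> C \<and> z \<in> C' \<and> q z < p x}"
  have X_iff: "{v, w} \<in> X \<longleftrightarrow> v \<in> C \<and> w \<in> C' \<or> w \<in> C \<and> v \<in> C'" for v w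
    by (auto simp: X_def doubleton_eq_iff)
  have Y_iff: "{v, w} \<in> Y \<longleftrightarrow> v \<in> C \<and> w \<in> C' \<and> q w < p v \<or> w \<in> C \<and> v \<in> C' \<and> q v < p w" for v w
    by (auto simp: Y_def doubleton_eq_iff)
  have XU: "X \<subseteq> U" using CU by (auto simp: X_def)
  have YX: "Y \<subseteq> X" by (auto simp: X_def Y_def)
  have simY: "simple_graph V Y" using simple simple_graph_mono XU YX by blast
  have nX: "neighbours X x = C'" if "x \<in> C" for x using that disj by (auto simp: X_iff)
  have nX': "neighbours X z = C" if "z \<in> C'" for z using that disj by (auto simp: X_iff)
  have nX0: "v \<in> C \<or> v \<in> C'" if "neighbours X v \<noteq> {}" for v using that by (auto simp: X_iff)
  have nB: "neighbours (X - Y) x = {z \<in> C'. p x \<le> q z}" if "x \<in> C" for x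
    using that disj by (auto simp: X_iff Y_iff)
  have nB': "neighbours (X - Y) z = {x \<in> C. p x \<le> q z}" if "z \<in> C'" for z
    using that disj by (auto simp: X_iff Y_iff)
  have nY: "card (neighbours Y x) = p x" if "x \<in> C" for x
  proof -
    have px: "p x < m'" using p_less[OF that] .
    have "neighbours Y x = {z \<in> C'. q z < p x}" using that disj by (auto simp: Y_iff)
    moreover have "bij_betw q {z \<in> C'. q z < p x} {0..<p x}"
    proof -
      have "q ` {z \<in> C'. q z < p x} = {0..<p x}"
      proof (intro equalityI subsetI)
        fix k assume "k \<in> {0..<p x}"
        moreover then obtain z where "z \<in> C'" "q z = k" using q_ex[of k] px by auto
        ultimately show "k \<in> q ` {z \<in> C'. q z < p x}" by auto
      qed auto
      moreover have "inj_on q {z \<in> C'. q z < p x}" using q_inj by (auto intro: inj_onI)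
      ultimately show ?thesis by (simp add: bij_betw_def)
    qed
    ultimately show ?thesis using bij_betw_same_card by fastforce
  qed
  have closed: "\<phi> x \<in> C \<longleftrightarrow> x \<in> C" "\<phi> x \<in> C' \<longleftrightarrow> x \<in> C'" if "\<phi> \<in> A" "x \<in> V" for \<phi> x
    using orbit_mem_iff[OF that x0] orbit_mem_iff[OF that z0] by (simp_all add: C_def C'_def)
  have autX: "graph_automorphism V X \<phi>" if "\<phi> \<in> A" for \<phi>
    using closed[OF that] bij[OF that] by (auto simp: graph_automorphism_def X_iff)
  define A' where "A' = preserving V A Y"
  have A'A: "\<phi> \<in> A" and A'Y: "graph_automorphism V Y \<phi>" if "\<phi> \<in> A'" for \<phi>
    using that by (auto simp: A'_def preserving_def)
  interpret A': permutation_group V A' unfolding A'_def by (rule preserving_group)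
  have fixC: "\<phi> x = x" if "\<phi> \<in> A'" "x \<in> C" for \<phi> x
  proof -
    have xV: "x \<in> V" using that CV by blast
    have "card (neighbours Y (\<phi> x)) = card (neighbours Y x)"
      using automorphism_neighbours[OF A'Y[OF that(1)] simY xV]
        card_image inj_on_subset[OF A'.perm_inj[OF that(1)] neighbours_subset[OF simY]] by metis
    then show ?thesis using nY closed(1)[OF A'A[OF that(1)] xV] that p_inj by metis
  qed
  have orbC: "orbit A' x = {x}" if "x \<in> C" for x
    using fixC[OF _ that] A'.orbit_refl unfolding orbit_def by blast
  have cut: "q (\<phi> z) < p x \<longleftrightarrow> q z < p x" if "\<phi> \<in> A'" "z \<in> C'" "x \<in> C" for \<phi> z x
  proof -
    have "{x, z} \<in> Y \<longleftrightarrow> {\<phi> x, \<phi> z} \<in> Y"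
      using A'Y[OF that(1)] that CV unfolding graph_automorphism_def by blast
    moreover have "\<phi> z \<in> C'" using closed(2)[OF A'A] that CV by blast
    ultimately show ?thesis using fixC[OF that(1,3)] that disj by (auto simp: Y_iff)
  qed
  \<comment> \<open>The successor of the smaller of two positions is a threshold that separates
    them, unless both positions lie beyond the last threshold.\<close>
  have same: "q (\<phi> z) = q z \<or> (Suc (q z) \<notin> P \<and> Suc (q (\<phi> z)) \<notin> P \<and> (m < m' \<longrightarrow> m \<le> q z \<and> m \<le> q (\<phi> z)))"
    if "\<phi> \<in> A'" "z \<in> C'" for \<phi> z
  proof (rule ccontr)
    assume neg: "\<not> ?thesis"
    have "\<phi> z \<in> C'" using closed(2)[OF A'A] that CV by blast
    then have bd: "q z < m'" "q (\<phi> z) < m'" using q_less that by auto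
    have "Suc (q z) \<in> P \<or> Suc (q (\<phi> z)) \<in> P" using neg bd by (auto simp: P_def)
    moreover have "Suc a \<in> P \<Longrightarrow> b < a \<Longrightarrow> Suc b \<in> P" for a b by (auto simp: P_def split: if_splits)
    ultimately have "Suc (min (q z) (q (\<phi> z))) \<in> P" by (metis linorder_not_less min_def nat_less_le)
    then obtain x where x: "x \<in> C" "p x = Suc (min (q z) (q (\<phi> z)))" using p_ex by blast
    have "q (\<phi> z) \<noteq> q z" using neg by blast
    then show False using cut[OF that x(1)] x(2) by (auto simp: min_def split: if_splits)
  qed
  have cU: "card (neighbours (U - X) z) = card (neighbours U z0) - m" if "z \<in> C'" for z
  proof -
    have "neighbours (U - X) z = neighbours U z - C" using nX'[OF that] by (simp add: neighbours_Diff)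
    moreover have "C \<subseteq> neighbours U z" using CU that by (auto simp: insert_commute)
    ultimately have "card (neighbours (U - X) z) = card (neighbours U z) - m"
      using card_Diff_subset[OF finC(1)] m_def by simp
    then show ?thesis using degree_orbit[OF z0] that C'_def by simp
  qed
  have le'': "m' \<le> card (neighbours U z0)" using le' by (simp add: m'_def C'_def)
  have c1': "orbit A' z = {z} \<or> finite (orbit A' z) \<and> card (orbit A' z) \<le> card (neighbours (U - X) z)"
    if z: "z \<in> C'" for z
  proof (cases "m < m' \<and> m \<le> q z")
    case True
    have sub: "orbit A' z \<subseteq> {w \<in> C'. m \<le> q w}"
    proof
      fix w assume "w \<in> orbit A' z"
      then obtain \<phi> where \<phi>: "\<phi> \<in> A'" "w = \<phi> z" by (auto simp: orbit_def)
      then have "w \<in> C'" using closed(2)[OF A'A] z CV by blast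
      moreover have "m \<le> q w" using same[OF \<phi>(1) z] True \<phi>(2) by auto
      ultimately show "w \<in> {w \<in> C'. m \<le> q w}" by blast
    qed
    have "inj_on q {w \<in> C'. m \<le> q w}" using q_inj by (auto intro: inj_onI)
    moreover have "q ` {w \<in> C'. m \<le> q w} \<subseteq> {m..<m'}" using q_less by auto
    ultimately have "card {w \<in> C'. m \<le> q w} \<le> m' - m"
      using card_inj_on_le[of q _ "{m..<m'}"] by simp
    moreover have "card (orbit A' z) \<le> card {w \<in> C'. m \<le> q w}"
      using sub finC(2) by (intro card_mono) auto
    moreover have "finite (orbit A' z)" using finite_subset[OF sub] finC(2) by simp
    moreover have "m' - m \<le> card (neighbours (U - X) z)" using cU[OF z] le'' by simp
    ultimately show ?thesis by linarith
  next
    case False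
    have "\<phi> z = z" if "\<phi> \<in> A'" for \<phi>
    proof -
      have \<phi>z: "\<phi> z \<in> C'" using closed(2)[OF A'A[OF that]] z CV by blast
      have "q (\<phi> z) = q z"
      proof (cases "m < m'")
        case True
        then show ?thesis using same[OF that z] False by auto
      next
        case False
        then have "m = m'" using mm by simp
        then have "Suc k \<notin> P \<Longrightarrow> k < m' \<Longrightarrow> k = m' - 1" for k by (auto simp: P_def)
        then show ?thesis using same[OF that z] q_less z \<phi>z by metis
      qed
      then show ?thesis using q_inj \<phi>z z by blast
    qed
    then show ?thesis using A'.orbit_refl unfolding orbit_def by blast
  qed
  \<comment> \<open>Only position 0 below thresholds that start at 1 sees no blue, and
    \<open>m < m'\<close> then leaves it an uncoloured edge. As there is at most one such vertex, no
    edge joins two of them.\<close>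
  have noB: "v \<in> C' \<and> m < m' \<and> q v = 0"
    if v: "neighbours X v \<noteq> {}" "neighbours (X - Y) v = {}" for v
  proof -
    have "v \<notin> C"
    proof
      assume "v \<in> C"
      moreover obtain z where "z \<in> C'" "q z = m' - 1" using q_ex[of "m' - 1"] mpos by auto
      ultimately show False using v(2) nB p_less[of v] by force
    qed
    then have vC: "v \<in> C'" using nX0[OF v(1)] by blast
    have none: "\<not> p x \<le> q v" if "x \<in> C" for x using v(2) nB'[OF vC] that by blast
    have "m < m'"
    proof (rule ccontr)
      assume "\<not> m < m'"
      then have "0 \<in> P" using mpos by (auto simp: P_def)
      then show False using p_ex none by fastforce
    qed
    moreover have "q v = 0"
    proof (rule ccontr)
      assume "q v \<noteq> 0"
      moreover have "1 \<in> P" using \<open>m < m'\<close> mpos by (auto simp: P_def)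
      ultimately show False using p_ex none by fastforce
    qed
    ultimately show ?thesis using vC by blast
  qed
  have c3': "neighbours U x = {z} \<and> neighbours U z = {x}"
    if xC: "x \<in> C" and zC: "z \<in> C'" and nY: "{x, z} \<notin> Y"
      and bx: "neighbours (X - Y) x = {z}" and bz: "neighbours (X - Y) z = {x}"
      and ux: "neighbours (U - X) x = {}" and uz: "neighbours (U - X) z = {}" for x z
  proof -
    have "m' \<le> m" using cU[OF zC] uz le'' by simp
    then have e: "m = m'" using mm by simp
    then obtain x1 where x1: "x1 \<in> C" "p x1 = 0" using p_ex[of 0] mpos by (auto simp: P_def)
    then have "x1 \<in> neighbours (X - Y) z" unfolding nB'[OF zC] by simp
    then have "x1 = x" unfolding bz by simp
    obtain z1 where z1: "z1 \<in> C'" "q z1 = m' - 1" using q_ex[of "m' - 1"] mpos by auto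
    then have "z1 \<in> neighbours (X - Y) x" unfolding nB[OF xC] using p_less[OF xC] by auto
    then have "z1 = z" unfolding bx by simp
    obtain z2 where z2: "z2 \<in> C'" "q z2 = 0" using q_ex[of 0] mpos by auto
    then have "z2 \<in> neighbours (X - Y) x" unfolding nB[OF xC] using \<open>x1 = x\<close> x1 by simp
    then have "z2 = z" unfolding bx by simp
    then have "m' = 1" using z1 z2 \<open>z1 = z\<close> mpos by simp
    then have "C = {x}" "C' = {z}"
      using e xC zC by (metis card_1_singletonE m_def singletonD, metis card_1_singletonE m'_def singletonD)
    then show ?thesis using nX[OF xC] nX'[OF zC] ux uz neighbours_mono[OF XU, of x] neighbours_mono[OF XU, of z]
      unfolding neighbours_Diff by blast
  qed
  have "colouring_step V U A X Y"
    unfolding colouring_step_def A'_def[symmetric]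
  proof (intro conjI ballI allI impI)
    show "X \<subseteq> U" "Y \<subseteq> X" by fact+
    show "X \<noteq> {}" using x0C by (auto simp: X_def)
    show "graph_automorphism V X \<phi>" if "\<phi> \<in> A" for \<phi> using autX that .
    show "orbit A' v = {v} \<or> finite (orbit A' v) \<and> card (orbit A' v) \<le> card (neighbours (U - X) v)"
      if "neighbours X v \<noteq> {}" for v
      using nX0[OF that] orbC c1' by blast
    show "neighbours (U - X) v \<noteq> {}" if "neighbours X v \<noteq> {}" "neighbours (X - Y) v = {}" for v
    proof -
      have "v \<in> C'" "m < m'" using noB[OF that] by auto
      then show ?thesis using cU[of v] le'' by auto
    qed
    show "neighbours U x = {z}" "neighbours U z = {x}"
      if "{x, z} \<in> X - Y" "neighbours (X - Y) x = {z}" "neighbours (X - Y) z = {x}"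
        "neighbours (U - X) x = {}" "neighbours (U - X) z = {}" for x z
      using that c3'[of x z] c3'[of z x] X_iff by (auto simp: insert_commute)
    show "\<not> (card (neighbours (U - X) v) = 1 \<and> card (neighbours (U - X) w) = 1)"
      if "{v, w} \<in> U - X" "neighbours X v \<noteq> {}" "neighbours X w \<noteq> {}"
        "neighbours (X - Y) v = {}" "neighbours (X - Y) w = {}" for v w
    proof -
      have "v = w" using noB[of v] noB[of w] that q_inj by metis
      then show ?thesis using that(1) simple_graphD(3)[OF simple] by blast
    qed
  qed
  then show ?thesis by blast
qed

text \<open>All edges at an orbit of size \<open>m\<close> are coloured, such that its vertices receive the red degrees
  \<open>0, \<dots>, m - 1\<close>. Inside the orbit, vertices \<open>x\<close> and \<open>y\<close> with targets \<open>p x\<close> and \<open>p y\<close> are joined by a red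
  edge iff \<open>m \<le> p x + p y\<close>, which leaves just enough room for the edges leaving the orbit.\<close>

lemma spread_step:
  fixes x0
  defines "C \<equiv> orbit A x0"
  assumes x0: "x0 \<in> V" and finC: "finite C" and two: "2 \<le> card C"
    and le: "card C \<le> card (neighbours U x0)"
    and small: "\<And>z. z \<in> V \<Longrightarrow> z \<notin> C \<Longrightarrow> neighbours U z \<inter> C \<noteq> {} \<Longrightarrow>
      card {w \<in> orbit A z. neighbours U w \<inter> C = neighbours U z \<inter> C} \<le> card (neighbours U z - C)"
    and one_left: "\<And>z. z \<in> V \<Longrightarrow> z \<notin> C \<Longrightarrow> neighbours U z \<inter> C \<noteq> {} \<Longrightarrow>
      card (neighbours U z - C) = 1 \<Longrightarrow> card (C - neighbours U z) \<le> 1"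
  shows "\<exists>X Y. colouring_step V U A X Y"
proof -
  define m where "m = card C"
  define D where "D = card (neighbours U x0)"
  have CV: "C \<subseteq> V" using orbit_subset x0 by (simp add: C_def)
  have mD: "m \<le> D" using le by (simp add: m_def D_def)
  have deg: "card (neighbours U x) = D" if "x \<in> C" for x
    using degree_orbit[OF x0] that by (simp add: C_def D_def)
  have finU: "finite (neighbours U x)" if "x \<in> C" for x using fin that CV by blast
  have "card C = card {0..<m}" by (simp add: m_def)
  from finite_same_card_bij[OF finC _ this] obtain p where p: "bij_betw p C {0..<m}" by blast
  have p_less: "p x < m" if "x \<in> C" for x using p that bij_betw_apply by fastforce
  have p_ex: "\<exists>x\<in>C. p x = k" if "k < m" for k
    using p that by (metis atLeast0LessThan bij_betw_imp_surj_on image_iff lessThan_iff)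
  have p_inj: "x = y" if "x \<in> C" "y \<in> C" "p x = p y" for x y
    using p that by (metis bij_betw_def inj_onD)
  have p_inj_on: "inj_on p S" if "S \<subseteq> C" for S
    using p that inj_on_subset by (auto simp: bij_betw_def)
  define ired where "ired x = {y \<in> neighbours U x \<inter> C. m \<le> p x + p y}" for x
  define iblue where "iblue x = {y \<in> neighbours U x \<inter> C. p x + p y < m}" for x
  have ired: "card (ired x) \<le> p x" if "x \<in> C" for x
  proof -
    have "p ` ired x \<subseteq> {m - p x..<m}" using p_less by (auto simp: ired_def)
    then have "card (ired x) \<le> card {m - p x..<m}"
      by (intro card_inj_on_le[OF p_inj_on]) (auto simp: ired_def)
    then show ?thesis using p_less[OF that] by simp
  qed
  have iblue: "card (iblue x) \<le> m - p x" if "x \<in> C" for x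
  proof -
    have "p ` iblue x \<subseteq> {0..<m - p x}" using p_less by (auto simp: iblue_def)
    then have "card (iblue x) \<le> card {0..<m - p x}"
      by (intro card_inj_on_le[OF p_inj_on]) (auto simp: iblue_def)
    then show ?thesis by simp
  qed
  \<comment> \<open>At most \<open>m - p x\<close> of the \<open>D\<close> edges at \<open>x\<close>
    are blue inside the orbit. So at least \<open>D - (m - p x) \<ge> p x\<close> edges are red
    inside or leave the orbit, and the red degree can be filled up outside.\<close>
  have "\<exists>S. S \<subseteq> neighbours U x - C \<and> card S = p x - card (ired x)" if x: "x \<in> C" for x
  proof -
    have "neighbours U x = (neighbours U x - C) \<union> (ired x \<union> iblue x)"
      by (auto simp: ired_def iblue_def)
    then have "D \<le> card (neighbours U x - C) + card (ired x \<union> iblue x)"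
      using deg[OF x] card_Un_le by metis
    then have "D \<le> card (neighbours U x - C) + (card (ired x) + card (iblue x))"
      using card_Un_le[of "ired x" "iblue x"] by linarith
    then have "p x - card (ired x) \<le> card (neighbours U x - C)"
      using iblue[OF x] mD p_less[OF x] by linarith
    then show ?thesis by (meson obtain_subset_with_card_n)
  qed
  then obtain S where S: "\<And>x. x \<in> C \<Longrightarrow> S x \<subseteq> neighbours U x - C"
    "\<And>x. x \<in> C \<Longrightarrow> card (S x) = p x - card (ired x)" by metis
  define X where "X = {e \<in> U. e \<inter> C \<noteq> {}}"
  define Y where "Y = {{x, z} | x z. x \<in> C \<and> z \<in> S x} \<union>
    {{x, y} | x y. x \<in> C \<and> y \<in> C \<and> {x, y} \<in> U \<and> m \<le> p x + p y}"
  have X_iff: "{v, w} \<in> X \<longleftrightarrow> {v, w} \<in> U \<and> (v \<in> C \<or> w \<in> C)" for v w by (auto simp: X_def)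
  have Y_iff: "{v, w} \<in> Y \<longleftrightarrow> v \<in> C \<and> w \<in> S v \<or> w \<in> C \<and> v \<in> S w \<or>
      v \<in> C \<and> w \<in> C \<and> {v, w} \<in> U \<and> m \<le> p v + p w" for v w
    unfolding Y_def by (auto simp: doubleton_eq_iff insert_commute add.commute)
  have SU: "{x, z} \<in> U \<and> z \<notin> C" if "x \<in> C" "z \<in> S x" for x z using S(1)[OF that(1)] that(2) by auto
  have XU: "X \<subseteq> U" by (auto simp: X_def)
  have YX: "Y \<subseteq> X" using SU by (auto simp: X_def Y_def)
  have simY: "simple_graph V Y" using simple simple_graph_mono XU YX by blast
  have nX: "neighbours X x = neighbours U x" "neighbours (U - X) x = {}" if "x \<in> C" for x
    using that by (auto simp: X_iff)
  have nX': "neighbours X z = neighbours U z \<inter> C" "neighbours (U - X) z = neighbours U z - C"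
    if "z \<notin> C" for z using that by (auto simp: X_iff)
  have nY: "neighbours Y x = S x \<union> ired x" if "x \<in> C" for x
    using that SU by (auto simp: Y_iff ired_def)
  have cY: "card (neighbours Y x) = p x" if "x \<in> C" for x
  proof -
    have "finite (S x)" "finite (ired x)" "S x \<inter> ired x = {}"
      using S(1)[OF that] finU[OF that] finite_subset finC by (auto simp: ired_def)
    then show ?thesis using nY[OF that] S(2)[OF that] ired[OF that] by (simp add: card_Un_disjoint)
  qed
  have cB: "card (neighbours (X - Y) x) = D - p x" if "x \<in> C" for x
  proof -
    have sub: "neighbours Y x \<subseteq> neighbours U x" using neighbours_mono[of Y U] XU YX by blast
    have "card (neighbours U x - neighbours Y x) = D - p x"
      using card_Diff_subset[OF finite_subset[OF sub finU[OF that]] sub] deg[OF that] cY[OF that] by simp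
    then show ?thesis using nX(1)[OF that] by (simp add: neighbours_Diff)
  qed
  \<comment> \<open>The blue degree \<open>D - p x\<close> is positive since
    \<open>p x < m \<le> D\<close>. It also differs between vertices of \<open>C\<close>, so that no
    blue edge within \<open>C\<close> has blue degree 1 at both ends.\<close>
  have noB: "v \<notin> C" if "neighbours (X - Y) v = {}" for v
    using cB[of v] that p_less[of v] mD by auto
  have closed: "\<phi> x \<in> C \<longleftrightarrow> x \<in> C" if "\<phi> \<in> A" "x \<in> V" for \<phi> x
    using orbit_mem_iff[OF that x0] by (simp add: C_def)
  have autX: "graph_automorphism V X \<phi>" if "\<phi> \<in> A" for \<phi>
    using closed[OF that] bij[OF that] perm_edge[OF that] by (auto simp: graph_automorphism_def X_iff)
  define A' where "A' = preserving V A Y"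
  have A'A: "\<phi> \<in> A" and A'Y: "graph_automorphism V Y \<phi>" if "\<phi> \<in> A'" for \<phi>
    using that by (auto simp: A'_def preserving_def)
  interpret A': permutation_group V A' unfolding A'_def by (rule preserving_group)
  have fixC: "\<phi> x = x" if "\<phi> \<in> A'" "x \<in> C" for \<phi> x
  proof -
    have xV: "x \<in> V" using that CV by blast
    have "card (neighbours Y (\<phi> x)) = card (neighbours Y x)"
      using automorphism_neighbours[OF A'Y[OF that(1)] simY xV]
        card_image inj_on_subset[OF A'.perm_inj[OF that(1)] neighbours_subset[OF simY]] by metis
    then show ?thesis using cY closed[OF A'A[OF that(1)] xV] that p_inj by metis
  qed
  have sub: "orbit A' z \<subseteq> {w \<in> orbit A z. neighbours U w \<inter> C = neighbours U z \<inter> C}"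
    if z: "z \<in> V" for z
  proof
    fix w assume "w \<in> orbit A' z"
    then obtain \<phi> where \<phi>: "\<phi> \<in> A'" "w = \<phi> z" by (auto simp: orbit_def)
    have "{w, y} \<in> U \<longleftrightarrow> {z, y} \<in> U" if "y \<in> C" for y
      using perm_edge[OF A'A[OF \<phi>(1)] z, of y] fixC[OF \<phi>(1) that] \<phi>(2) that CV by auto
    moreover have "w \<in> orbit A z" using \<phi> A'A by (auto simp: orbit_def)
    ultimately show "w \<in> {w \<in> orbit A z. neighbours U w \<inter> C = neighbours U z \<inter> C}" by auto
  qed
  have finw: "finite {w \<in> orbit A z. neighbours U w \<inter> C = neighbours U z \<inter> C}"
    if "neighbours U z \<inter> C \<noteq> {}" for z
  proof -
    obtain y where y: "y \<in> C" "y \<in> neighbours U z" using \<open>neighbours U z \<inter> C \<noteq> {}\<close> by blast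
    have "{w \<in> orbit A z. neighbours U w \<inter> C = neighbours U z \<inter> C} \<subseteq> neighbours U y"
    proof
      fix w assume "w \<in> {w \<in> orbit A z. neighbours U w \<inter> C = neighbours U z \<inter> C}"
      then have "y \<in> neighbours U w" using y by blast
      then show "w \<in> neighbours U y" using neighbours_commute by metis
    qed
    then show ?thesis using finU[OF y(1)] finite_subset by blast
  qed
  have left: "0 < card (neighbours U z - C)" if "z \<in> V" "z \<notin> C" "neighbours U z \<inter> C \<noteq> {}" for z
  proof -
    have "z \<in> {w \<in> orbit A z. neighbours U w \<inter> C = neighbours U z \<inter> C}" using orbit_refl by simp
    then have "0 < card {w \<in> orbit A z. neighbours U w \<inter> C = neighbours U z \<inter> C}"
      using finw[OF that(3)] card_gt_0_iff by blast
    then show ?thesis using small[OF that] by linarith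
  qed
  have left': "neighbours (U - X) z \<noteq> {}" if "z \<in> V" "z \<notin> C" "neighbours X z \<noteq> {}" for z
  proof -
    have "0 < card (neighbours (U - X) z)"
      using left[OF that(1,2)] that(3) nX'[OF that(2)] by simp
    then show ?thesis by (metis card.empty less_irrefl)
  qed
  \<comment> \<open>A vertex outside \<open>C\<close> all of whose new edges are red misses the
    vertex \<open>y0\<close> of red degree 0. If it has only one uncoloured edge left,
    \<open>one_left\<close> lets it miss no other vertex, so it is the single red neighbour of
    \<open>y1\<close>. Hence there is at most one such vertex, and no edge joins two of
    them.\<close>
  obtain y0 y1 where y0: "y0 \<in> C" "p y0 = 0" and y1: "y1 \<in> C" "p y1 = 1"
    using p_ex[of 0] p_ex[of 1] two m_def by auto
  obtain v1 where v1: "neighbours Y y1 = {v1}" using cY[OF y1(1)] y1(2) card_1_singletonE by metis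
  have red1: "v = v1"
    if "v \<notin> C" "neighbours U v \<inter> C \<noteq> {}" "neighbours (X - Y) v = {}" "card (neighbours U v - C) = 1" for v
  proof -
    have vV: "v \<in> V" using that(2) neighbours_outside[OF simple] by blast
    have red: "v \<in> neighbours Y y" if "y \<in> C" "y \<in> neighbours U v" for y
      using that \<open>neighbours (X - Y) v = {}\<close> X_iff neighbours_commute[of v Y y] by auto
    have "finite (neighbours Y y0)" using finite_subset[OF neighbours_mono finU[OF y0(1)]] XU YX by blast
    then have "neighbours Y y0 = {}" using cY[OF y0(1)] y0(2) by simp
    then have "y0 \<notin> neighbours U v" using red[OF y0(1)] by blast
    moreover have "card (C - neighbours U v) \<le> 1" using one_left[OF vV that(1,2,4)] .
    moreover have "y0 \<noteq> y1" using y0 y1 by auto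
    ultimately have "y1 \<in> neighbours U v"
      using y0(1) y1(1) finC card_le_Suc0_iff_eq[of "C - neighbours U v"]
      by (metis Diff_iff One_nat_def finite_Diff)
    then have "v \<in> neighbours Y y1" using red[OF y1(1)] by blast
    then show ?thesis using v1 by blast
  qed
  have "colouring_step V U A X Y"
    unfolding colouring_step_def A'_def[symmetric]
  proof (intro conjI ballI allI impI)
    show "X \<subseteq> U" "Y \<subseteq> X" by fact+
    show "X \<noteq> {}"
    proof -
      have "neighbours X x0 \<noteq> {}" using nX(1)[of x0] orbit_refl le two unfolding C_def by fastforce
      then show ?thesis by auto
    qed
    show "graph_automorphism V X \<phi>" if "\<phi> \<in> A" for \<phi> using autX that .
    show "orbit A' v = {v} \<or> finite (orbit A' v) \<and> card (orbit A' v) \<le> card (neighbours (U - X) v)"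
      if v: "v \<in> V" "neighbours X v \<noteq> {}" for v
    proof (cases "v \<in> C")
      case True
      then show ?thesis using A'.fixed_orbit fixC by blast
    next
      case False
      have ne: "neighbours U v \<inter> C \<noteq> {}" using v(2) nX'(1)[OF False] by simp
      have "card (orbit A' v) \<le> card (neighbours U v - C)"
        using card_mono[OF finw[OF ne] sub[OF v(1)]] small[OF v(1) False ne] by linarith
      then show ?thesis
        using nX'(2)[OF False] finite_subset[OF sub[OF v(1)] finw[OF ne]] by simp
    qed
    show "neighbours (U - X) v \<noteq> {}"
      if "v \<in> V" "neighbours X v \<noteq> {}" "neighbours (X - Y) v = {}" for v
      using left'[OF that(1) noB[OF that(3)] that(2)] .
    show "neighbours U x = {z}" "neighbours U z = {x}"
      if h: "{x, z} \<in> X - Y" "neighbours (X - Y) x = {z}" "neighbours (X - Y) z = {x}"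
        "neighbours (U - X) x = {}" "neighbours (U - X) z = {}" for x z
    proof -
      have V: "x \<in> V" "z \<in> V" "x \<noteq> z" using h(1) simple_graphD[OF simple] XU by blast+
      have inC: "v \<in> C" if "neighbours (U - X) v = {}" "neighbours (X - Y) v \<noteq> {}" "v \<in> V" for v
      proof (rule ccontr)
        assume "v \<notin> C"
        moreover have "neighbours X v \<noteq> {}" using that(2) by auto
        ultimately show False using left'[of v] that by blast
      qed
      have "x \<in> C" using inC[OF h(4) _ V(1)] h(2) by simp
      have "z \<in> C" using inC[OF h(5) _ V(2)] h(3) by simp
      have "D - p x = 1" "D - p z = 1" using cB[OF \<open>x \<in> C\<close>] cB[OF \<open>z \<in> C\<close>] h(2,3) by simp_all
      then have "p x = p z" using p_less \<open>x \<in> C\<close> \<open>z \<in> C\<close> mD by force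
      then have False using p_inj \<open>x \<in> C\<close> \<open>z \<in> C\<close> V by blast
      then show "neighbours U x = {z}" "neighbours U z = {x}" by simp_all
    qed
    show "\<not> (card (neighbours (U - X) v) = 1 \<and> card (neighbours (U - X) w) = 1)"
      if h: "{v, w} \<in> U - X" "neighbours X v \<noteq> {}" "neighbours X w \<noteq> {}"
        "neighbours (X - Y) v = {}" "neighbours (X - Y) w = {}" for v w
    proof
      assume one: "card (neighbours (U - X) v) = 1 \<and> card (neighbours (U - X) w) = 1"
      have "v \<notin> C" "w \<notin> C" using noB h by blast+
      then have "v = w" using red1[of v] red1[of w] nX' h one by auto
      then show False using h(1) simple_graphD(3)[OF simple] by blast
    qed
  qed
  then show ?thesis by blast
qed

end

section \<open>Counting and inequalities for classes of twins\<close>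

lemma card_fibres:
  assumes "finite S" "\<And>x. x \<in> S \<Longrightarrow> card {y \<in> S. f y = f x} = k"
  shows "card S = k * card (f ` S)"
proof -
  have "card S = (\<Sum>y\<in>f ` S. card {x \<in> S. f x = y})"
    using sum.image_gen[OF assms(1), of "\<lambda>_. 1::nat" f] by simp
  also have "\<dots> = (\<Sum>y\<in>f ` S. k)" by (rule sum.cong) (auto simp: assms(2))
  finally show ?thesis by simp
qed

lemma image_Collect_eq:
  assumes im: "f ` C = C" and eq: "\<And>w. w \<in> C \<Longrightarrow> P (f w) \<longleftrightarrow> R w"
  shows "{w \<in> C. P w} = f ` {w \<in> C. R w}"
proof
  show "f ` {w \<in> C. R w} \<subseteq> {w \<in> C. P w}" using assms by auto
  show "{w \<in> C. P w} \<subseteq> f ` {w \<in> C. R w}"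
  proof
    fix w assume w: "w \<in> {w \<in> C. P w}"
    then obtain v where "v \<in> C" "w = f v" using im by (metis (no_types, lifting) image_iff mem_Collect_eq)
    then show "w \<in> f ` {w \<in> C. R w}" using w eq by auto
  qed
qed

text \<open>Guarantees enough \<open>s\<close>-element sets of positions to give every class of
  twins its own.\<close>

lemma le_choose:
  assumes "1 \<le> s" "s < n"
  shows "n \<le> n choose s"
  using assms
proof (induction n arbitrary: s)
  case (Suc n)
  obtain t where t: "s = Suc t" using Suc.prems by (cases s) auto
  show ?case
  proof (cases "s = n")
    case True
    then show ?thesis by simp
  next
    case False
    then have "n \<le> n choose s" using Suc by simp
    moreover have "1 \<le> n choose t" using t Suc.prems by (simp add: Suc_leI zero_less_binomial)
    ultimately show ?thesis using t by simp
  qed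
qed simp

text \<open>Division gives \<open>\<mu> \<le> D / \<kappa>\<close> and
  \<open>b \<le> D * \<kappa> / \<nu>\<close>. If \<open>\<nu> \<ge> \<kappa> + 2\<close> and
  \<open>\<kappa> \<ge> 2\<close>, then \<open>1 / \<kappa> + \<kappa> / \<nu> \<le> 1\<close>, so
  that \<open>\<mu> + b \<le> D\<close>, against the fourth assumption. In the application also
  \<open>\<kappa> < \<nu>\<close>, so a vertex of \<open>C\<close> misses exactly one class of
  twins.\<close>

lemma block_arith1:
  fixes \<kappa> \<nu> \<mu> b m D :: nat
  assumes "m * \<kappa> = \<nu> * b" "\<kappa> * \<mu> \<le> D" "m \<le> D" "D + 2 \<le> \<mu> + b" "2 \<le> \<kappa>"
  shows "\<nu> \<le> \<kappa> + 1"
proof (rule ccontr)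
  assume "\<not> \<nu> \<le> \<kappa> + 1"
  then have \<nu>: "\<kappa> + 2 \<le> \<nu>" by simp
  have "\<kappa> * \<nu> * (D + 2) \<le> \<kappa> * \<nu> * (\<mu> + b)" using assms(4) by (rule mult_le_mono2)
  also have "\<dots> = \<nu> * (\<kappa> * \<mu>) + \<kappa> * (\<nu> * b)" by (simp add: algebra_simps)
  also have "\<dots> = \<nu> * (\<kappa> * \<mu>) + \<kappa> * \<kappa> * m" using assms(1) by (simp add: algebra_simps)
  also have "\<dots> \<le> \<nu> * D + \<kappa> * \<kappa> * D" using assms(2,3) by (intro add_mono mult_le_mono2)
  finally have 1: "\<kappa> * \<nu> * D + 2 * (\<kappa> * \<nu>) \<le> (\<nu> + \<kappa> * \<kappa>) * D" by (simp add: algebra_simps)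
  obtain j where j: "\<nu> = \<kappa> + 2 + j" using \<nu> le_Suc_ex by blast
  obtain i where i: "\<kappa> = 2 + i" using assms(5) le_Suc_ex by blast
  have "\<nu> + \<kappa> * \<kappa> \<le> \<kappa> * \<nu>" by (simp add: i j algebra_simps)
  then have "(\<nu> + \<kappa> * \<kappa>) * D \<le> \<kappa> * \<nu> * D" by (rule mult_le_mono1)
  then have "2 * (\<kappa> * \<nu>) = 0" using 1 by linarith
  then show False using assms(5) \<nu> by simp
qed

text \<open>The first two conclusions provide enough \<open>s\<close>-subsets of
  \<open>\<mu>\<close> positions. The third says that \<open>\<mu> - s + 1\<close>, a bound for the
  parts into which \<open>s\<close> thresholds cut a class of \<open>\<mu>\<close> vertices, is at
  most the remaining degree \<open>d - b\<close>. For \<open>\<kappa> = 1\<close> it follows from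
  \<open>\<mu> \<le> D < d\<close> and \<open>b \<le> s\<close>. For \<open>\<kappa> \<ge> 2\<close>
  one has \<open>b = m * \<kappa> / (\<kappa> + 1)\<close> and
  \<open>s \<ge> m / (\<kappa> + 1)\<close>, hence
  \<open>b - s \<le> (\<kappa> - 1) * D / \<kappa>\<close>, and this together with
  \<open>\<mu> \<le> D / \<kappa>\<close> gives \<open>\<mu> + b \<le> D + s\<close>.\<close>

lemma block_arith2:
  fixes \<kappa> \<nu> \<mu> b m D d s n :: nat
  assumes "m * \<kappa> = \<nu> * b" "\<kappa> * \<mu> \<le> D" "m \<le> D" "D < d" "d < \<mu> + b" "\<kappa> < \<nu>"
    "s \<le> m - b" "b < m" "s * n = m" "n \<le> \<nu>" "1 \<le> \<kappa>" "\<kappa> = 1 \<Longrightarrow> b \<le> s" "0 < b"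
    "2 \<le> \<kappa> \<Longrightarrow> \<nu> = \<kappa> + 1"
  shows "s < \<mu>" "n \<le> \<mu>" "\<mu> + b + 1 \<le> d + s"
proof -
  show "s < \<mu>" using assms by linarith
  have "n \<le> \<mu> \<and> \<mu> + b + 1 \<le> d + s"
  proof (cases "\<kappa> = 1")
    case True
    then have le: "\<mu> \<le> D" "b \<le> s" "\<nu> * b = m" using assms by auto
    have "b \<noteq> 1" using le assms(4,5) by auto
    then obtain b' where b': "b = 2 + b'" using \<open>0 < b\<close>
      by (metis One_nat_def Suc_leI le_Suc_ex le_neq_implies_less one_add_one plus_1_eq_Suc)
    obtain j where j: "\<nu> = 2 + j" using assms(6) True le_Suc_ex
      by (metis Suc_leI one_add_one plus_1_eq_Suc)
    have "\<nu> + b \<le> \<nu> * b" by (simp add: b' j algebra_simps)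
    then show ?thesis using le assms(3-6,10) by linarith
  next
    case False
    then have k2: "2 \<le> \<kappa>" using assms(11) by simp
    then have \<nu>: "\<nu> = \<kappa> + 1" using assms(14) by simp
    have "(\<kappa> + 1) * (D + 2) \<le> (\<kappa> + 1) * (\<mu> + b)" using assms(4,5) by (intro mult_le_mono2) linarith
    also have "\<dots> = (\<kappa> + 1) * \<mu> + m * \<kappa>" using assms(1) \<nu> by (simp add: algebra_simps)
    also have "\<dots> \<le> \<kappa> * \<mu> + \<mu> + D * \<kappa>" using assms(3) by simp
    finally have "2 * (\<kappa> + 1) \<le> \<mu>" using assms(2) by (simp add: algebra_simps)
    then have 1: "n \<le> \<mu>" using assms(10) \<nu> by simp
    have sm: "m \<le> s * (\<kappa> + 1)" using assms(9,10) \<nu> by (metis mult_le_mono2)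
    have "\<kappa> * (\<kappa> + 1) * (\<mu> + b) = (\<kappa> + 1) * (\<kappa> * \<mu>) + \<kappa> * (\<nu> * b)" by (simp add: \<nu> algebra_simps)
    also have "\<dots> = (\<kappa> + 1) * (\<kappa> * \<mu>) + \<kappa> * \<kappa> * m" using assms(1) by (simp add: algebra_simps)
    also have "\<dots> \<le> (\<kappa> + 1) * D + \<kappa> * \<kappa> * m" using assms(2) by (intro add_mono mult_le_mono2) auto
    also have "\<dots> \<le> \<kappa> * (\<kappa> + 1) * D + \<kappa> * m"
    proof -
      obtain i where i: "\<kappa> = 2 + i" using k2 le_Suc_ex by blast
      have "(\<kappa> - 1) * \<kappa> * m \<le> (\<kappa> - 1) * (\<kappa> + 1) * D" using assms(3) by (intro mult_le_mono) auto
      then show ?thesis by (simp add: i algebra_simps)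
    qed
    also have "\<dots> \<le> \<kappa> * (\<kappa> + 1) * D + \<kappa> * (s * (\<kappa> + 1))" using sm by (intro add_mono mult_le_mono2) auto
    finally have "\<kappa> * (\<kappa> + 1) * (\<mu> + b) \<le> \<kappa> * (\<kappa> + 1) * (D + s)" by (simp add: algebra_simps)
    then have "\<mu> + b \<le> D + s" using k2 by (metis add_gr_0 mult_le_cancel1 nat_0_less_mult_iff not_less
          not_numeral_le_zero zero_less_one le_0_eq)
    then show ?thesis using 1 assms(4) by linarith
  qed
  then show "n \<le> \<mu>" "\<mu> + b + 1 \<le> d + s" by auto
qed

section \<open>Splitting classes of twins that are too large\<close>

context acted_graph
begin

text \<open>Here a vertex of the orbit \<open>C'\<close> would share its neighbours in \<open>C\<close> with too many others for
  \<open>spread_step\<close>. The twin classes of \<open>C\<close> with respect to \<open>C'\<close> are told apart by assigning to them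
  distinct sets of red degrees.\<close>

lemma block_step:
  fixes x0 z0
  defines "C \<equiv> orbit A x0" and "C' \<equiv> orbit A z0"
  assumes x0: "x0 \<in> V" and z0: "z0 \<in> V" and ne: "z0 \<notin> C" and finC: "finite C"
    and le: "card C \<le> card (neighbours U x0)" and less: "card (neighbours U x0) < card (neighbours U z0)"
    and adj: "neighbours U z0 \<inter> C \<noteq> {}" and nadj: "\<not> C \<subseteq> neighbours U z0"
    and large: "card (neighbours U z0) <
      card {w \<in> C'. neighbours U w \<inter> C = neighbours U z0 \<inter> C} + card (neighbours U z0 \<inter> C)"
  shows "\<exists>X Y. colouring_step V U A X Y"
proof -
  have CV: "C \<subseteq> V" "C' \<subseteq> V" using orbit_subset x0 z0 by (auto simp: C_def C'_def)
  have x0C: "x0 \<in> C" "z0 \<in> C'" using orbit_refl by (auto simp: C_def C'_def)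
  have disj: "C \<inter> C' = {}"
    using ne orbit_eq[OF x0] orbit_sym[OF z0] unfolding C_def C'_def by blast
  define B where "B z = neighbours U z \<inter> C" for z
  define Q where "Q z = {w \<in> C'. B w = B z}" for z
  define T where "T x = neighbours U x \<inter> C'" for x
  define P where "P x = {y \<in> C. T y = T x}" for x
  define m where "m = card C"
  define D where "D = card (neighbours U x0)"
  define d where "d = card (neighbours U z0)"
  define b where "b = card (B z0)"
  define \<mu> where "\<mu> = card (Q z0)"
  define s where "s = card (P x0)"
  have TB: "z \<in> T x \<longleftrightarrow> x \<in> B z" if "x \<in> C" "z \<in> C'" for x z
    using that neighbours_commute[of z U x] by (auto simp: T_def B_def)
  have imC: "\<phi> ` C = C" "\<phi> ` C' = C'" if "\<phi> \<in> A" for \<phi>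
    using orbit_image[OF x0 that] orbit_image[OF z0 that] by (simp_all add: C_def C'_def)
  have imB: "B (\<phi> z) = \<phi> ` B z" if "\<phi> \<in> A" "z \<in> C'" for \<phi> z
    using perm_neighbours_orbit[OF that(1) _ x0] that CV by (auto simp: B_def C_def)
  have imT: "T (\<phi> x) = \<phi> ` T x" if "\<phi> \<in> A" "x \<in> C" for \<phi> x
    using perm_neighbours_orbit[OF that(1) _ z0] that CV by (auto simp: T_def C'_def)
  have subV: "B z \<subseteq> V" "T x \<subseteq> V" for z x using CV by (auto simp: B_def T_def)
  have imQ: "Q (\<phi> z) = \<phi> ` Q z" if "\<phi> \<in> A" "z \<in> C'" for \<phi> z
  proof -
    have "B (\<phi> w) = B (\<phi> z) \<longleftrightarrow> B w = B z" if "w \<in> C'" for w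
      using imB[OF \<open>\<phi> \<in> A\<close> that] imB[OF \<open>\<phi> \<in> A\<close> \<open>z \<in> C'\<close>] inj_on_image_eq_iff[OF perm_inj[OF \<open>\<phi> \<in> A\<close>] subV(1) subV(1)] by simp
    then show ?thesis unfolding Q_def by (rule image_Collect_eq[OF imC(2)[OF that(1)]])
  qed
  have imP: "P (\<phi> x) = \<phi> ` P x" if "\<phi> \<in> A" "x \<in> C" for \<phi> x
  proof -
    have "T (\<phi> w) = T (\<phi> x) \<longleftrightarrow> T w = T x" if "w \<in> C" for w
      using imT[OF \<open>\<phi> \<in> A\<close> that] imT[OF \<open>\<phi> \<in> A\<close> \<open>x \<in> C\<close>] inj_on_image_eq_iff[OF perm_inj[OF \<open>\<phi> \<in> A\<close>] subV(2) subV(2)] by simp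
    then show ?thesis unfolding P_def by (rule image_Collect_eq[OF imC(1)[OF that(1)]])
  qed
  have card_im: "card (\<phi> ` S) = card S" if "\<phi> \<in> A" "S \<subseteq> V" for \<phi> S
    using card_image inj_on_subset[OF perm_inj] that by metis
  have cB: "card (B z) = b" and cQ: "card (Q z) = \<mu>" if "z \<in> C'" for z
  proof -
    obtain \<phi> where \<phi>: "\<phi> \<in> A" "z = \<phi> z0" using \<open>z \<in> C'\<close> by (auto simp: C'_def orbit_def)
    show "card (B z) = b" using imB[OF \<phi>(1) x0C(2)] card_im[OF \<phi>(1) subV(1)] \<phi>(2) b_def by simp
    have "Q z0 \<subseteq> V" using CV by (auto simp: Q_def)
    then show "card (Q z) = \<mu>" using imQ[OF \<phi>(1) x0C(2)] card_im[OF \<phi>(1)] \<phi>(2) \<mu>_def by simp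
  qed
  have cT: "card (T x) = card (T x0)" and cP: "card (P x) = s" if "x \<in> C" for x
  proof -
    obtain \<phi> where \<phi>: "\<phi> \<in> A" "x = \<phi> x0" using \<open>x \<in> C\<close> by (auto simp: C_def orbit_def)
    show "card (T x) = card (T x0)" using imT[OF \<phi>(1) x0C(1)] card_im[OF \<phi>(1) subV(2)] \<phi>(2) by simp
    have "P x0 \<subseteq> V" using CV by (auto simp: P_def)
    then show "card (P x) = s" using imP[OF \<phi>(1) x0C(1)] card_im[OF \<phi>(1)] \<phi>(2) s_def by simp
  qed
  have finB: "finite (B z)" for z using finC by (simp add: B_def)
  have b0: "0 < b" using adj finB[of z0] by (simp add: b_def B_def card_gt_0_iff)
  have bm: "b < m"
    unfolding b_def m_def using nadj by (intro psubset_card_mono[OF finC]) (auto simp: B_def)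
  have finT: "finite (T x)" if "x \<in> C" for x using fin that CV by (auto simp: T_def)
  have "C' \<subseteq> (\<Union>x\<in>C. T x)"
  proof
    fix z assume z: "z \<in> C'"
    then have "B z \<noteq> {}" using cB[OF z] b0 by auto
    then show "z \<in> (\<Union>x\<in>C. T x)" using TB z by (auto simp: B_def)
  qed
  then have finC': "finite C'" using finC finT finite_subset by (metis finite_UN)
  have finQ: "finite (Q z)" for z using finC' by (simp add: Q_def)
  have finP: "finite (P x)" for x using finC by (simp add: P_def)
  have selfQ: "z \<in> Q z" if "z \<in> C'" for z using that by (simp add: Q_def)
  have selfP: "x \<in> P x" if "x \<in> C" for x using that by (simp add: P_def)
  have Q_eq: "Q w = Q z \<longleftrightarrow> B w = B z" if "w \<in> C'" "z \<in> C'" for w z using that by (auto simp: Q_def)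
  have P_eq: "P w = P x \<longleftrightarrow> T w = T x" if "w \<in> C" "x \<in> C" for w x using that by (auto simp: P_def)
  have QT: "Q z \<subseteq> T x" if "z \<in> T x" "x \<in> C" for x z
    using that TB by (auto simp: Q_def T_def)
  have PB: "P x \<subseteq> B z" if "x \<in> B z" "z \<in> C'" for x z
  proof
    fix y assume "y \<in> P x"
    then have y: "y \<in> C" "T y = T x" by (simp_all add: P_def)
    have "x \<in> C" using that by (simp add: B_def)
    then show "y \<in> B z" using TB[OF y(1) that(2)] TB[OF _ that(2), of x] that(1) y(2) by simp
  qed
  have \<mu>0: "0 < \<mu>" using selfQ x0C finQ by (auto simp: \<mu>_def card_gt_0_iff)
  \<comment> \<open>A class \<open>Q z\<close> lies inside \<open>T x\<close> or is disjoint from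
    it, so the edges between the orbits can be counted by classes: \<open>\<kappa>\<close> of the
    \<open>\<nu>\<close> classes of \<open>C'\<close> are adjacent to a given vertex of
    \<open>C\<close>, and \<open>C\<close> itself consists of \<open>n\<close> classes of size
    \<open>s\<close>.\<close>
  define \<kappa> where "\<kappa> = card (Q ` T x0)"
  define \<nu> where "\<nu> = card (Q ` C')"
  define n where "n = card (P ` C)"
  have cT\<kappa>: "card (T x) = \<mu> * card (Q ` T x)" if "x \<in> C" for x
  proof (rule card_fibres[OF finT[OF that]])
    fix z assume z: "z \<in> T x"
    then have "{y \<in> T x. Q y = Q z} = Q z"
      using QT[OF z that] Q_eq[of _ z] by (auto simp: T_def Q_def)
    then show "card {y \<in> T x. Q y = Q z} = \<mu>" using cQ z by (simp add: T_def)
  qed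
  have \<kappa>x: "card (Q ` T x) = \<kappa>" if "x \<in> C" for x
    using cT\<kappa>[OF that] cT\<kappa>[OF x0C(1)] cT[OF that] \<mu>0 by (simp add: \<kappa>_def)
  have m': "card C' = \<mu> * \<nu>"
    unfolding \<nu>_def
  proof (rule card_fibres[OF finC'])
    fix z assume z: "z \<in> C'"
    then have "{y \<in> C'. Q y = Q z} = Q z" using Q_eq[of _ z] by (auto simp: Q_def)
    then show "card {y \<in> C'. Q y = Q z} = \<mu>" using cQ z by simp
  qed
  have mn: "m = s * n"
    unfolding m_def n_def
  proof (rule card_fibres[OF finC])
    fix x assume x: "x \<in> C"
    then have "{y \<in> C. P y = P x} = P x" using P_eq[of _ x] by (auto simp: P_def)
    then show "card {y \<in> C. P y = P x} = s" using cP x by simp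
  qed
  have "m * card (T x0) = card C' * b"
  proof -
    have "(\<Sum>x\<in>C. card {z \<in> C'. z \<in> T x}) = b * card C'"
      by (rule sum_multicount[OF finC finC'])
        (use TB cB in \<open>force simp: B_def intro!: arg_cong[of _ _ card]\<close>)
    moreover have "card {z \<in> C'. z \<in> T x} = card (T x0)" if "x \<in> C" for x
      using cT[OF that] by (simp add: T_def Int_def conj_commute)
    ultimately show ?thesis by (simp add: m_def mult.commute)
  qed
  then have "\<mu> * (m * \<kappa>) = \<mu> * (\<nu> * b)"
    using m' cT\<kappa>[OF x0C(1)] by (simp add: \<kappa>_def algebra_simps)
  then have mk: "m * \<kappa> = \<nu> * b" using \<mu>0 by simp
  have \<nu>0: "0 < \<nu>" using x0C finC' by (auto simp: \<nu>_def card_gt_0_iff)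
  have \<kappa>1: "1 \<le> \<kappa>" using mk \<nu>0 b0 by (cases \<kappa>) auto
  have \<kappa>\<nu>: "\<kappa> < \<nu>"
  proof (rule ccontr)
    assume "\<not> \<kappa> < \<nu>"
    then have "\<nu> * b < \<kappa> * m" using bm \<nu>0 by (simp add: mult_le_less_imp_less)
    then show False using mk by (simp add: mult.commute)
  qed
  have kD: "\<kappa> * \<mu> \<le> D"
  proof -
    have "card (T x0) \<le> D" unfolding D_def T_def using fin[OF x0] by (intro card_mono) auto
    then show ?thesis using cT\<kappa>[OF x0C(1)] by (simp add: \<kappa>_def mult.commute)
  qed
  have mD: "m \<le> D" and Dd: "D < d" using le less by (simp_all add: m_def D_def d_def)
  have viol: "d < \<mu> + b" using large by (simp add: d_def \<mu>_def b_def Q_def B_def)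
  \<comment> \<open>Some vertex of \<open>C\<close> is not adjacent to \<open>z0\<close>, and then
    its whole class of twins avoids \<open>B z0\<close>.\<close>
  have smb: "s \<le> m - b"
  proof -
    obtain x where x: "x \<in> C" "x \<notin> B z0" using nadj unfolding B_def by blast
    have "P x \<subseteq> C - B z0"
    proof
      fix y assume "y \<in> P x"
      then have "y \<in> C" "x \<in> P y" using x(1) by (simp_all add: P_def)
      then show "y \<in> C - B z0" using PB[OF _ x0C(2), of y] x(2) by blast
    qed
    then have "card (P x) \<le> card (C - B z0)" using finC by (intro card_mono) auto
    then show ?thesis
      using cP[OF x(1)] card_Diff_subset[OF finB, of z0 C] by (simp add: m_def b_def B_def)
  qed
  \<comment> \<open>All neighbours of \<open>z0\<close> in \<open>C\<close> see exactly the class of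
    \<open>z0\<close>, hence they are twins of each other.\<close>
  have \<kappa>b: "b \<le> s" if k1: "\<kappa> = 1"
  proof -
    obtain x where x: "x \<in> B z0" using adj unfolding B_def by blast
    have TQ: "T y = Q z0" if y: "y \<in> B z0" for y
    proof
      have "y \<in> C" using y by (simp add: B_def)
      then have yC: "y \<in> C" "z0 \<in> T y" using TB[OF _ x0C(2)] y by simp_all
      show "Q z0 \<subseteq> T y" using QT yC by blast
      show "T y \<subseteq> Q z0"
      proof
        fix w assume w: "w \<in> T y"
        have "card (Q ` T y) = 1" using \<kappa>x[OF yC(1)] k1 by simp
        then have "Q w = Q z0" using w yC(2) by (metis card_1_singletonE image_eqI singletonD)
        then show "w \<in> Q z0" using selfQ[of w] w by (simp add: T_def)
      qed
    qed
    have "B z0 \<subseteq> P x"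
    proof
      fix y assume y: "y \<in> B z0"
      then have "y \<in> C" by (simp add: B_def)
      then show "y \<in> P x" using TQ[OF y] TQ[OF x] by (simp add: P_def)
    qed
    then have "card (B z0) \<le> card (P x)" using finP by (intro card_mono) auto
    then show ?thesis using cP[of x] x by (simp add: b_def B_def)
  qed
  have \<nu>\<kappa>: "\<nu> = \<kappa> + 1" if "2 \<le> \<kappa>"
    using block_arith1[OF mk kD mD _ that] viol Dd \<kappa>\<nu> by simp
  have nT: "n = card (T ` C)"
  proof -
    have "P ` C = (\<lambda>t. {y \<in> C. T y = t}) ` T ` C" by (simp add: image_image P_def)
    moreover have "inj_on (\<lambda>t. {y \<in> C. T y = t}) (T ` C)" by (rule inj_onI) blast
    ultimately show ?thesis unfolding n_def by (simp add: card_image)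
  qed
  \<comment> \<open>Each set \<open>T x\<close> is determined by a single class of
    \<open>C'\<close>: the one it equals if \<open>\<kappa> = 1\<close>, the one it misses if
    \<open>\<nu> = \<kappa> + 1\<close>.\<close>
  have n\<nu>: "n \<le> \<nu>"
  proof (cases "\<kappa> = 1")
    case True
    have "T ` C \<subseteq> Q ` C'"
    proof
      fix t assume "t \<in> T ` C"
      then obtain x where x: "x \<in> C" "t = T x" by blast
      obtain q where q: "Q ` T x = {q}" using \<kappa>x[OF x(1)] True card_1_singletonE by metis
      then obtain z where z: "z \<in> T x" by blast
      have "T x = Q z"
      proof
        show "Q z \<subseteq> T x" using QT z x by blast
        show "T x \<subseteq> Q z"
        proof
          fix w assume w: "w \<in> T x"
          then have "Q w = Q z" using q z by blast
          then show "w \<in> Q z" using selfQ[of w] w by (simp add: T_def)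
        qed
      qed
      then show "t \<in> Q ` C'" using x z by (auto simp: T_def)
    qed
    then show ?thesis unfolding nT \<nu>_def using finC' by (intro card_mono) auto
  next
    case False
    then have \<nu>: "\<nu> = \<kappa> + 1" using \<kappa>1 \<nu>\<kappa> by simp
    have "T ` C \<subseteq> (\<lambda>q. C' - q) ` Q ` C'"
    proof
      fix t assume "t \<in> T ` C"
      then obtain x where x: "x \<in> C" "t = T x" by blast
      have dis: "Q ` T x \<inter> Q ` (C' - T x) = {}"
      proof (rule ccontr)
        assume "\<not> ?thesis"
        then obtain w z where wz: "w \<in> T x" "z \<in> C'" "z \<notin> T x" "Q w = Q z" by blast
        then have "z \<in> Q w" using selfQ by blast
        then show False using QT[OF wz(1) x(1)] wz(3) by blast
      qed
      have "Q ` C' = Q ` T x \<union> Q ` (C' - T x)" by (auto simp: T_def)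
      then have "card (Q ` (C' - T x)) = 1"
        using card_Un_disjoint[OF _ _ dis] finC' finT[OF x(1)] \<nu> \<kappa>x[OF x(1)] by (simp add: \<nu>_def)
      then obtain q where q: "Q ` (C' - T x) = {q}" using card_1_singletonE by metis
      then obtain z where z: "z \<in> C' - T x" by blast
      have "C' - T x = Q z"
      proof
        show "Q z \<subseteq> C' - T x"
        proof
          fix w assume "w \<in> Q z"
          then have w: "w \<in> C'" "z \<in> Q w" using z by (auto simp: Q_def)
          then show "w \<in> C' - T x" using QT[of w x] x z by blast
        qed
        show "C' - T x \<subseteq> Q z"
        proof
          fix w assume w: "w \<in> C' - T x"
          then have "Q w = Q z" using q z by blast
          then show "w \<in> Q z" using selfQ[of w] w by simp
        qed
      qed
      then have "T x = C' - Q z" by (auto simp: T_def)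
      then show "t \<in> (\<lambda>q. C' - q) ` Q ` C'" using x z by blast
    qed
    then have "card (T ` C) \<le> card ((\<lambda>q. C' - q) ` Q ` C')" using finC' by (intro card_mono) auto
    also have "\<dots> \<le> \<nu>" unfolding \<nu>_def using finC' by (intro card_image_le) auto
    finally show ?thesis unfolding nT .
  qed
  note ar = block_arith2[OF mk kD mD Dd viol \<kappa>\<nu> smb bm mn[symmetric] n\<nu> \<kappa>1 \<kappa>b b0 \<nu>\<kappa>]
  have s1: "1 \<le> s" using mn bm by (cases s) auto
  \<comment> \<open>Every class of \<open>C\<close> receives its own set of \<open>s\<close> red
    degrees. The set will identify the class, and the red degree the vertex within the
    class.\<close>
  have "\<exists>f. f ` (P ` C) \<subseteq> {S. S \<subseteq> {0..<\<mu>} \<and> card S = s} \<and> inj_on f (P ` C)"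
  proof (rule card_le_inj)
    show "finite (P ` C)" using finC by simp
    show "finite {S. S \<subseteq> {0..<\<mu>} \<and> card S = s}" by simp
    show "card (P ` C) \<le> card {S. S \<subseteq> {0..<\<mu>} \<and> card S = s}"
      using n_subsets[of "{0..<\<mu>}" s] le_choose[OF s1 ar(1)] ar(2) by (simp add: n_def)
  qed
  then obtain f where f0: "f ` (P ` C) \<subseteq> {S. S \<subseteq> {0..<\<mu>} \<and> card S = s}"
    and f_inj: "inj_on f (P ` C)" by (elim exE conjE)
  have f: "f (P x) \<subseteq> {0..<\<mu>}" "card (f (P x)) = s" "finite (f (P x))" if "x \<in> C" for x
  proof -
    have "f (P x) \<in> {S. S \<subseteq> {0..<\<mu>} \<and> card S = s}" using f0 that by (simp add: image_subset_iff)
    then show "f (P x) \<subseteq> {0..<\<mu>}" "card (f (P x)) = s" by simp_all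
    then show "finite (f (P x))" using finite_subset by blast
  qed
  have "\<forall>q\<in>P ` C. \<exists>k. bij_betw k q (f q)"
  proof
    fix q assume "q \<in> P ` C"
    then obtain x where x: "x \<in> C" "q = P x" by blast
    then show "\<exists>k. bij_betw k q (f q)"
      using finite_same_card_bij[OF finP[of x] f(3)[OF x(1)]] f(2)[OF x(1)] cP[OF x(1)] by simp
  qed
  from bchoice[OF this] obtain g where g: "\<forall>q\<in>P ` C. bij_betw (g q) q (f q)" by blast
  define r where "r x = g (P x) x" for x
  have rP: "bij_betw r (P x) (f (P x))" if "x \<in> C" for x
  proof -
    have "r y = g (P x) y" if "y \<in> P x" for y
      using that \<open>x \<in> C\<close> P_eq[of y x] by (auto simp: r_def P_def)
    then have "bij_betw r (P x) (f (P x)) \<longleftrightarrow> bij_betw (g (P x)) (P x) (f (P x))"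
      by (rule bij_betw_cong)
    then show ?thesis using g that by simp
  qed
  have r_less: "r x < \<mu>" if "x \<in> C" for x
    using bij_betw_apply[OF rP[OF that] selfP[OF that]] f(1)[OF that] by auto
  have "\<forall>q\<in>Q ` C'. \<exists>k. bij_betw k q {0..<\<mu>}"
  proof
    fix q assume "q \<in> Q ` C'"
    then obtain z where z: "z \<in> C'" "q = Q z" by blast
    then show "\<exists>k. bij_betw k q {0..<\<mu>}"
      using finite_same_card_bij[OF finQ[of z], of "{0..<\<mu>}"] cQ[OF z(1)] by simp
  qed
  from bchoice[OF this] obtain h where h: "\<forall>q\<in>Q ` C'. bij_betw (h q) q {0..<\<mu>}" by blast
  define pos where "pos z = h (Q z) z" for z
  have posQ: "bij_betw pos (Q z) {0..<\<mu>}" if "z \<in> C'" for z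
  proof -
    have "pos y = h (Q z) y" if "y \<in> Q z" for y
      using that \<open>z \<in> C'\<close> Q_eq[of y z] by (auto simp: pos_def Q_def)
    then have "bij_betw pos (Q z) {0..<\<mu>} \<longleftrightarrow> bij_betw (h (Q z)) (Q z) {0..<\<mu>}"
      by (rule bij_betw_cong)
    then show ?thesis using h that by simp
  qed
  \<comment> \<open>Only the edges between the two orbits are coloured. In every class adjacent to
    \<open>x\<close>, exactly \<open>r x\<close> of the edges from \<open>x\<close> are red; since
    this number is the same for all these classes, automorphisms that permute the classes preserve
    \<open>r\<close> as well.\<close>
  define X where "X = {e \<in> U. \<exists>x z. e = {x, z} \<and> x \<in> C \<and> z \<in> C'}"
  define Y where "Y = {e \<in> U. \<exists>x z. e = {x, z} \<and> x \<in> C \<and> z \<in> C' \<and> pos z < r x}"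
  have X_iff: "{v, w} \<in> X \<longleftrightarrow> {v, w} \<in> U \<and> (v \<in> C \<and> w \<in> C' \<or> w \<in> C \<and> v \<in> C')" for v w
    unfolding X_def by (auto simp: doubleton_eq_iff)
  have Y_iff: "{v, w} \<in> Y \<longleftrightarrow> {v, w} \<in> U \<and>
      (v \<in> C \<and> w \<in> C' \<and> pos w < r v \<or> w \<in> C \<and> v \<in> C' \<and> pos v < r w)" for v w
    unfolding Y_def by (auto simp: doubleton_eq_iff)
  have XU: "X \<subseteq> U" by (auto simp: X_def)
  have YX: "Y \<subseteq> X" by (auto simp: X_def Y_def)
  have simY: "simple_graph V Y" using simple simple_graph_mono XU YX by blast
  have nX: "neighbours X x = T x" "neighbours Y x = {z \<in> T x. pos z < r x}"
    "neighbours (X - Y) x = {z \<in> T x. r x \<le> pos z}" if "x \<in> C" for x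
    using that disj by (auto simp: X_iff Y_iff T_def)
  have nX': "neighbours X z = B z" "neighbours (U - X) z = neighbours U z - C" if "z \<in> C'" for z
    using that disj by (auto simp: X_iff B_def)
  have nX0: "v \<in> C \<or> v \<in> C'" if "neighbours X v \<noteq> {}" for v using that by (auto simp: X_iff)
  have cU: "card (neighbours (U - X) z) = d - b" if "z \<in> C'" for z
  proof -
    have "neighbours U z - C = neighbours U z - B z" by (auto simp: B_def)
    then show ?thesis
      using nX'(2)[OF that] card_Diff_subset[OF finB, of z "neighbours U z"] cB[OF that]
        degree_orbit[OF z0, of z] that by (simp add: B_def C'_def d_def)
  qed
  \<comment> \<open>At least two uncoloured edges remain at every vertex of \<open>C'\<close>; this
    settles the clauses of \<open>colouring_step\<close> about missing and isolated blue
    edges.\<close>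
  have two: "2 \<le> d - b" using bm mD Dd by linarith
  have Tne: "T x \<noteq> {}" if "x \<in> C" for x using cT\<kappa>[OF that] \<kappa>x[OF that] \<kappa>1 \<mu>0 by auto
  have noB: "v \<in> C'" if "neighbours X v \<noteq> {}" "neighbours (X - Y) v = {}" for v
  proof (rule ccontr)
    assume "v \<notin> C'"
    then have v: "v \<in> C" using nX0 that by blast
    then obtain z where z: "z \<in> T v" using Tne by blast
    then have zC: "z \<in> C'" by (simp add: T_def)
    have "\<mu> - 1 \<in> pos ` Q z" using posQ[OF zC] \<mu>0 by (simp add: bij_betw_def)
    then obtain w where "w \<in> Q z" "pos w = \<mu> - 1" by auto
    then have "w \<in> neighbours (X - Y) v"
      unfolding nX(3)[OF v] using QT[OF z v] r_less[OF v] by auto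
    then show False using that(2) by blast
  qed
  have closed: "\<phi> x \<in> C \<longleftrightarrow> x \<in> C" "\<phi> x \<in> C' \<longleftrightarrow> x \<in> C'" if "\<phi> \<in> A" "x \<in> V" for \<phi> x
    using orbit_mem_iff[OF that x0] orbit_mem_iff[OF that z0] by (simp_all add: C_def C'_def)
  have autX: "graph_automorphism V X \<phi>" if "\<phi> \<in> A" for \<phi>
    using closed[OF that] bij[OF that] perm_edge[OF that] by (auto simp: graph_automorphism_def X_iff)
  define A' where "A' = preserving V A Y"
  have A'A: "\<phi> \<in> A" and A'Y: "graph_automorphism V Y \<phi>" if "\<phi> \<in> A'" for \<phi>
    using that by (auto simp: A'_def preserving_def)
  interpret A': permutation_group V A' unfolding A'_def by (rule preserving_group)
  have cred: "card (Q z \<inter> neighbours Y x) = r x" if "x \<in> C" "z \<in> T x" for x z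
  proof -
    have zC: "z \<in> C'" using that by (simp add: T_def)
    have "Q z \<inter> neighbours Y x = {w \<in> Q z. pos w < r x}"
      using QT[OF that(2,1)] nX(2)[OF that(1)] by blast
    moreover have "bij_betw pos {w \<in> Q z. pos w < r x} {0..<r x}"
    proof (rule bij_betw_imageI)
      show "inj_on pos {w \<in> Q z. pos w < r x}"
        using posQ[OF zC] by (auto simp: bij_betw_def intro: inj_on_subset)
      show "pos ` {w \<in> Q z. pos w < r x} = {0..<r x}"
      proof (intro equalityI subsetI)
        fix k assume k: "k \<in> {0..<r x}"
        then have "k \<in> pos ` Q z" using posQ[OF zC] r_less[OF that(1)] by (simp add: bij_betw_def)
        then show "k \<in> pos ` {w \<in> Q z. pos w < r x}" using k by auto
      qed auto
    qed
    ultimately show ?thesis using bij_betw_same_card by fastforce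
  qed
  have r_inv: "r (\<phi> x) = r x" if \<phi>: "\<phi> \<in> A'" and x: "x \<in> C" for \<phi> x
  proof -
    obtain z where z: "z \<in> T x" using Tne x by blast
    have xV: "x \<in> V" and zC: "z \<in> C'" using x z CV by (auto simp: T_def)
    have QV: "Q z \<subseteq> V" using CV by (auto simp: Q_def)
    have "\<phi> ` (Q z \<inter> neighbours Y x) = Q (\<phi> z) \<inter> neighbours Y (\<phi> x)"
      using inj_on_image_Int[OF A'.perm_inj[OF \<phi>] QV neighbours_subset[OF simY]]
        imQ[OF A'A[OF \<phi>] zC] automorphism_neighbours[OF A'Y[OF \<phi>] simY xV] by simp
    moreover have "card (\<phi> ` (Q z \<inter> neighbours Y x)) = card (Q z \<inter> neighbours Y x)"
      using card_im[OF A'A[OF \<phi>], of "Q z \<inter> neighbours Y x"] QV by blast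
    moreover have "\<phi> x \<in> C" using closed(1)[OF A'A[OF \<phi>] xV] x by simp
    moreover have "\<phi> z \<in> T (\<phi> x)" using imT[OF A'A[OF \<phi>] x] z by simp
    ultimately show ?thesis using cred[OF x z] cred[of "\<phi> x" "\<phi> z"] by simp
  qed
  have fixC: "\<phi> x = x" if \<phi>: "\<phi> \<in> A'" and x: "x \<in> C" for \<phi> x
  proof -
    have \<phi>x: "\<phi> x \<in> C" using closed(1)[OF A'A[OF \<phi>]] x CV by blast
    have "r ` P (\<phi> x) = r ` P x"
    proof -
      have "r ` \<phi> ` P x = r ` P x"
        unfolding image_image using r_inv[OF \<phi>] by (intro image_cong) (auto simp: P_def)
      then show ?thesis using imP[OF A'A[OF \<phi>] x] by simp
    qed
    then have "f (P (\<phi> x)) = f (P x)" using rP[OF x] rP[OF \<phi>x] by (simp add: bij_betw_def)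
    then have "P (\<phi> x) = P x" using f_inj x \<phi>x by (simp add: inj_on_eq_iff)
    then have "\<phi> x \<in> P x" using selfP[OF \<phi>x] by simp
    then show ?thesis using rP[OF x] r_inv[OF \<phi> x] selfP[OF x] by (metis bij_betw_def inj_onD)
  qed
  have c1': "finite (orbit A' z) \<and> card (orbit A' z) \<le> d - b" if z: "z \<in> C'" for z
  proof -
    have zV: "z \<in> V" using z CV by blast
    define piece where "piece = {w \<in> Q z. \<forall>x\<in>B z. pos w < r x \<longleftrightarrow> pos z < r x}"
    have sub: "orbit A' z \<subseteq> piece"
    proof
      fix w assume "w \<in> orbit A' z"
      then obtain \<phi> where \<phi>: "\<phi> \<in> A'" "w = \<phi> z" by (auto simp: orbit_def)
      have wC: "w \<in> C'" using closed(2)[OF A'A[OF \<phi>(1)] zV] z \<phi>(2) by simp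
      have edge: "{w, x} \<in> U \<longleftrightarrow> {z, x} \<in> U" "{w, x} \<in> Y \<longleftrightarrow> {z, x} \<in> Y" if "x \<in> C" for x
        using perm_edge[OF A'A[OF \<phi>(1)] zV, of x] fixC[OF \<phi>(1) that] \<phi>(2) that CV
          A'Y[OF \<phi>(1)] zV by (auto simp: graph_automorphism_def)
      have "B w = B z" using edge(1) by (auto simp: B_def)
      moreover have "pos w < r x \<longleftrightarrow> pos z < r x" if "x \<in> B z" for x
      proof -
        have "x \<in> C" "{z, x} \<in> U" "{w, x} \<in> U" using that edge(1) by (auto simp: B_def)
        then show ?thesis using edge(2)[of x] z wC disj by (auto simp: Y_iff)
      qed
      ultimately show "w \<in> piece" using wC by (simp add: piece_def Q_def)
    qed
    have finp: "finite piece" using finQ by (simp add: piece_def)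
    have zp: "z \<in> piece" using selfQ[OF z] by (simp add: piece_def)
    define I where "I = pos ` piece"
    have I: "finite I" "I \<noteq> {}" using finp zp by (auto simp: I_def)
    have pinj: "inj_on pos piece"
      using posQ[OF z] by (auto simp: bij_betw_def piece_def intro: inj_on_subset)
    have I\<mu>: "I \<subseteq> {0..<\<mu>}" using posQ[OF z] by (auto simp: bij_betw_def I_def piece_def)
    obtain x where x: "x \<in> B z" using cB[OF z] b0 by fastforce
    have xC: "x \<in> C" using x by (simp add: B_def)
    \<comment> \<open>A threshold lying in \<open>I\<close> above its minimum would separate the two
      positions. So the \<open>s\<close> thresholds from the class of \<open>x\<close> avoid
      \<open>I - {Min I}\<close>, which gives \<open>card I \<le> \<mu> - s + 1\<close>.\<close>
    have "(I - {Min I}) \<inter> f (P x) = {}"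
    proof (rule ccontr)
      assume "\<not> ?thesis"
      then obtain t where t: "t \<in> I" "t \<noteq> Min I" "t \<in> f (P x)" by blast
      have "t \<in> r ` P x" using t(3) rP[OF xC] by (simp add: bij_betw_def)
      then obtain y where y: "y \<in> P x" "r y = t" by blast
      have yB: "y \<in> B z" using PB[OF x z] y by blast
      obtain w where w: "w \<in> piece" "pos w = t" using t(1) by (auto simp: I_def)
      have "Min I \<in> I" using I by simp
      then obtain w0 where w0: "w0 \<in> piece" "pos w0 = Min I" by (auto simp: I_def)
      have "Min I < t" using Min_le[OF I(1) t(1)] t(2) by simp
      moreover have "pos w < r y \<longleftrightarrow> pos z < r y" "pos w0 < r y \<longleftrightarrow> pos z < r y"
        using w(1) w0(1) yB by (simp_all add: piece_def)
      ultimately show False using w(2) w0(2) y(2) by simp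
    qed
    then have "card ((I - {Min I}) \<union> f (P x)) = card (I - {Min I}) + card (f (P x))"
      using I(1) f(3)[OF xC] by (intro card_Un_disjoint) auto
    moreover have "card ((I - {Min I}) \<union> f (P x)) \<le> card {0..<\<mu>}"
      using I\<mu> f(1)[OF xC] by (intro card_mono) auto
    moreover have "card (I - {Min I}) = card I - 1" using I by simp
    ultimately have "card I - 1 + s \<le> \<mu>" using f(2)[OF xC] by simp
    moreover have "card I = card piece" using pinj by (simp add: I_def card_image)
    ultimately have "card piece \<le> d - b" using ar(3) by linarith
    then show ?thesis using card_mono[OF finp sub] finite_subset[OF sub finp] by simp
  qed
  have "colouring_step V U A X Y"
    unfolding colouring_step_def A'_def[symmetric]
  proof (intro conjI ballI allI impI)
    show "X \<subseteq> U" "Y \<subseteq> X" by fact+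
    show "X \<noteq> {}"
    proof -
      have "neighbours X x0 \<noteq> {}" using nX(1) Tne x0C by simp
      then show ?thesis by auto
    qed
    show "graph_automorphism V X \<phi>" if "\<phi> \<in> A" for \<phi> using autX that .
    show "orbit A' v = {v} \<or> finite (orbit A' v) \<and> card (orbit A' v) \<le> card (neighbours (U - X) v)"
      if v: "v \<in> V" "neighbours X v \<noteq> {}" for v
    proof (cases "v \<in> C")
      case True
      then show ?thesis using A'.fixed_orbit fixC by blast
    next
      case False
      then have "v \<in> C'" using nX0 v by blast
      then show ?thesis using c1' cU by simp
    qed
    show "neighbours (U - X) v \<noteq> {}"
      if "v \<in> V" "neighbours X v \<noteq> {}" "neighbours (X - Y) v = {}" for v
      using cU[OF noB[OF that(2,3)]] two by auto
    show "neighbours U x = {z}" "neighbours U z = {x}"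
      if h: "{x, z} \<in> X - Y" "neighbours (X - Y) x = {z}" "neighbours (X - Y) z = {x}"
        "neighbours (U - X) x = {}" "neighbours (U - X) z = {}" for x z
    proof -
      have "x \<in> C' \<or> z \<in> C'" using h(1) X_iff by auto
      then have False using cU[of x] cU[of z] h(4,5) two by auto
      then show "neighbours U x = {z}" "neighbours U z = {x}" by simp_all
    qed
    show "\<not> (card (neighbours (U - X) v) = 1 \<and> card (neighbours (U - X) w) = 1)"
      if h: "{v, w} \<in> U - X" "neighbours X v \<noteq> {}" "neighbours X w \<noteq> {}"
        "neighbours (X - Y) v = {}" "neighbours (X - Y) w = {}" for v w
      using cU[OF noB[OF h(2,4)]] two by simp
  qed
  then show ?thesis by blast
qed

end

section \<open>Existence of a colouring step\<close>

lemma colouring_stepD: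
  assumes "colouring_step V U A X Y"
  shows "X \<subseteq> U"
    "X \<noteq> {}"
    "Y \<subseteq> X"
    "\<forall>\<phi>\<in>A. graph_automorphism V X \<phi>"
    "\<forall>v\<in>V. neighbours X v \<noteq> {} \<longrightarrow> orbit (preserving V A Y) v = {v} \<or>
      finite (orbit (preserving V A Y) v) \<and> card (orbit (preserving V A Y) v) \<le> card (neighbours (U - X) v)"
    "\<forall>v\<in>V. neighbours X v \<noteq> {} \<longrightarrow> neighbours (X - Y) v = {} \<longrightarrow> neighbours (U - X) v \<noteq> {}"
    "\<forall>x z. {x, z} \<in> X - Y \<longrightarrow> neighbours (X - Y) x = {z} \<longrightarrow> neighbours (X - Y) z = {x} \<longrightarrow>
      neighbours (U - X) x = {} \<longrightarrow> neighbours (U - X) z = {} \<longrightarrow>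
      neighbours U x = {z} \<and> neighbours U z = {x}"
    "\<forall>v w. {v, w} \<in> U - X \<longrightarrow> neighbours X v \<noteq> {} \<longrightarrow> neighbours X w \<noteq> {} \<longrightarrow>
      neighbours (X - Y) v = {} \<longrightarrow> neighbours (X - Y) w = {} \<longrightarrow>
      \<not> (card (neighbours (U - X) v) = 1 \<and> card (neighbours (U - X) w) = 1)"
  by (insert assms[unfolded colouring_step_def], elim conjE, assumption)+

context acted_graph
begin

lemma join_orbits:
  assumes "x \<in> V" "z \<in> V" "orbit A x \<subseteq> neighbours U z" "x' \<in> orbit A x" "z' \<in> orbit A z"
  shows "{x', z'} \<in> U"
proof -
  obtain \<phi> where \<phi>: "\<phi> \<in> A" "z' = \<phi> z" using assms(5) by (auto simp: orbit_def)
  then have "x' \<in> \<phi> ` orbit A x" using orbit_image[OF assms(1)] assms(4) by simp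
  then obtain y where y: "y \<in> orbit A x" "x' = \<phi> y" by blast
  have "{y, z} \<in> U" using y(1) assms(3) by (auto simp: insert_commute[of y])
  then show ?thesis using perm_edge[OF \<phi>(1) _ assms(2)] y orbit_subset[OF assms(1)] \<phi>(2) by blast
qed

lemma orbit_double_count:
  assumes "x \<in> V" "z \<in> V" "finite (orbit A x)" "finite (orbit A z)"
  shows "card (orbit A x) * card (neighbours U x \<inter> orbit A z)
       = card (orbit A z) * card (neighbours U z \<inter> orbit A x)"
proof -
  have "(\<Sum>v\<in>orbit A x. card {w \<in> orbit A z. {v, w} \<in> U}) = card (neighbours U z \<inter> orbit A x) * card (orbit A z)"
  proof (rule sum_multicount[OF assms(3,4)], rule ballI)
    fix w assume w: "w \<in> orbit A z"
    have "{v \<in> orbit A x. {v, w} \<in> U} = neighbours U w \<inter> orbit A x" by (auto simp: insert_commute)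
    then show "card {v \<in> orbit A x. {v, w} \<in> U} = card (neighbours U z \<inter> orbit A x)"
      using degree_into_orbit[OF assms(2) w assms(1)] by simp
  qed
  moreover have "card {w \<in> orbit A z. {v, w} \<in> U} = card (neighbours U x \<inter> orbit A z)"
    if "v \<in> orbit A x" for v
  proof -
    have "{w \<in> orbit A z. {v, w} \<in> U} = neighbours U v \<inter> orbit A z" by auto
    then show ?thesis using degree_into_orbit[OF assms(1) that assms(2)] by simp
  qed
  ultimately show ?thesis by (simp add: mult.commute)
qed

text \<open>A degree below \<open>d\<close> shows that a vertex has met a coloured edge, and
  \<open>a\<close> is such a vertex with edges left. If the orbit of some such vertex is completely
  joined to another orbit, a half graph works. Otherwise the smallest such orbit \<open>C\<close>
  can be given distinct red degrees, unless an untouched orbit contains too many vertices with the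
  same neighbours in \<open>C\<close>; this exception is \<open>block_step\<close>.\<close>

lemma colouring_step_exists:
  assumes deg: "\<And>v. v \<in> V \<Longrightarrow> card (neighbours U v) \<le> d"
    and orb: "\<And>v. v \<in> V \<Longrightarrow> card (neighbours U v) = d \<or> orbit A v = {v} \<or>
      finite (orbit A v) \<and> card (orbit A v) \<le> card (neighbours U v)"
    and a: "a \<in> V" "card (neighbours U a) < d" "neighbours U a \<noteq> {}"
  shows "\<exists>X Y. colouring_step V U A X Y"
proof (cases "\<exists>x\<in>V. \<exists>z\<in>V. z \<notin> orbit A x \<and> card (neighbours U x) < d \<and> orbit A x \<subseteq> neighbours U z")
  case True
  then obtain x z where x: "x \<in> V" "card (neighbours U x) < d" and z: "z \<in> V" "z \<notin> orbit A x"
    and sub: "orbit A x \<subseteq> neighbours U z" by blast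
  have join: "{x', z'} \<in> U" if "x' \<in> orbit A x" "z' \<in> orbit A z" for x' z'
    using join_orbits[OF x(1) z(1) sub that] .
  have zx: "x \<notin> orbit A z" using z orbit_sym[OF z(1)] by blast
  have subz: "orbit A z \<subseteq> neighbours U x" using join orbit_refl by auto
  have cx: "card (orbit A x) \<le> card (neighbours U x)"
  proof -
    have "card (orbit A x) \<le> card (neighbours U x) \<or> orbit A x = {x}" using orb[OF x(1)] x(2) by auto
    moreover have "0 < card (neighbours U x)"
      using subz orbit_refl[of z] fin[OF x(1)] card_gt_0_iff by blast
    ultimately show ?thesis by auto
  qed
  \<comment> \<open>Nothing is assumed about the orbit size if \<open>z\<close> has degree
    \<open>d\<close>, but then the orbit lies within the neighbourhood of \<open>x\<close>, which
    has fewer than \<open>d\<close> vertices.\<close>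
  have cz: "card (orbit A z) \<le> card (neighbours U z)"
  proof (cases "card (neighbours U z) = d")
    case True
    then show ?thesis using card_mono[OF fin[OF x(1)] subz] x(2) by simp
  next
    case False
    then have "card (orbit A z) \<le> card (neighbours U z) \<or> orbit A z = {z}" using orb[OF z(1)] by auto
    moreover have "0 < card (neighbours U z)"
      using sub orbit_refl[of x] fin[OF z(1)] card_gt_0_iff by blast
    ultimately show ?thesis by auto
  qed
  show ?thesis
  proof (cases "card (orbit A x) \<le> card (orbit A z)")
    case True
    then show ?thesis using join_step[OF x(1) z(1) z(2) join _ cz] by blast
  next
    case False
    then have le: "card (orbit A z) \<le> card (orbit A x)" by simp
    have "{z', x'} \<in> U" if "z' \<in> orbit A z" "x' \<in> orbit A x" for z' x'
      using join[OF that(2,1)] by (simp add: insert_commute)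
    from join_step[OF z(1) x(1) zx this le cx] show ?thesis .
  qed
next
  case stuck: False
  \<comment> \<open>Orbits of these vertices are finite by \<open>orb\<close>, so
    \<open>card\<close> compares their true sizes.\<close>
  define W where "W v \<longleftrightarrow> v \<in> V \<and> card (neighbours U v) < d \<and> neighbours U v \<noteq> {}" for v
  obtain x0 where "W x0" and min: "\<And>v. W v \<Longrightarrow> card (orbit A x0) \<le> card (orbit A v)"
    using ex_has_least_nat[of W a "\<lambda>v. card (orbit A v)"] a by (auto simp: W_def)
  then have x0: "x0 \<in> V" "card (neighbours U x0) < d" "neighbours U x0 \<noteq> {}" by (auto simp: W_def)
  define C where "C = orbit A x0"
  have nojoin: "\<not> C \<subseteq> neighbours U z" if "z \<in> V" "z \<notin> C" for z
    using stuck x0 that by (auto simp: C_def)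
  \<comment> \<open>A fixed vertex is completely joined to the orbit of each of its neighbours,
    which \<open>stuck\<close> excludes.\<close>
  have not1: "C \<noteq> {x0}"
  proof
    assume C1: "C = {x0}"
    obtain z where z: "z \<in> neighbours U x0" using x0 by blast
    then have "z \<in> V" "z \<noteq> x0" using simple_graphD[OF simple, of x0 z] by auto
    moreover have "x0 \<in> neighbours U z" using z neighbours_commute by metis
    ultimately show False using nojoin[of z] C1 by simp
  qed
  then have finC: "finite C" and cC: "card C \<le> card (neighbours U x0)"
    using orb[OF x0(1)] x0(2) by (auto simp: C_def)
  have "card C \<noteq> 1"
    using not1 orbit_refl[of x0] card_1_singletonE unfolding C_def by (metis singletonD)
  moreover have "card C \<noteq> 0" using finC orbit_refl[of x0] by (auto simp: C_def)
  ultimately have two: "2 \<le> card C" by simp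
  let ?b = "\<lambda>z. card (neighbours U z \<inter> C)"
  let ?S = "\<lambda>z. {w \<in> orbit A z. neighbours U w \<inter> C = neighbours U z \<inter> C}"
  have bm: "?b z < card C" if "z \<in> V" "z \<notin> C" for z
    using nojoin[OF that] by (intro psubset_card_mono[OF finC]) auto
  have diff: "card (neighbours U z - C) = card (neighbours U z) - ?b z" if "z \<in> V" for z
    using card_Diff_subset_Int[of "neighbours U z" C] finC by simp
  show ?thesis
  proof (cases "\<exists>z\<in>V. z \<notin> C \<and> neighbours U z \<inter> C \<noteq> {} \<and> card (neighbours U z) = d \<and>
      card (neighbours U z) < card (?S z) + ?b z")
    case True
    then obtain z where z: "z \<in> V" "z \<notin> C" "neighbours U z \<inter> C \<noteq> {}" "card (neighbours U z) = d"
      "card (neighbours U z) < card (?S z) + ?b z" by blast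
    have "card (neighbours U x0) < card (neighbours U z)" using x0(2) z(4) by simp
    from block_step[OF x0(1) z(1) z(2)[unfolded C_def] finC[unfolded C_def] cC[unfolded C_def] this
        z(3)[unfolded C_def] nojoin[OF z(1,2), unfolded C_def] z(5)[unfolded C_def]]
    show ?thesis .
  next
    case False
    have touched: "card (orbit A z) \<le> card (neighbours U z) \<and> card C \<le> card (orbit A z) \<and>
        card (?S z) + ?b z \<le> card (orbit A z)"
      if z: "z \<in> V" "z \<notin> C" "neighbours U z \<inter> C \<noteq> {}" "card (neighbours U z) < d" for z
    proof -
      have m: "card C \<le> card (orbit A z)" using min[of z] z by (auto simp: W_def C_def)
      then have "orbit A z \<noteq> {z}" using two by auto
      then have fz: "finite (orbit A z)" "card (orbit A z) \<le> card (neighbours U z)"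
        using orb[OF z(1)] z(4) by auto
      obtain x where x: "x \<in> C" "x \<notin> neighbours U z" using nojoin[OF z(1,2)] by blast
      define e where "e = card (neighbours U x \<inter> orbit A z)"
      have "card C * e = card (orbit A z) * ?b z"
        using orbit_double_count[OF x0(1) z(1)] finC fz(1) degree_into_orbit[OF x0(1) _ z(1), of x] x(1)
        by (simp add: e_def C_def)
      then have "card C * ?b z \<le> card C * e" using m by (metis mult_le_mono1)
      then have be: "?b z \<le> e" using two by simp
      have "?S z \<inter> (neighbours U x \<inter> orbit A z) = {}"
      proof (rule ccontr)
        assume "\<not> ?thesis"
        then obtain w where w: "w \<in> ?S z" "w \<in> neighbours U x" by blast
        then have "x \<in> neighbours U w \<inter> C" using x(1) neighbours_commute[of w U x] by blast
        then show False using w(1) x(2) by blast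
      qed
      then have "card (?S z \<union> (neighbours U x \<inter> orbit A z)) = card (?S z) + e"
        using fz(1) unfolding e_def by (intro card_Un_disjoint) auto
      moreover have "card (?S z \<union> (neighbours U x \<inter> orbit A z)) \<le> card (orbit A z)"
        using fz(1) by (intro card_mono) auto
      ultimately show ?thesis using m fz be by simp
    qed
    show ?thesis
    proof (rule spread_step[OF x0(1) finC[unfolded C_def] two[unfolded C_def] cC[unfolded C_def]],
        fold C_def)
      fix z assume z: "z \<in> V" "z \<notin> C" "neighbours U z \<inter> C \<noteq> {}"
      show "card (?S z) \<le> card (neighbours U z - C)"
      proof (cases "card (neighbours U z) = d")
        case True
        then have "card (?S z) + ?b z \<le> card (neighbours U z)" using False z by auto
        then show ?thesis using diff[OF z(1)] by simp
      next
        case nd: False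
        then have "card (neighbours U z) < d" using deg[OF z(1)] by simp
        from touched[OF z this] have "card (?S z) + ?b z \<le> card (neighbours U z)" by linarith
        then show ?thesis using diff[OF z(1)] by simp
      qed
      \<comment> \<open>An untouched vertex keeps at least two edges, because it has fewer than
        \<open>card C < d\<close> neighbours in \<open>C\<close>. A touched one has degree at least
        \<open>card C\<close> by minimality of \<open>C\<close>, so if a single edge remains, it
        misses at most one vertex of \<open>C\<close>.\<close>
      show "card (C - neighbours U z) \<le> 1" if one: "card (neighbours U z - C) = 1"
      proof (cases "card (neighbours U z) = d")
        case True
        then show ?thesis using one diff[OF z(1)] bm[OF z(1,2)] cC x0(2) by simp
      next
        case nd: False
        then have "card (neighbours U z) < d" using deg[OF z(1)] by simp
        from touched[OF z this] have "card C \<le> card (neighbours U z)" by linarith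
        then have "card C \<le> ?b z + 1" using one diff[OF z(1)] by simp
        moreover have "card (C - neighbours U z) = card C - ?b z"
          using card_Diff_subset_Int[of C "neighbours U z"] finC by (simp add: Int_commute)
        ultimately show ?thesis by simp
      qed
    qed
  qed
qed

end

section \<open>Partial colourings\<close>

locale rooted_graph = permutation_group V A0
  for V :: "'a set" and A0 +
  fixes E :: "'a set set" and d :: nat and r s u :: 'a
  assumes simpleE: "simple_graph V E"
    and degree: "v \<in> V \<Longrightarrow> finite (neighbours E v) \<and> card (neighbours E v) = d"
    and conn: "connected_graph V E"
    and d2: "2 \<le> d"
    and rV: "r \<in> V"
    and aut0: "\<phi> \<in> A0 \<Longrightarrow> graph_automorphism V E \<phi>"
begin

text \<open>\<open>B\<close> and \<open>R\<close> are the blue and the red edges; \<open>A\<close> is the group of those elements of \<open>A0\<close>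
  that may still preserve the finished colouring. Three conditions are about the uniqueness of the
  root: in the end \<open>r\<close> is the only vertex without a blue edge and \<open>{s, u}\<close> is the only blue edge
  that meets no other blue edge.\<close>

definition valid :: "'a set set \<Rightarrow> 'a set set \<Rightarrow> ('a \<Rightarrow> 'a) set \<Rightarrow> bool" where
  "valid B R A \<longleftrightarrow> B \<subseteq> E \<and> R \<subseteq> E \<and> B \<inter> R = {} \<and> A \<subseteq> A0 \<and> permutation_group V A \<and>
     (\<forall>\<phi>\<in>A. graph_automorphism V B \<phi> \<and> graph_automorphism V R \<phi>) \<and>
     (\<forall>\<phi>\<in>A0. \<forall>B' R'. B \<subseteq> B' \<longrightarrow> R \<subseteq> R' \<longrightarrow> B' \<inter> R' = {} \<longrightarrow> B' \<union> R' = E \<longrightarrow>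
        graph_automorphism V B' \<phi> \<longrightarrow> graph_automorphism V R' \<phi> \<longrightarrow> \<phi> \<in> A) \<and>
     neighbours (E - B - R) r = {} \<and>
     (\<forall>v\<in>V. card (neighbours (E - B - R) v) = d \<or> orbit A v = {v} \<or>
        finite (orbit A v) \<and> card (orbit A v) \<le> card (neighbours (E - B - R) v)) \<and>
     (\<forall>v\<in>V. v \<noteq> r \<longrightarrow> neighbours B v = {} \<longrightarrow> neighbours (E - B - R) v \<noteq> {}) \<and>
     (\<forall>x z. {x, z} \<in> B \<longrightarrow> {x, z} \<noteq> {s, u} \<longrightarrow> neighbours B x = {z} \<longrightarrow> neighbours B z = {x} \<longrightarrow>
        neighbours (E - B - R) x \<noteq> {} \<or> neighbours (E - B - R) z \<noteq> {}) \<and>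
     (\<forall>x z. {x, z} \<in> E - B - R \<longrightarrow> neighbours B x = {} \<longrightarrow> neighbours B z = {} \<longrightarrow>
        \<not> (card (neighbours (E - B - R) x) = 1 \<and> card (neighbours (E - B - R) z) = 1))"

lemma validD:
  assumes "valid B R A"
  shows "B \<subseteq> E"
    "R \<subseteq> E"
    "B \<inter> R = {}"
    "A \<subseteq> A0"
    "permutation_group V A"
    "\<forall>\<phi>\<in>A. graph_automorphism V B \<phi> \<and> graph_automorphism V R \<phi>"
    "\<forall>\<phi>\<in>A0. \<forall>B' R'. B \<subseteq> B' \<longrightarrow> R \<subseteq> R' \<longrightarrow> B' \<inter> R' = {} \<longrightarrow> B' \<union> R' = E \<longrightarrow> graph_automorphism V B' \<phi> \<longrightarrow>
      graph_automorphism V R' \<phi> \<longrightarrow> \<phi> \<in> A"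
    "neighbours (E - B - R) r = {}"
    "\<forall>v\<in>V. card (neighbours (E - B - R) v) = d \<or> orbit A v = {v} \<or> finite (orbit A v) \<and> card (orbit A v) \<le> card (neighbours (E - B - R) v)"
    "\<forall>v\<in>V. v \<noteq> r \<longrightarrow> neighbours B v = {} \<longrightarrow> neighbours (E - B - R) v \<noteq> {}"
    "\<forall>x z. {x, z} \<in> B \<longrightarrow> {x, z} \<noteq> {s, u} \<longrightarrow> neighbours B x = {z} \<longrightarrow> neighbours B z = {x} \<longrightarrow>
      neighbours (E - B - R) x \<noteq> {} \<or> neighbours (E - B - R) z \<noteq> {}"
    "\<forall>x z. {x, z} \<in> E - B - R \<longrightarrow> neighbours B x = {} \<longrightarrow> neighbours B z = {} \<longrightarrow>
      \<not> (card (neighbours (E - B - R) x) = 1 \<and> card (neighbours (E - B - R) z) = 1)"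
  by (insert assms[unfolded valid_def], elim conjE, assumption)+

lemma valid_acted_graph:
  assumes "valid B R A"
  shows "acted_graph V A (E - B - R)"
proof -
  interpret A: permutation_group V A by (rule validD(5)[OF assms])
  show ?thesis
  proof unfold_locales
    show "simple_graph V (E - B - R)" by (rule simple_graph_mono[OF simpleE]) blast
    show "finite (neighbours (E - B - R) v)" if "v \<in> V" for v
      using degree[OF that] by (auto intro: finite_subset[OF neighbours_mono[of "E - B - R" E]])
    show "graph_automorphism V (E - B - R) \<phi>" if "\<phi> \<in> A" for \<phi>
    proof (intro automorphism_Diff)
      have "\<phi> \<in> A0" using validD(4)[OF assms] that by (rule subsetD)
      then show "graph_automorphism V E \<phi>" by (rule aut0)
      show "graph_automorphism V B \<phi>" "graph_automorphism V R \<phi>"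
        using validD(6)[OF assms] that by simp_all
    qed
  qed
qed

text \<open>The clauses of \<open>colouring_step\<close> see only vertices touched in this round;
  \<open>one\<close> supplies the case of an uncoloured edge between a touched and an untouched
  vertex. An isolated blue edge without uncoloured edges at its ends does not arise. If it is old,
  its ends cannot have been touched, so it was already there. If it is new, it was a component of
  \<open>U\<close> whose ends had no blue edge, which the last clause of \<open>valid\<close>
  excludes.\<close>

lemma valid_extend:
  assumes v: "valid B R A" and st: "colouring_step V (E - B - R) A X Y"
    and one: "\<And>v w. {v, w} \<in> E - B - R - X \<Longrightarrow> neighbours X v \<noteq> {} \<Longrightarrow> neighbours X w = {} \<Longrightarrow>
      neighbours (X - Y) v = {} \<Longrightarrow> neighbours B w = {} \<Longrightarrow> card (neighbours (E - B - R) w) \<noteq> 1"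
  shows "valid (B \<union> (X - Y)) (R \<union> Y) (preserving V A Y)"
proof -
  define U where "U = E - B - R"
  define A' where "A' = preserving V A Y"
  interpret acted_graph V A U unfolding U_def using valid_acted_graph[OF v] .
  note D = colouring_stepD[OF st, folded U_def A'_def]
  have XU: "X \<subseteq> U" and YX: "Y \<subseteq> X" and autX: "\<And>\<phi>. \<phi> \<in> A \<Longrightarrow> graph_automorphism V X \<phi>"
    using D(1,3,4) by blast+
  note c1 = D(5)[rule_format] and c2 = D(6)[rule_format] and c3 = D(7)[rule_format]
    and c4 = D(8)[rule_format]
  note W = validD[OF v, folded U_def]
  have BE: "B \<subseteq> E" "R \<subseteq> E" "B \<inter> R = {}" "A \<subseteq> A0" by (rule W)+
  note autBR = W(6)[rule_format] and v0 = W(7)[rule_format] and vr = W(8)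
    and v1 = W(9)[rule_format] and v2 = W(10)[rule_format] and v3 = W(11)[rule_format]
    and v4 = W(12)[rule_format]
  define B' where "B' = B \<union> (X - Y)"
  define R' where "R' = R \<union> Y"
  have U': "E - B' - R' = U - X" using YX by (auto simp: B'_def R'_def U_def)
  have nB: "neighbours B' v = neighbours B v \<union> neighbours (X - Y) v" for v by (auto simp: B'_def)
  have un: "neighbours (U - X) v = neighbours U v" if "neighbours X v = {}" for v
    using that by (simp add: neighbours_Diff)
  have BX: "B \<inter> X = {}" using XU by (auto simp: U_def)
  have "valid B' R' A'"
    unfolding valid_def U'
  proof (intro conjI ballI allI impI)
    show "B' \<subseteq> E" "R' \<subseteq> E" "B' \<inter> R' = {}" "A' \<subseteq> A0"
      using BE XU YX preserving_subset[of V A Y] by (auto simp: B'_def R'_def U_def A'_def)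
    show "permutation_group V A'" unfolding A'_def by (rule preserving_group)
    show "graph_automorphism V B' \<phi>" "graph_automorphism V R' \<phi>" if "\<phi> \<in> A'" for \<phi>
      using that autBR autX unfolding B'_def R'_def A'_def preserving_def
      by (auto intro!: automorphism_Un automorphism_Diff)
    show "\<phi> \<in> A'"
      if h: "\<phi> \<in> A0" "B' \<subseteq> B''" "R' \<subseteq> R''" "B'' \<inter> R'' = {}" "B'' \<union> R'' = E"
        "graph_automorphism V B'' \<phi>" "graph_automorphism V R'' \<phi>" for \<phi> B'' R''
    proof -
      have \<phi>: "\<phi> \<in> A" using v0[OF h(1) _ _ h(4-7)] h(2,3) by (auto simp: B'_def R'_def)
      have "Y = R'' \<inter> X" using h(2-4) YX by (auto simp: B'_def R'_def)
      then have "graph_automorphism V Y \<phi>"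
        using h(7) autX[OF \<phi>] by (simp add: graph_automorphism_def)
      then show ?thesis using \<phi> by (simp add: A'_def preserving_def)
    qed
    show "neighbours (U - X) r = {}" using vr by (simp add: neighbours_Diff)
    show "card (neighbours (U - X) v) = d \<or> orbit A' v = {v} \<or>
        finite (orbit A' v) \<and> card (orbit A' v) \<le> card (neighbours (U - X) v)" if "v \<in> V" for v
    proof (cases "neighbours X v = {}")
      case True
      have sub: "orbit A' v \<subseteq> orbit A v" using orbit_mono preserving_subset by (simp add: A'_def orbit_mono preserving_subset)
      have self: "v \<in> orbit A' v"
        using permutation_group.orbit_refl[OF preserving_group] by (simp add: A'_def)
      from v1[OF that] show ?thesis
      proof (elim disjE)
        assume "orbit A v = {v}"
        then have "orbit A' v = {v}" using sub self by auto
        then show ?thesis by blast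
      next
        assume "finite (orbit A v) \<and> card (orbit A v) \<le> card (neighbours U v)"
        then have "finite (orbit A' v) \<and> card (orbit A' v) \<le> card (neighbours U v)"
          using sub finite_subset card_mono[OF _ sub] by (meson le_trans)
        then show ?thesis using un[OF True] by simp
      qed (use un[OF True] in simp)
    next
      case False
      then show ?thesis using c1[OF that] by blast
    qed
    show "neighbours (U - X) v \<noteq> {}" if "v \<in> V" "v \<noteq> r" "neighbours B' v = {}" for v
      using that c2[of v] v2[of v] un[of v] nB[of v] by (cases "neighbours X v = {}") auto
    show "neighbours (U - X) x \<noteq> {} \<or> neighbours (U - X) z \<noteq> {}"
      if h: "{x, z} \<in> B'" "{x, z} \<noteq> {s, u}" "neighbours B' x = {z}" "neighbours B' z = {x}" for x z
    proof (rule ccontr)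
      assume "\<not> ?thesis"
      then have e: "neighbours (U - X) x = {}" "neighbours (U - X) z = {}" by auto
      have V: "x \<in> V" "z \<in> V" using h(1) simple_graphD[OF simpleE] BE XU by (auto simp: B'_def U_def)
      show False
      proof (cases "{x, z} \<in> B")
        case True
        then have zx: "{z, x} \<in> B" by (simp add: insert_commute)
        have "neighbours B x = {z}" "neighbours B z = {x}" using h(3,4) nB True zx by auto
        \<comment> \<open>An end of an old isolated blue edge gets no new blue edge. Had it been
          touched, \<open>c2\<close> would have left it an uncoloured edge.\<close>
        moreover have "neighbours U y = {}"
          if y: "y \<in> V" "neighbours B' y = {y'}" "{y, y'} \<in> B" "neighbours (U - X) y = {}" for y y'
        proof -
          have "neighbours (X - Y) y \<subseteq> {y'}" using y(2) nB by blast
          moreover have "y' \<notin> neighbours (X - Y) y" using y(3) BX by auto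
          ultimately have "neighbours (X - Y) y = {}" by blast
          then have "neighbours X y = {}" using c2[OF y(1)] y(4) by blast
          then show ?thesis using un y(4) by simp
        qed
        ultimately show False using v3[OF True h(2)] V h(3,4) e True zx by blast
      next
        case False
        then have xz: "{x, z} \<in> X - Y" "{z, x} \<in> X - Y" using h(1) by (auto simp: B'_def insert_commute)
        have "z \<notin> neighbours B x" "x \<notin> neighbours B z" using False by (auto simp: insert_commute)
        moreover have "neighbours B x \<subseteq> {z}" "neighbours B z \<subseteq> {x}"
          unfolding h(3,4)[symmetric] nB by simp_all
        ultimately have b: "neighbours B x = {}" "neighbours B z = {}" by blast+
        then have "neighbours (X - Y) x = {z}" "neighbours (X - Y) z = {x}"
          using h(3,4) unfolding nB by simp_all
        then have "neighbours U x = {z} \<and> neighbours U z = {x}" using c3[OF xz(1) _ _ e] by blast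
        then show False using v4[of x z] b xz XU by auto
      qed
    qed
    show "\<not> (card (neighbours (U - X) x) = 1 \<and> card (neighbours (U - X) z) = 1)"
      if h: "{x, z} \<in> U - X" "neighbours B' x = {}" "neighbours B' z = {}" for x z
    proof -
      have b: "neighbours B x = {}" "neighbours B z = {}"
        "neighbours (X - Y) x = {}" "neighbours (X - Y) z = {}"
        using h(2,3) nB[of x] nB[of z] by auto
      have zx: "{z, x} \<in> U - X" using h(1) by (simp add: insert_commute)
      consider "neighbours X x = {}" "neighbours X z = {}" | "neighbours X x \<noteq> {}" "neighbours X z \<noteq> {}"
        | "neighbours X x \<noteq> {}" "neighbours X z = {}" | "neighbours X x = {}" "neighbours X z \<noteq> {}" by blast
      then show ?thesis
      proof cases
        case 1
        then show ?thesis using v4[of x z] b h(1) un by auto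
      next
        case 2
        then show ?thesis using c4[OF h(1)] b by blast
      next
        case 3
        then show ?thesis using one[folded U_def, OF h(1)] b un by auto
      next
        case 4
        then show ?thesis using one[folded U_def, OF zx] b un by auto
      qed
    qed
  qed
  then show ?thesis by (simp add: A'_def B'_def R'_def)
qed

text \<open>A vertex without a blue edge and with one uncoloured edge forces this edge to be blue.
  Colouring such edges by themselves makes \<open>one\<close> of \<open>valid_extend\<close> hold
  trivially; if there are none, \<open>one\<close> holds for every colouring step.\<close>

lemma valid_progress:
  assumes v: "valid B R A" and ne: "E - B - R \<noteq> {}"
  shows "\<exists>X Y. X \<subseteq> E - B - R \<and> X \<noteq> {} \<and> Y \<subseteq> X \<and> valid (B \<union> (X - Y)) (R \<union> Y) (preserving V A Y)"
proof -
  define U where "U = E - B - R"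
  interpret acted_graph V A U unfolding U_def using valid_acted_graph[OF v] .
  note W = validD[OF v, folded U_def]
  note vr = W(8) and v1 = W(9)[rule_format] and v4 = W(12)[rule_format]
  have UE: "U \<subseteq> E" by (auto simp: U_def)
  show ?thesis
  proof (cases "\<exists>x\<in>V. card (neighbours U x) = 1 \<and> neighbours B x = {}")
    case True
    then obtain x z where x: "x \<in> V" "neighbours B x = {}" "neighbours U x = {z}"
      using card_1_singletonE by metis
    have xz: "{x, z} \<in> U" using x(3) by auto
    then have z: "z \<in> V" "x \<noteq> z" using simple_graphD[OF simple] by blast+
    \<comment> \<open>Since \<open>d \<ge> 2\<close>, the uncoloured degree 1 is not
      \<open>d\<close>, so the orbit bound applies. Then \<open>z\<close> is fixed too, as the only
      uncoloured neighbour of \<open>x\<close>.\<close>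
    have fx: "orbit A x = {x}"
    proof -
      have "orbit A x = {x} \<or> finite (orbit A x) \<and> card (orbit A x) \<le> 1" using v1[OF x(1)] d2 x(3) by auto
      then show ?thesis using orbit_refl[of x] card_le_Suc0_iff_eq[of "orbit A x"] by auto
    qed
    have \<phi>x: "\<phi> x = x" if "\<phi> \<in> A" for \<phi> using that fx by (auto simp: orbit_def)
    have \<phi>z: "\<phi> z = z" if "\<phi> \<in> A" for \<phi>
      using perm_neighbours[OF that x(1)] \<phi>x[OF that] x(3) by simp
    have fz: "orbit A z = {z}" using fixed_orbit \<phi>z by blast
    have nX: "neighbours {{x, z}} v = (if v = x then {z} else if v = z then {x} else {})" for v
      using z(2) by (auto simp: doubleton_eq_iff)
    have sub: "orbit (preserving V A {}) v = {v}" if "v = x \<or> v = z" for v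
      using permutation_group.orbit_refl[OF preserving_group, of v "{}"] fx fz that
        orbit_mono[OF preserving_subset, of V A "{}" v] by auto
    have st: "colouring_step V U A {{x, z}} {}"
      unfolding colouring_step_def
    proof (intro conjI ballI allI impI)
      show "{{x, z}} \<subseteq> U" using xz by simp
      show "graph_automorphism V {{x, z}} \<phi>" if \<phi>: "\<phi> \<in> A" for \<phi>
      proof -
        have "\<phi> a = x \<longleftrightarrow> a = x" "\<phi> a = z \<longleftrightarrow> a = z" if "a \<in> V" for a
          using perm_inj[OF \<phi>] \<phi>x[OF \<phi>] \<phi>z[OF \<phi>] that x(1) z(1) by (metis inj_on_eq_iff)+
        then show ?thesis using bij[OF \<phi>] by (auto simp: graph_automorphism_def doubleton_eq_iff)
      qed
      show "neighbours U a = {b}" "neighbours U b = {a}"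
        if h: "{a, b} \<in> {{x, z}} - {}" "neighbours (U - {{x, z}}) a = {}" "neighbours (U - {{x, z}}) b = {}" for a b
      proof -
        have "{a, b} \<in> U" "{b, a} \<in> U" "neighbours {{x, z}} a = {b}" "neighbours {{x, z}} b = {a}"
          using h(1) xz z(2) nX by (auto simp: doubleton_eq_iff insert_commute)
        then show "neighbours U a = {b}" "neighbours U b = {a}"
          using h(2,3) by (auto simp: neighbours_Diff)
      qed
    qed (use sub nX in \<open>auto split: if_splits\<close>)
    have "valid (B \<union> ({{x, z}} - {})) (R \<union> {}) (preserving V A {})"
      by (rule valid_extend[OF v st[unfolded U_def]]) simp
    then show ?thesis using xz by (intro exI[of _ "{{x, z}}"] exI[of _ "{}"]) (auto simp: U_def)
  next
    case False
    have deg: "card (neighbours U v) \<le> d" if "v \<in> V" for v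
      using degree[OF that] card_mono[OF _ neighbours_mono[OF UE, of v]] by auto
    obtain e where e: "e \<in> U" using ne unfolding U_def by blast
    have "\<exists>a b. e = {a, b} \<and> a \<noteq> b \<and> a \<in> V \<and> b \<in> V"
      using simpleE e UE by (auto simp: simple_graph_def)
    then obtain w w' where w: "{w, w'} \<in> U" "w \<in> V" using e by blast
    have "(\<lambda>x y. {x, y} \<in> E)\<^sup>*\<^sup>* r w" using conn w(2) rV by (simp add: connected_graph_def)
    \<comment> \<open>On a walk from the root, which has no uncoloured edge, to an end of an
      uncoloured edge, the first vertex with an uncoloured edge is entered by a coloured
      one.\<close>
    then have "neighbours U w = {} \<or> (\<exists>a\<in>V. card (neighbours U a) < d \<and> neighbours U a \<noteq> {})"
    proof (induction rule: rtranclp_induct)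
      case base
      then show ?case using vr by blast
    next
      case (step y a)
      show ?case
      proof (cases "neighbours U y = {} \<and> neighbours U a \<noteq> {}")
        case True
        have aV: "a \<in> V" using simple_graphD[OF simpleE step(2)] by blast
        have "{y, a} \<notin> U" using True by auto
        then have "neighbours U a \<subset> neighbours E a"
          using UE step(2) by (auto simp: insert_commute)
        then have "card (neighbours U a) < d" using degree[OF aV] psubset_card_mono by metis
        then show ?thesis using True aV by blast
      next
        case False
        then show ?thesis using step(3) by blast
      qed
    qed
    moreover have "w' \<in> neighbours U w" using w(1) by simp
    ultimately obtain a where a: "a \<in> V" "card (neighbours U a) < d" "neighbours U a \<noteq> {}" by blast
    obtain X Y where st: "colouring_step V U A X Y"
      using colouring_step_exists[OF deg v1 a] by blast
    have "valid (B \<union> (X - Y)) (R \<union> Y) (preserving V A Y)"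
    proof (rule valid_extend[OF v st[unfolded U_def]])
      fix v w assume h: "{v, w} \<in> E - B - R - X" "neighbours B w = {}"
      have "w \<in> V" using h(1) simple_graphD[OF simpleE] by blast
      then show "card (neighbours (E - B - R) w) \<noteq> 1" using False h(2) by (auto simp: U_def)
    qed
    moreover have "X \<subseteq> E - B - R" "X \<noteq> {}" "Y \<subseteq> X"
      using colouring_stepD(1-3)[OF st] by (simp_all add: U_def)
    ultimately show ?thesis by (intro exI[of _ X] exI[of _ Y]) simp
  qed
qed

end

section \<open>Completing a partial colouring by Zorn's lemma\<close>

context rooted_graph
begin

text \<open>A maximal valid state has no uncoloured edge by \<open>valid_progress\<close>. Chains
  have upper bounds because the clauses of \<open>valid\<close> about colours at vertices involve at
  most two vertices, whose finitely many edges have their final status in some member of the chain,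
  while the orbits only shrink in the limit.\<close>

lemma complete_colouring:
  assumes start: "valid B0 R0 A1"
  shows "\<exists>B R A. valid B R A \<and> B0 \<subseteq> B \<and> R0 \<subseteq> R \<and> B \<union> R = E"
proof -
  \<comment> \<open>A state is coded by the set of its coloured edges together with the permutations that are
    already excluded, so that growing states are growing sets.\<close>
  define Bl where "Bl T = {e. Inl (e, False) \<in> T}" for T :: "('a set \<times> bool + ('a \<Rightarrow> 'a)) set"
  define Rd where "Rd T = {e. Inl (e, True) \<in> T}" for T :: "('a set \<times> bool + ('a \<Rightarrow> 'a)) set"
  define Gp where "Gp T = {\<phi>. Inr \<phi> \<notin> T}" for T :: "('a set \<times> bool + ('a \<Rightarrow> 'a)) set"
  define code :: "'a set set \<Rightarrow> 'a set set \<Rightarrow> ('a \<Rightarrow> 'a) set \<Rightarrow> ('a set \<times> bool + ('a \<Rightarrow> 'a)) set"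
    where "code B R A = {t. \<exists>e. t = Inl (e, False) \<and> e \<in> B} \<union> {t. \<exists>e. t = Inl (e, True) \<and> e \<in> R}
      \<union> {t. \<exists>\<phi>. t = Inr \<phi> \<and> \<phi> \<notin> A}" for B R A
  have [simp]: "Bl (code B R A) = B" "Rd (code B R A) = R" "Gp (code B R A) = A" for B R A
    by (auto simp: Bl_def Rd_def Gp_def code_def)
  have code_id: "code (Bl T) (Rd T) (Gp T) = T" for T
  proof (rule set_eqI)
    fix t show "t \<in> code (Bl T) (Rd T) (Gp T) \<longleftrightarrow> t \<in> T"
    proof (cases t)
      case (Inl p)
      then show ?thesis by (cases p, cases "snd p") (auto simp: code_def Bl_def Rd_def Gp_def)
    next
      case (Inr \<phi>)
      then show ?thesis by (simp add: code_def Gp_def)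
    qed
  qed
  have code_mono: "code B R A \<subseteq> code B' R' A'" if "B \<subseteq> B'" "R \<subseteq> R'" "A' \<subseteq> A" for B R A B' R' A'
    using that by (auto simp: code_def)
  define \<S> where "\<S> = {T. code B0 R0 A1 \<subseteq> T \<and> valid (Bl T) (Rd T) (Gp T)}"
  have "\<exists>M\<in>\<S>. \<forall>X\<in>\<S>. M \<subseteq> X \<longrightarrow> X = M"
  proof (rule subset_Zorn_nonempty)
    show "\<S> \<noteq> {}" using start by (auto simp: \<S>_def intro!: exI[of _ "code B0 R0 A1"])
    fix \<C> assume ne: "\<C> \<noteq> {}" and chain: "subset.chain \<S> \<C>"
    define T where "T = \<Union>\<C>"
    have CS: "C \<in> \<S>" if "C \<in> \<C>" for C using chain that by (auto simp: subset.chain_def)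
    have val: "valid (Bl C) (Rd C) (Gp C)" if "C \<in> \<C>" for C using CS[OF that] by (simp add: \<S>_def)
    obtain C0 where C0: "C0 \<in> \<C>" using ne by blast
    have BlT: "e \<in> Bl T \<longleftrightarrow> (\<exists>C\<in>\<C>. e \<in> Bl C)" and RdT: "e \<in> Rd T \<longleftrightarrow> (\<exists>C\<in>\<C>. e \<in> Rd C)" for e
      by (auto simp: T_def Bl_def Rd_def)
    have GpT: "\<phi> \<in> Gp T \<longleftrightarrow> (\<forall>C\<in>\<C>. \<phi> \<in> Gp C)" for \<phi> by (auto simp: T_def Gp_def)
    have BE: "Bl T \<subseteq> E" "Rd T \<subseteq> E" using BlT RdT validD(1,2)[OF val] by blast+
    have loc: "\<exists>C\<in>\<C>. \<forall>v\<in>W. neighbours (Bl C) v = neighbours (Bl T) v \<and>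
        neighbours (Rd C) v = neighbours (Rd T) v \<and>
        neighbours (E - Bl C - Rd C) v = neighbours (E - Bl T - Rd T) v"
      if W: "finite W" "W \<subseteq> V" for W
    proof -
      \<comment> \<open>All colour entries of the union on edges at \<open>W\<close>. They are
        finitely many, so one member of the chain contains them and agrees with the union at all
        vertices of \<open>W\<close>.\<close>
      define S where "S = (\<lambda>((v, w), b). Inl ({v, w}, b)) ` (Sigma W (neighbours E) \<times> (UNIV :: bool set)) \<inter> T"
      have "finite (Sigma W (neighbours E))" using W degree by (intro finite_SigmaI) auto
      then have "finite S" unfolding S_def by (intro finite_Int disjI1 finite_imageI finite_cartesian_product) simp_all
      moreover have "S \<subseteq> \<Union>\<C>" by (auto simp: S_def T_def)
      ultimately obtain C where C: "C \<in> \<C>" "S \<subseteq> C"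
        using finite_subset_Union_chain[OF _ _ ne chain] by metis
      have CT: "C \<subseteq> T" using C(1) by (auto simp: T_def)
      have in_C: "Inl ({v, w}, b) \<in> C" if "v \<in> W" "Inl ({v, w}, b) \<in> T" "{v, w} \<in> E" for v w b
      proof -
        have "Inl ({v, w}, b) \<in> S" unfolding S_def using that by (force simp: image_iff)
        then show ?thesis using C(2) by blast
      qed
      have nB: "neighbours (Bl C) v = neighbours (Bl T) v" and nR: "neighbours (Rd C) v = neighbours (Rd T) v"
        if "v \<in> W" for v
        using CT in_C[OF that] BE by (auto simp: Bl_def Rd_def)
      have "neighbours (E - Bl C - Rd C) v = neighbours (E - Bl T - Rd T) v" if "v \<in> W" for v
        using nB[OF that] nR[OF that] by (simp only: neighbours_Diff)
      then show ?thesis using C(1) nB nR by blast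
    qed
    have "valid (Bl T) (Rd T) (Gp T)"
      unfolding valid_def
    proof (intro conjI ballI allI impI)
      show "Bl T \<subseteq> E" "Rd T \<subseteq> E" by fact+
      show "Bl T \<inter> Rd T = {}"
      proof (rule ccontr)
        assume "\<not> ?thesis"
        then obtain e C C' where e: "C \<in> \<C>" "e \<in> Bl C" "C' \<in> \<C>" "e \<in> Rd C'"
          using BlT RdT by blast
        then have "C \<subseteq> C' \<or> C' \<subseteq> C" using chain by (auto simp: subset.chain_def)
        then have "e \<in> Bl C' \<inter> Rd C' \<or> e \<in> Bl C \<inter> Rd C" using e by (auto simp: Bl_def Rd_def)
        then show False using validD(3)[OF val] e by blast
      qed
      show "Gp T \<subseteq> A0" using validD(4)[OF val[OF C0]] C0 GpT by blast
      show "permutation_group V (Gp T)"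
      proof
        show "id \<in> Gp T" using permutation_group.id_mem[OF validD(5)[OF val]] by (simp add: GpT)
        show "\<phi> \<circ> \<psi> \<in> Gp T" if "\<phi> \<in> Gp T" "\<psi> \<in> Gp T" for \<phi> \<psi>
          using permutation_group.comp_mem[OF validD(5)[OF val]] that by (simp add: GpT)
        show "inv_into V \<phi> \<in> Gp T" if "\<phi> \<in> Gp T" for \<phi>
          using permutation_group.inv_mem[OF validD(5)[OF val]] that by (simp add: GpT)
        show "bij_betw \<phi> V V" if "\<phi> \<in> Gp T" for \<phi>
          using permutation_group.bij[OF validD(5)[OF val[OF C0]]] that C0 by (simp add: GpT)
      qed
      show "graph_automorphism V (Bl T) \<phi>" "graph_automorphism V (Rd T) \<phi>" if \<phi>: "\<phi> \<in> Gp T" for \<phi>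
      proof -
        have *: "graph_automorphism V (Bl C) \<phi> \<and> graph_automorphism V (Rd C) \<phi>" if "C \<in> \<C>" for C
          using validD(6)[OF val[OF that]] \<phi> that GpT by blast
        have "bij_betw \<phi> V V" using *[OF C0] by (simp add: graph_automorphism_def)
        moreover have "{a, b} \<in> Bl C \<longleftrightarrow> {\<phi> a, \<phi> b} \<in> Bl C" "{a, b} \<in> Rd C \<longleftrightarrow> {\<phi> a, \<phi> b} \<in> Rd C"
          if "C \<in> \<C>" "a \<in> V" "b \<in> V" for C a b
          using *[OF that(1)] that(2,3) by (simp_all add: graph_automorphism_def)
        ultimately show "graph_automorphism V (Bl T) \<phi>" "graph_automorphism V (Rd T) \<phi>"
          unfolding graph_automorphism_def BlT RdT by (simp_all cong: bex_cong)
      qed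
      show "\<phi> \<in> Gp T"
        if h: "\<phi> \<in> A0" "Bl T \<subseteq> B'" "Rd T \<subseteq> R'" "B' \<inter> R' = {}" "B' \<union> R' = E"
          "graph_automorphism V B' \<phi>" "graph_automorphism V R' \<phi>" for \<phi> B' R'
        unfolding GpT
      proof
        fix C assume C: "C \<in> \<C>"
        then have "Bl C \<subseteq> B'" "Rd C \<subseteq> R'" using h(2,3) BlT RdT by blast+
        then show "\<phi> \<in> Gp C" using validD(7)[OF val[OF C]] h by blast
      qed
      show "neighbours (E - Bl T - Rd T) r = {}"
      proof -
        obtain C where C: "C \<in> \<C>" "neighbours (E - Bl C - Rd C) r = neighbours (E - Bl T - Rd T) r"
          using loc[of "{r}"] rV by auto
        then show ?thesis using validD(8)[OF val[OF C(1)]] by simp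
      qed
      show "card (neighbours (E - Bl T - Rd T) v) = d \<or> orbit (Gp T) v = {v} \<or>
          finite (orbit (Gp T) v) \<and> card (orbit (Gp T) v) \<le> card (neighbours (E - Bl T - Rd T) v)"
        if v: "v \<in> V" for v
      proof -
        obtain C where C: "C \<in> \<C>" "neighbours (E - Bl C - Rd C) v = neighbours (E - Bl T - Rd T) v"
          using loc[of "{v}"] v by auto
        have sub: "orbit (Gp T) v \<subseteq> orbit (Gp C) v" using C(1) GpT by (intro orbit_mono) blast
        have "id \<in> Gp T" using permutation_group.id_mem[OF validD(5)[OF val]] by (simp add: GpT)
        then have self: "v \<in> orbit (Gp T) v" unfolding orbit_def by (metis id_apply image_eqI)
        have "card (neighbours (E - Bl C - Rd C) v) = d \<or> orbit (Gp C) v = {v} \<or>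
          finite (orbit (Gp C) v) \<and> card (orbit (Gp C) v) \<le> card (neighbours (E - Bl C - Rd C) v)"
          using validD(9)[OF val[OF C(1)]] v by blast
        then show ?thesis
        proof (elim disjE)
          assume "orbit (Gp C) v = {v}"
          then have "orbit (Gp T) v = {v}" using sub self by auto
          then show ?thesis by blast
        next
          assume a: "finite (orbit (Gp C) v) \<and> card (orbit (Gp C) v) \<le> card (neighbours (E - Bl C - Rd C) v)"
          then have "finite (orbit (Gp T) v)" "card (orbit (Gp T) v) \<le> card (orbit (Gp C) v)"
            using sub finite_subset card_mono by blast+
          then show ?thesis using a C(2) by simp
        qed (use C(2) in simp)
      qed
      show "neighbours (E - Bl T - Rd T) v \<noteq> {}"
        if v: "v \<in> V" "v \<noteq> r" "neighbours (Bl T) v = {}" for v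
      proof -
        obtain C where C: "C \<in> \<C>" "neighbours (E - Bl C - Rd C) v = neighbours (E - Bl T - Rd T) v"
          "neighbours (Bl C) v = neighbours (Bl T) v"
          using loc[of "{v}"] v by auto
        then show ?thesis using validD(10)[OF val[OF C(1)]] v by metis
      qed
      show "neighbours (E - Bl T - Rd T) x \<noteq> {} \<or> neighbours (E - Bl T - Rd T) z \<noteq> {}"
        if h: "{x, z} \<in> Bl T" "{x, z} \<noteq> {s, u}" "neighbours (Bl T) x = {z}" "neighbours (Bl T) z = {x}" for x z
      proof -
        have "x \<in> V" "z \<in> V" using h(1) BE(1) simple_graphD[OF simpleE] by blast+
        then have "\<exists>C\<in>\<C>. \<forall>v\<in>{x, z}. neighbours (Bl C) v = neighbours (Bl T) v \<and>
          neighbours (Rd C) v = neighbours (Rd T) v \<and>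
          neighbours (E - Bl C - Rd C) v = neighbours (E - Bl T - Rd T) v" by (intro loc) auto
        then obtain C where C1: "C \<in> \<C>" and Cv: "\<forall>v\<in>{x, z}. neighbours (Bl C) v = neighbours (Bl T) v \<and>
          neighbours (Rd C) v = neighbours (Rd T) v \<and>
          neighbours (E - Bl C - Rd C) v = neighbours (E - Bl T - Rd T) v" by (rule bexE)
        have "neighbours (E - Bl C - Rd C) x = neighbours (E - Bl T - Rd T) x"
          "neighbours (E - Bl C - Rd C) z = neighbours (E - Bl T - Rd T) z"
          "neighbours (Bl C) x = {z}" "neighbours (Bl C) z = {x}"
          using bspec[OF Cv, of x] bspec[OF Cv, of z] unfolding h(3,4) by blast+
        note C = C1 this
        have "z \<in> neighbours (Bl C) x" unfolding C(4) by simp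
        then have "{x, z} \<in> Bl C" by (simp only: in_neighbours)
        then show ?thesis using validD(11)[OF val[OF C(1)]] h(2) C(2-5) by metis
      qed
      show "\<not> (card (neighbours (E - Bl T - Rd T) x) = 1 \<and> card (neighbours (E - Bl T - Rd T) z) = 1)"
        if h: "{x, z} \<in> E - Bl T - Rd T" "neighbours (Bl T) x = {}" "neighbours (Bl T) z = {}" for x z
      proof -
        have "x \<in> V" "z \<in> V" using h(1) simple_graphD[OF simpleE] by blast+
        then have "\<exists>C\<in>\<C>. \<forall>v\<in>{x, z}. neighbours (Bl C) v = neighbours (Bl T) v \<and>
          neighbours (Rd C) v = neighbours (Rd T) v \<and>
          neighbours (E - Bl C - Rd C) v = neighbours (E - Bl T - Rd T) v" by (intro loc) auto
        then obtain C where C1: "C \<in> \<C>" and Cv: "\<forall>v\<in>{x, z}. neighbours (Bl C) v = neighbours (Bl T) v \<and>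
          neighbours (Rd C) v = neighbours (Rd T) v \<and>
          neighbours (E - Bl C - Rd C) v = neighbours (E - Bl T - Rd T) v" by (rule bexE)
        have "neighbours (E - Bl C - Rd C) x = neighbours (E - Bl T - Rd T) x"
          "neighbours (E - Bl C - Rd C) z = neighbours (E - Bl T - Rd T) z"
          "neighbours (Bl C) x = {}" "neighbours (Bl C) z = {}"
          using bspec[OF Cv, of x] bspec[OF Cv, of z] unfolding h(2,3) by blast+
        note C = C1 this
        have "z \<in> neighbours (E - Bl C - Rd C) x" unfolding C(2) using h(1) by simp
        then have "{x, z} \<in> E - Bl C - Rd C" by (simp only: in_neighbours)
        then show ?thesis using validD(12)[OF val[OF C(1)]] C(2-5) by metis
      qed
    qed
    moreover have "code B0 R0 A1 \<subseteq> T" using CS[OF C0] C0 by (auto simp: \<S>_def T_def)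
    ultimately show "\<Union>\<C> \<in> \<S>" by (simp add: \<S>_def T_def)
  qed
  then obtain M where M: "M \<in> \<S>" and max: "\<And>X. X \<in> \<S> \<Longrightarrow> M \<subseteq> X \<Longrightarrow> X = M" by blast
  have Mc: "code B0 R0 A1 \<subseteq> M" and Mv: "valid (Bl M) (Rd M) (Gp M)" using M by (simp_all add: \<S>_def)
  have "E - Bl M - Rd M = {}"
  proof (rule ccontr)
    assume "\<not> ?thesis"
    from valid_progress[OF Mv this] obtain X Y where XY: "X \<subseteq> E - Bl M - Rd M" "X \<noteq> {}" "Y \<subseteq> X"
      and v: "valid (Bl M \<union> (X - Y)) (Rd M \<union> Y) (preserving V (Gp M) Y)" by blast
    define M' where "M' = code (Bl M \<union> (X - Y)) (Rd M \<union> Y) (preserving V (Gp M) Y)"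
    have "code (Bl M) (Rd M) (Gp M) \<subseteq> M'"
      unfolding M'_def by (rule code_mono) (auto simp: preserving_subset)
    then have MM: "M \<subseteq> M'" by (simp add: code_id)
    moreover have "M' \<in> \<S>" using v Mc MM by (auto simp: \<S>_def M'_def)
    ultimately have "M' = M" by (rule max[rotated])
    then have "Bl M \<union> (X - Y) = Bl M" "Rd M \<union> Y = Rd M"
      using \<open>\<And>B R A. Bl (code B R A) = B\<close> \<open>\<And>B R A. Rd (code B R A) = R\<close> unfolding M'_def by metis+
    then show False using XY by blast
  qed
  then have "Bl M \<union> Rd M = E" using validD(1,2)[OF Mv] by blast
  moreover have "B0 \<subseteq> Bl M" "R0 \<subseteq> Rd M"
    using Mc by (auto simp: code_def Bl_def Rd_def)
  ultimately show ?thesis using Mv by blast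
qed

lemma rigid_colouring:
  assumes start: "valid {{s, u}} R0 A0"
  shows "\<exists>B R. {s, u} \<in> B \<and> R0 \<subseteq> R \<and> B \<inter> R = {} \<and> B \<union> R = E \<and>
    (\<forall>v\<in>V. v \<noteq> r \<longrightarrow> neighbours B v \<noteq> {}) \<and>
    (\<forall>x z. {x, z} \<in> B \<longrightarrow> neighbours B x = {z} \<longrightarrow> neighbours B z = {x} \<longrightarrow> {x, z} = {s, u}) \<and>
    (\<forall>\<phi>\<in>A0. graph_automorphism V B \<phi> \<longrightarrow> graph_automorphism V R \<phi> \<longrightarrow> (\<forall>v\<in>V. \<phi> v = v))"
proof -
  obtain B R A where v: "valid B R A" and sub: "{{s, u}} \<subseteq> B" "R0 \<subseteq> R" and BR: "B \<union> R = E"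
    using complete_colouring[OF start] by blast
  have none: "neighbours (E - B - R) v = {}" for v using BR by auto
  have orb: "orbit A v = {v}" if "v \<in> V" for v
  proof -
    have "v \<in> orbit A v" by (rule permutation_group.orbit_refl[OF validD(5)[OF v]])
    then have "\<not> (finite (orbit A v) \<and> card (orbit A v) \<le> 0)"
      by (metis card_gt_0_iff empty_iff not_less)
    moreover have "card (neighbours (E - B - R) v) = d \<or> orbit A v = {v} \<or>
        finite (orbit A v) \<and> card (orbit A v) \<le> card (neighbours (E - B - R) v)"
      using validD(9)[OF v] that by blast
    ultimately show ?thesis using d2 none[of v] by auto
  qed
  have "\<phi> v = v" if "\<phi> \<in> A0" "graph_automorphism V B \<phi>" "graph_automorphism V R \<phi>" "v \<in> V" for \<phi> v
  proof -
    have "\<phi> \<in> A" using validD(7)[OF v] that(1-3) validD(3)[OF v] BR by blast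
    then have "\<phi> v \<in> orbit A v" by (auto simp: orbit_def)
    then show ?thesis using orb[OF that(4)] by simp
  qed
  moreover have "neighbours B v \<noteq> {}" if "v \<in> V" "v \<noteq> r" for v
    using validD(10)[OF v] that none by blast
  moreover have "{x, z} = {s, u}"
    if "{x, z} \<in> B" "neighbours B x = {z}" "neighbours B z = {x}" for x z
  proof (rule ccontr)
    assume "{x, z} \<noteq> {s, u}"
    from validD(11)[OF v, rule_format, OF that(1) this that(2,3)] show False using none by metis
  qed
  moreover have "{s, u} \<in> B" using sub(1) by simp
  ultimately show ?thesis
    using sub(2) BR validD(3)[OF v] by (intro exI[of _ B] exI[of _ R] conjI ballI allI impI) simp_all
qed

end

section \<open>Graphs of finite degree\<close>

lemma two_colours:
  assumes R: "R \<subseteq> E" and simple: "simple_graph V E"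
    and triv: "\<And>\<phi> v. graph_automorphism V E \<phi> \<Longrightarrow> graph_automorphism V R \<phi> \<Longrightarrow> v \<in> V \<Longrightarrow> \<phi> v = v"
  shows "dist_index_le V E 2"
proof -
  define c :: "'a set \<Rightarrow> nat" where "c e = (if e \<in> R then 1 else 0)" for e
  have "\<phi> v = v" if \<phi>: "graph_automorphism V E \<phi>" "preserves_aut E c \<phi>" and v: "v \<in> V" for \<phi> v
  proof (rule triv[OF \<phi>(1) _ v])
    have "{\<phi> a, \<phi> b} \<in> R \<longleftrightarrow> {a, b} \<in> R" if "a \<in> V" "b \<in> V" for a b
    proof (cases "{a, b} \<in> E")
      case True
      then have "c (\<phi> ` {a, b}) = c {a, b}" using \<phi>(2) unfolding preserves_aut_def by blast
      then show ?thesis by (auto simp: c_def split: if_splits)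
    next
      case False
      then have "{\<phi> a, \<phi> b} \<notin> E" using \<phi>(1) that by (simp add: graph_automorphism_def)
      then show ?thesis using False R by blast
    qed
    then show "graph_automorphism V R \<phi>" using \<phi>(1) by (simp add: graph_automorphism_def)
  qed
  then have "distinguishing_edge_colouring V E c" by (simp add: distinguishing_edge_colouring_def)
  moreover have "\<forall>e\<in>E. c e < 2" by (simp add: c_def)
  ultimately show ?thesis unfolding dist_index_le_def by blast
qed

lemma closed_component:
  assumes conn: "connected_graph V E" and T: "T \<subseteq> V" "T \<noteq> {}"
    and closed: "\<And>a. a \<in> T \<Longrightarrow> neighbours E a \<subseteq> T"
  shows "V = T"
proof (rule antisym[OF _ T(1)])
  show "V \<subseteq> T"
  proof
    fix w assume "w \<in> V"
    obtain t where t: "t \<in> T" using T by blast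
    have "(\<lambda>x y. {x, y} \<in> E)\<^sup>*\<^sup>* t w"
      using conn \<open>w \<in> V\<close> t T by (auto simp: connected_graph_def)
    then show "w \<in> T"
    proof (induction rule: rtranclp_induct)
      case (step y z)
      then have "z \<in> neighbours E y" by simp
      then show ?case using closed step by blast
    qed (rule t)
  qed
qed

declare in_neighbours [simp del]

locale finite_degree_graph =
  fixes V :: "'a set" and E :: "'a set set" and d :: nat
  assumes simple: "simple_graph V E"
    and degree: "v \<in> V \<Longrightarrow> finite (neighbours E v) \<and> card (neighbours E v) = d"
    and conn: "connected_graph V E"
    and d2: "2 \<le> d"
begin

abbreviation "N \<equiv> neighbours E"

lemma N_sym: "w \<in> N v \<Longrightarrow> v \<in> N w"
  using neighbours_commute by metis

lemma N_V: "w \<in> N v \<Longrightarrow> w \<in> V \<and> v \<in> V \<and> v \<noteq> w"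
  using simple_graphD[OF simple, of v w] by (simp add: in_neighbours)

lemma N_irrefl: "v \<notin> N v"
  using N_V by blast

text \<open>The edges at \<open>r\<close>, \<open>s\<close> and \<open>u\<close> are coloured first: \<open>{s, u}\<close> is blue, the others are red.\<close>

lemma path_colouring:
  fixes r s u
  defines "S \<equiv> {r, s, u}"
  assumes path: "s \<in> N r" "u \<in> N s" "u \<notin> N r" "r \<noteq> u"
    and small: "\<And>v. v \<in> V - S \<Longrightarrow> N v \<inter> S \<noteq> {} \<Longrightarrow>
      card {w \<in> V - S. N w \<inter> S = N v \<inter> S} + card (N v \<inter> S) \<le> d"
    and free: "\<And>v w. w \<in> N v \<Longrightarrow> v \<notin> S \<Longrightarrow> w \<notin> S \<Longrightarrow>
      \<not> (card (N v \<inter> S) = d - 1 \<and> card (N w \<inter> S) = d - 1)"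
  shows "dist_index_le V E 2"
proof -
  have V: "r \<in> V" "s \<in> V" "u \<in> V" "r \<noteq> s" "s \<noteq> u" using N_V[OF path(1)] N_V[OF path(2)] by auto
  define A0 where "A0 = {\<phi>. graph_automorphism V E \<phi> \<and> \<phi> r = r \<and> \<phi> s = s \<and> \<phi> u = u}"
  define R0 where "R0 = {e \<in> E. e \<inter> S \<noteq> {}} - {{s, u}}"
  have su: "{s, u} \<in> E" using path(2) by (simp add: in_neighbours)
  have inv_fix: "inv_into V \<phi> v = v" if "graph_automorphism V E \<phi>" "\<phi> v = v" "v \<in> V" for \<phi> v
    using that bij_betw_inv_into_left[of \<phi> V V v] by (simp add: graph_automorphism_def)
  interpret rooted_graph V A0 E d r s u
  proof
    show "id \<in> A0" by (simp add: A0_def automorphism_id)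
    show "\<phi> \<circ> \<psi> \<in> A0" if "\<phi> \<in> A0" "\<psi> \<in> A0" for \<phi> \<psi>
      using that by (simp add: A0_def automorphism_comp)
    show "inv_into V \<phi> \<in> A0" if "\<phi> \<in> A0" for \<phi>
      using that inv_fix V by (simp add: A0_def automorphism_inv_into)
    show "bij_betw \<phi> V V" if "\<phi> \<in> A0" for \<phi>
      using that by (simp add: A0_def graph_automorphism_def)
    show "graph_automorphism V E \<phi>" if "\<phi> \<in> A0" for \<phi> using that by (simp add: A0_def)
  qed (use simple degree conn d2 V in auto)
  have U: "E - {{s, u}} - R0 = {e \<in> E. e \<inter> S = {}}" by (auto simp: R0_def S_def)
  define U where "U = {e \<in> E. e \<inter> S = {}}"
  have nU: "neighbours U v = (if v \<in> S then {} else N v - S)" for v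
    by (auto simp: U_def in_neighbours)
  have nB: "neighbours {{s, u}} v = (if v = s then {u} else if v = u then {s} else {})" for v
    using V by (auto simp: in_neighbours doubleton_eq_iff)
  have cU: "card (neighbours U v) = d - card (N v \<inter> S)" if "v \<in> V" "v \<notin> S" for v
    using nU[of v] that degree[of v] card_Diff_subset_Int[of "N v" S] by (simp add: S_def)
  have J_less: "card (N v \<inter> S) < d" if v: "v \<in> V" "v \<notin> S" for v
  proof (cases "N v \<inter> S = {}")
    case True
    then show ?thesis using d2 by simp
  next
    case False
    define K where "K = {w \<in> V - S. N w \<inter> S = N v \<inter> S}"
    obtain a where a: "a \<in> S" "a \<in> N v" using False by blast
    have aV: "a \<in> V" using a N_V by blast
    have "K \<subseteq> N a"
    proof
      fix w assume "w \<in> K"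
      then have "a \<in> N w" using a unfolding K_def by blast
      then show "w \<in> N a" by (rule N_sym)
    qed
    then have "finite K" using degree[OF aV] finite_subset by blast
    moreover have "v \<in> K" using v by (simp add: K_def)
    ultimately have "0 < card K" using card_gt_0_iff by blast
    moreover have "card K + card (N v \<inter> S) \<le> d" unfolding K_def using small[of v] v False by simp
    ultimately show ?thesis by linarith
  qed
  have "valid {{s, u}} R0 A0"
    unfolding valid_def U U_def[symmetric]
  proof (intro conjI ballI allI impI)
    show "{{s, u}} \<subseteq> E" "R0 \<subseteq> E" "{{s, u}} \<inter> R0 = {}" "A0 \<subseteq> A0"
      using su by (auto simp: R0_def)
    show "permutation_group V A0" by (rule permutation_group_axioms)
    show "graph_automorphism V {{s, u}} \<phi>" "graph_automorphism V R0 \<phi>" if \<phi>: "\<phi> \<in> A0" for \<phi>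
    proof -
      have fix3: "\<phi> r = r" "\<phi> s = s" "\<phi> u = u" using \<phi> by (simp_all add: A0_def)
      have eq: "\<phi> a = r \<longleftrightarrow> a = r" "\<phi> a = s \<longleftrightarrow> a = s" "\<phi> a = u \<longleftrightarrow> a = u" if "a \<in> V" for a
        using perm_inj[OF \<phi>] fix3 V that by (metis inj_on_eq_iff)+
      show "graph_automorphism V {{s, u}} \<phi>"
        using bij[OF \<phi>] eq by (auto simp: graph_automorphism_def doubleton_eq_iff)
      then have "graph_automorphism V (U \<union> {{s, u}}) \<phi>"
      proof (rule automorphism_Un[rotated])
        have "\<phi> a \<in> S \<longleftrightarrow> a \<in> S" if "a \<in> V" for a using eq[OF that] by (simp add: S_def)
        moreover have "{a, b} \<in> U \<longleftrightarrow> {a, b} \<in> E \<and> a \<notin> S \<and> b \<notin> S" for a b by (auto simp: U_def)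
        ultimately show "graph_automorphism V U \<phi>"
          using aut0[OF \<phi>] by (simp add: graph_automorphism_def)
      qed
      from automorphism_Diff[OF aut0[OF \<phi>] this]
      show "graph_automorphism V R0 \<phi>"
      proof -
        have "E - (U \<union> {{s, u}}) = R0" by (auto simp: R0_def U_def)
        then show ?thesis using \<open>graph_automorphism V (E - (U \<union> {{s, u}})) \<phi>\<close> by simp
      qed
    qed
    show "\<phi> \<in> A0" if "\<phi> \<in> A0" for \<phi> using that .
    show "neighbours U r = {}" by (simp add: nU S_def)
    show "card (neighbours U v) = d \<or> orbit A0 v = {v} \<or>
        finite (orbit A0 v) \<and> card (orbit A0 v) \<le> card (neighbours U v)" if v: "v \<in> V" for v
    proof (cases "v \<in> S")
      case True
      then have "orbit A0 v = {v}" by (intro fixed_orbit) (auto simp: S_def A0_def)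
      then show ?thesis by blast
    next
      case False
      show ?thesis
      proof (cases "N v \<inter> S = {}")
        case True
        then show ?thesis using cU[OF v False] by simp
      next
        case ne: False
        define K where "K = {w \<in> V - S. N w \<inter> S = N v \<inter> S}"
        have sub: "orbit A0 v \<subseteq> K"
        proof
          fix w assume "w \<in> orbit A0 v"
          then obtain \<phi> where \<phi>: "\<phi> \<in> A0" "w = \<phi> v" by (auto simp: orbit_def)
          have fix3: "\<phi> r = r" "\<phi> s = s" "\<phi> u = u" using \<phi> by (simp_all add: A0_def)
          then have imS: "\<phi> ` S = S" by (simp add: S_def)
          have SV: "S \<subseteq> V" using V by (simp add: S_def)
          have "\<phi> v \<notin> S"
            using perm_inj[OF \<phi>(1)] fix3 V v False unfolding S_def by (metis inj_on_eq_iff insert_iff singletonD)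
          moreover have "N (\<phi> v) \<inter> S = \<phi> ` (N v \<inter> S)"
            using automorphism_neighbours[OF aut0[OF \<phi>(1)] simple v] imS
              inj_on_image_Int[OF perm_inj[OF \<phi>(1)] neighbours_subset[OF simple] SV] by metis
          moreover have "\<phi> ` (N v \<inter> S) = id ` (N v \<inter> S)"
            by (rule image_cong) (use fix3 in \<open>auto simp: S_def\<close>)
          ultimately show "w \<in> K" using \<phi>(2) perm_in[OF \<phi>(1) v] by (simp add: K_def)
        qed
        obtain a where a: "a \<in> S" "a \<in> N v" using ne by blast
        have aV: "a \<in> V" using a N_V by blast
        have "K \<subseteq> N a"
        proof
          fix w assume "w \<in> K"
          then have "a \<in> N w" using a unfolding K_def by blast
          then show "w \<in> N a" by (rule N_sym)
        qed
        then have finK: "finite K" using degree[OF aV] finite_subset by blast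
        have "card K + card (N v \<inter> S) \<le> d" unfolding K_def using small[of v] v False ne by simp
        then have "card (orbit A0 v) \<le> card (neighbours U v)"
          using card_mono[OF finK sub] cU[OF v False] by simp
        then show ?thesis using finite_subset[OF sub finK] by blast
      qed
    qed
    show "neighbours U v \<noteq> {}" if "v \<in> V" "v \<noteq> r" "neighbours {{s, u}} v = {}" for v
    proof -
      have "v \<notin> S" using that nB[of v] by (auto simp: S_def split: if_splits)
      then have "0 < card (neighbours U v)" using J_less[of v] cU[of v] that by simp
      then show ?thesis by auto
    qed
    show "neighbours U x \<noteq> {} \<or> neighbours U z \<noteq> {}" if "{x, z} \<in> {{s, u}}" "{x, z} \<noteq> {s, u}" for x z
      using that by simp
    show "\<not> (card (neighbours U x) = 1 \<and> card (neighbours U z) = 1)" if h: "{x, z} \<in> U" for x z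
    proof
      assume one: "card (neighbours U x) = 1 \<and> card (neighbours U z) = 1"
      have xz: "x \<notin> S" "z \<notin> S" "z \<in> N x" using h by (auto simp: U_def in_neighbours)
      then have "x \<in> V" "z \<in> V" using N_V by blast+
      then have "card (N x \<inter> S) = d - 1" "card (N z \<inter> S) = d - 1"
        using cU[of x] cU[of z] one xz by linarith+
      then show False using free[OF xz(3,1,2)] by blast
    qed
  qed
  from rigid_colouring[OF this] obtain B R where BR: "{s, u} \<in> B" "R0 \<subseteq> R" "B \<inter> R = {}" "B \<union> R = E"
    and blue: "\<And>v. v \<in> V \<Longrightarrow> v \<noteq> r \<Longrightarrow> neighbours B v \<noteq> {}"
    and isolated: "\<And>x z. {x, z} \<in> B \<Longrightarrow> neighbours B x = {z} \<Longrightarrow> neighbours B z = {x} \<Longrightarrow> {x, z} = {s, u}"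
    and triv: "\<And>\<phi> v. \<phi> \<in> A0 \<Longrightarrow> graph_automorphism V B \<phi> \<Longrightarrow> graph_automorphism V R \<phi> \<Longrightarrow> v \<in> V \<Longrightarrow> \<phi> v = v"
    by metis
  have BE: "B \<subseteq> E" using BR(4) by blast
  have simB: "simple_graph V B" using simple_graph_mono[OF simple BE] .
  have Bedge: "{a, b} = {s, u}" if "{a, b} \<in> B" "a \<in> S" for a b
  proof -
    have "{a, b} \<notin> R0" using that BR(2,3) by blast
    then show ?thesis using that BE unfolding R0_def by blast
  qed
  have Br: "neighbours B r = {}"
  proof (rule ccontr)
    assume "neighbours B r \<noteq> {}"
    then obtain b where "{r, b} \<in> B" by (auto simp: in_neighbours)
    then have "{r, b} = {s, u}" by (rule Bedge) (simp add: S_def)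
    then show False using V path(4) by (auto simp: doubleton_eq_iff)
  qed
  have "b = u" if "{s, b} \<in> B" for b
  proof -
    have "{s, b} = {s, u}" by (rule Bedge[OF that]) (simp add: S_def)
    then show ?thesis using V by (auto simp: doubleton_eq_iff)
  qed
  then have Bs: "neighbours B s = {u}"  using BR(1) unfolding neighbours_def by blast
  have us: "{u, s} \<in> B" using BR(1) by (simp add: insert_commute)
  have "b = s" if "{u, b} \<in> B" for b
  proof -
    have "{u, b} = {s, u}" by (rule Bedge[OF that]) (simp add: S_def)
    then show ?thesis using V by (auto simp: doubleton_eq_iff)
  qed
  then have Bu: "neighbours B u = {s}" using us unfolding neighbours_def by blast
  show ?thesis
  proof (rule two_colours[of R])
    show "R \<subseteq> E" using BR(4) by blast
    show "simple_graph V E" by (rule simple)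
    fix \<phi> v assume \<phi>: "graph_automorphism V E \<phi>" "graph_automorphism V R \<phi>" and v: "v \<in> V"
    have "B = E - R" using BR by blast
    then have \<phi>B: "graph_automorphism V B \<phi>" using automorphism_Diff[OF \<phi>] by simp
    have \<phi>V: "\<phi> a \<in> V" if "a \<in> V" for a using \<phi>(1) that bij_betw_apply by (fastforce simp: graph_automorphism_def)
    have nb: "neighbours B (\<phi> a) = \<phi> ` neighbours B a" if "a \<in> V" for a
      using automorphism_neighbours[OF \<phi>B simB that] .
    have "neighbours B (\<phi> r) = {}" using nb[OF V(1)] Br by simp
    then have fr: "\<phi> r = r" using blue[OF \<phi>V[OF V(1)]] by blast
    have 1: "neighbours B (\<phi> s) = {\<phi> u}" "neighbours B (\<phi> u) = {\<phi> s}"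
      using nb[OF V(2)] nb[OF V(3)] Bs Bu by simp_all
    have "\<phi> u \<in> neighbours B (\<phi> s)" using 1 by simp
    then have "{\<phi> s, \<phi> u} \<in> B" by (simp add: in_neighbours)
    from isolated[OF this 1] have su': "{\<phi> s, \<phi> u} = {s, u}" .
    \<comment> \<open>So far \<open>{s, u}\<close> is preserved only as a set. Its ends are not
      exchanged, because \<open>s\<close> is adjacent to the fixed vertex \<open>r\<close> and
      \<open>u\<close> is not.\<close>
    have "\<phi> s \<in> N r"
    proof -
      have "N (\<phi> r) = \<phi> ` N r" by (rule automorphism_neighbours[OF \<phi>(1) simple V(1)])
      then show ?thesis using path(1) fr by auto
    qed
    then have fsu: "\<phi> s = s" "\<phi> u = u" using su' path(3) by (auto simp: doubleton_eq_iff)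
    have "\<phi> \<in> A0" using \<phi>(1) fr fsu by (simp add: A0_def)
    then show "\<phi> v = v" using triv \<phi>B \<phi>(2) v by blast
  qed
qed

end

section \<open>Induced paths that can serve as a start\<close>

context finite_degree_graph
begin

text \<open>An induced path with two further conditions for the bound
  \<open>good_path_small\<close>: \<open>N r \<noteq> N u\<close> limits the vertices adjacent to
  both ends but not to \<open>s\<close>, and the last condition limits those adjacent to all
  three.\<close>

definition good_path :: "'a \<Rightarrow> 'a \<Rightarrow> 'a \<Rightarrow> bool" where
  "good_path r s u \<longleftrightarrow> s \<in> N r \<and> u \<in> N s \<and> u \<notin> N r \<and> r \<noteq> u \<and> N r \<noteq> N u \<and>
     (d = 2 \<or> \<not> N s - {r, u} \<subseteq> N r \<inter> N u)"

text \<open>With the edges at \<open>S\<close> coloured, \<open>v\<close> and \<open>w\<close> would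
  keep only the edge between them, and neither would have a blue edge; the last clause of
  \<open>valid\<close> forbids this.\<close>

definition conflict :: "'a set \<Rightarrow> 'a \<Rightarrow> 'a \<Rightarrow> bool" where
  "conflict S v w \<longleftrightarrow> w \<in> N v \<and> v \<notin> S \<and> w \<notin> S \<and> card (N v \<inter> S) = d - 1 \<and> card (N w \<inter> S) = d - 1"

lemma good_path_sym: "good_path r s u \<Longrightarrow> good_path u s r"
  unfolding good_path_def using N_sym by (metis Int_commute insert_commute)

lemma N_card: "v \<in> V \<Longrightarrow> card (N v) = d" and N_fin: "v \<in> V \<Longrightarrow> finite (N v)"
  using degree by auto

lemma N_eqI:
  assumes "T \<subseteq> N v" "card T = d" "v \<in> V"
  shows "N v = T"
  using card_subset_eq[OF N_fin[OF assms(3)] assms(1)] N_card[OF assms(3)] assms(2) by simp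

text \<open>Induction along a walk from \<open>v\<close>: a neighbour of a neighbour of
  \<open>v\<close> is \<open>v\<close>, adjacent to \<open>v\<close>, or a twin by assumption, and a
  neighbour of a twin of \<open>v\<close> is adjacent to \<open>v\<close>. Used in contraposition,
  it yields an induced path whose ends are not twins.\<close>

lemma adjacent_or_twins:
  assumes twins: "\<And>r s u. s \<in> N r \<Longrightarrow> u \<in> N s \<Longrightarrow> u \<notin> N r \<Longrightarrow> r \<noteq> u \<Longrightarrow> N r = N u"
    and vw: "v \<in> V" "w \<in> V"
  shows "v = w \<or> w \<in> N v \<or> N v = N w"
proof -
  have "(\<lambda>x y. {x, y} \<in> E)\<^sup>*\<^sup>* v w" using conn vw by (simp add: connected_graph_def)
  then show ?thesis
  proof (induction rule: rtranclp_induct)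
    case (step y z)
    then have "z \<in> N y" by (simp add: in_neighbours)
    then show ?case using step.IH twins[of y v z] by blast
  qed simp
qed

text \<open>If an induced path \<open>r s u\<close> with nontwin ends fails, all other neighbours of
  \<open>s\<close> are adjacent to \<open>r\<close> and \<open>u\<close>. Take such a neighbour
  \<open>x\<close> as a new middle. If this fails too, \<open>N r\<close> consists of
  \<open>s\<close>, those neighbours and one vertex \<open>y\<close>, which is adjacent to none of
  \<open>u\<close>, \<open>s\<close> and \<open>x\<close>. Then the path \<open>s r y\<close> is
  good, with \<open>x\<close> as witness for both extra conditions.\<close>

lemma good_path_exists:
  assumes "v \<in> V" "w \<in> V" "v \<noteq> w" "w \<notin> N v" "N v \<noteq> N w"
  shows "\<exists>r s u. good_path r s u"
proof -
  obtain r s u where p: "s \<in> N r" "u \<in> N s" "u \<notin> N r" "r \<noteq> u" "N r \<noteq> N u"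
    using adjacent_or_twins[of v w] assms by blast
  have V: "r \<in> V" "s \<in> V" "u \<in> V" using p N_V by blast+
  show ?thesis
  proof (cases "good_path r s u")
    case True
    then show ?thesis by blast
  next
    case False
    then have dn: "d \<noteq> 2" and sub: "N s - {r, u} \<subseteq> N r \<inter> N u" using p by (auto simp: good_path_def)
    have rs: "r \<in> N s" using p(1) by (rule N_sym)
    define X where "X = N s - {r, u}"
    have cX: "card X = d - 2" using N_card[OF V(2)] rs p(2,4) by (simp add: X_def card_Diff_subset)
    have finX: "finite X" using N_fin[OF V(2)] by (simp add: X_def)
    then obtain x where x: "x \<in> X" using cX dn d2 by fastforce
    have xr: "x \<in> N r" "x \<in> N u" "x \<in> N s" "x \<noteq> r" "x \<noteq> u" using x sub by (auto simp: X_def)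
    have xs: "x \<noteq> s" using xr N_irrefl by blast
    show ?thesis
    proof (cases "good_path r x u")
      case True
      then show ?thesis by blast
    next
      case nx: False
      then have subx: "N x - {r, u} \<subseteq> N r \<inter> N u" using p xr dn N_sym by (auto simp: good_path_def)
      have sX: "s \<notin> X" using N_irrefl by (auto simp: X_def)
      have Xr: "insert s X \<subseteq> N r" using sub p(1) by (auto simp: X_def)
      have "card (insert s X) = d - 1" using finX sX cX dn d2 by simp
      then have "card (N r - insert s X) = 1"
        using N_card[OF V(1)] finX Xr d2 by (simp add: card_Diff_subset)
      then obtain y where y: "N r - insert s X = {y}" using card_1_singletonE by blast
      then have Nr: "N r = insert y (insert s X)" and yn: "y \<noteq> s" "y \<notin> X" using Xr by auto
      have yr: "y \<noteq> r" "y \<in> N r" using Nr N_irrefl by auto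
      have yu: "y \<noteq> u" using yr p(3) by blast
      have ys: "y \<notin> N s" using yn yr yu by (auto simp: X_def)
      have yNu: "y \<notin> N u"
      proof
        assume "y \<in> N u"
        moreover have "s \<in> N u" using p(2) by (rule N_sym)
        ultimately have "N r \<subseteq> N u" using Nr sub by (auto simp: X_def)
        then have "N u = N r" using N_eqI[of "N r" u] N_card V by simp
        then show False using p(5) by simp
      qed
      have "y \<notin> N x" using subx yr yu yNu by blast
      then have "x \<notin> N y" using N_sym by blast
      then have "N s \<noteq> N y" "\<not> N r - {s, y} \<subseteq> N s \<inter> N y" using xr xs \<open>y \<notin> X\<close> x by auto
      then have "good_path s r y"
        using rs yr(2) ys yn(1) by (auto simp: good_path_def)
      then show ?thesis by blast
    qed
  qed
qed

text \<open>All vertices of the class are neighbours of whichever path vertices \<open>v\<close>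
  sees. Common neighbours of all three number at most \<open>d - 3\<close>, as one neighbour of
  \<open>s\<close> drops out. Those of \<open>s\<close> and at most one end number at most
  \<open>d - 2\<close>. Those of \<open>r\<close> and \<open>u\<close> but not \<open>s\<close>
  number at most \<open>d - 2\<close>, since \<open>N r \<noteq> N u\<close>. Those of one end alone
  number at most \<open>d - 1\<close>.\<close>

lemma good_path_small:
  assumes g: "good_path r s u" and v: "v \<in> V - {r, s, u}" and ne: "N v \<inter> {r, s, u} \<noteq> {}"
  shows "card {w \<in> V - {r, s, u}. N w \<inter> {r, s, u} = N v \<inter> {r, s, u}} + card (N v \<inter> {r, s, u}) \<le> d"
proof -
  define S where "S = {r, s, u}"
  define K where "K = {w \<in> V - S. N w \<inter> S = N v \<inter> S}"
  have p: "s \<in> N r" "u \<in> N s" "u \<notin> N r" "r \<noteq> u" "N r \<noteq> N u" using g by (auto simp: good_path_def)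
  have V: "r \<in> V" "s \<in> V" "u \<in> V" "r \<noteq> s" "s \<noteq> u" using N_V[OF p(1)] N_V[OF p(2)] by auto
  have rs: "r \<in> N s" and us: "s \<in> N u" using p N_sym by blast+
  have mem: "w \<in> N a" if "w \<in> K" "a \<in> S" "a \<in> N v" for w a
    using that N_sym unfolding K_def by blast
  have KS: "w \<notin> S" if "w \<in> K" for w using that by (simp add: K_def)
  have cs: "card (N s - {r, u}) = d - 2" "finite (N s)"
    using N_card[OF V(2)] N_fin[OF V(2)] rs p(2,4) by (simp_all add: card_Diff_subset)
  have "card K + card (N v \<inter> S) \<le> d"
  proof (cases "s \<in> N v")
    case True
    have Ks: "K \<subseteq> N s - {r, u}" using mem[of _ s] True KS by (auto simp: S_def)
    show ?thesis
    proof (cases "r \<in> N v \<and> u \<in> N v")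
      case all: True
      have "v \<in> N s - {r, u}" using N_sym[OF True] v by simp
      then have "card (N s - {r, u}) \<noteq> 0" using cs(2) by auto
      then have "d \<noteq> 2" using cs by simp
      then obtain x where x: "x \<in> N s - {r, u}" "x \<notin> N r \<or> x \<notin> N u"
        using g unfolding good_path_def by blast
      have "K \<subseteq> N s - {r, u} - {x}"
        using Ks mem[of _ r] mem[of _ u] all x(2) by (auto simp: S_def)
      then have "card K \<le> card (N s - {r, u} - {x})" using cs(2) by (intro card_mono) auto
      also have "\<dots> = d - 3" using x(1) cs by simp
      finally have "card K \<le> d - 3" .
      moreover have "card (N v \<inter> S) \<le> 3"
        using card_mono[of S "N v \<inter> S"] V p(4) by (simp add: S_def)
      moreover have "3 \<le> d" using \<open>d \<noteq> 2\<close> d2 by simp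
      ultimately show ?thesis by linarith
    next
      case False
      have "card K \<le> d - 2" using card_mono[OF _ Ks] cs by simp
      moreover have "card (N v \<inter> S) \<le> 2"
        using False V p(4) by (auto simp: S_def Int_insert_right)
      ultimately show ?thesis using d2 by linarith
    qed
  next
    case sv: False
    have bound: "card K \<le> d - 1 \<and> card (N v \<inter> S) = 1"
      if "a \<in> N v" "N v \<inter> S = {a}" "a = r \<or> a = u" for a
    proof -
      have "s \<in> N a" "a \<in> V" "a \<in> S" using that(3) p(1) us V by (auto simp: S_def)
      have "K \<subseteq> N a - {s}" using mem[OF _ \<open>a \<in> S\<close> that(1)] KS by (auto simp: S_def)
      then have "card K \<le> card (N a - {s})" using N_fin[OF \<open>a \<in> V\<close>] by (intro card_mono) auto
      then show ?thesis using N_card[OF \<open>a \<in> V\<close>] \<open>s \<in> N a\<close> that(2) by simp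
    qed
    consider "r \<in> N v" "u \<in> N v" | "r \<in> N v" "u \<notin> N v" | "r \<notin> N v" "u \<in> N v"
      using ne sv by (auto simp: Int_insert_right split: if_splits)
    then show ?thesis
    proof cases
      case 1
      have "\<not> N r \<subseteq> N u" using N_eqI[of "N r" u] N_card V p(5) by auto
      then have "card (N r \<inter> N u) < card (N r)" using N_fin[OF V(1)] by (intro psubset_card_mono) auto
      then have "card (N r \<inter> N u) \<le> d - 1" using N_card[OF V(1)] by simp
      then have "card (N r \<inter> N u - {s}) \<le> d - 2" using p(1) us by simp
      moreover have "K \<subseteq> N r \<inter> N u - {s}" using mem[of _ r] mem[of _ u] 1 KS by (auto simp: S_def)
      then have "card K \<le> card (N r \<inter> N u - {s})" using N_fin[OF V(1)] by (intro card_mono) auto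
      moreover have "card (N v \<inter> S) \<le> 2" using sv V p(4) by (auto simp: S_def Int_insert_right)
      ultimately show ?thesis using d2 by linarith
    next
      case 2
      then have "N v \<inter> S = {r}" using sv by (auto simp: S_def)
      then show ?thesis using bound[of r] 2 d2 by simp
    next
      case 3
      then have "N v \<inter> S = {u}" using sv by (auto simp: S_def)
      then show ?thesis using bound[of u] 3 d2 by simp
    qed
  qed
  then show ?thesis by (simp add: K_def S_def)
qed

text \<open>The neighbourhoods of \<open>r\<close>, \<open>s\<close>, \<open>v\<close> and
  \<open>w\<close> are forced, and \<open>u\<close> has one more neighbour \<open>f\<close>. The
  path is shifted to \<open>f u s\<close>. A conflicting vertex would have two neighbours on it; but
  \<open>r\<close> and \<open>v\<close>, the outer neighbours of \<open>s\<close>, see only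
  \<open>s\<close> there, and \<open>w\<close>, the outer neighbour of \<open>u\<close>, does not
  see \<open>f\<close>.\<close>

lemma cubic_conflict:
  assumes d3: "d = 3" and g: "good_path r s u" and v: "N v = {w, r, s}" and w: "N w = {v, r, u}"
    and out: "v \<notin> {r, s, u}" "w \<notin> {r, s, u}" "v \<noteq> w"
  shows "\<exists>f. good_path f u s \<and> (\<forall>v w. \<not> conflict {f, u, s} v w)"
proof -
  have p: "s \<in> N r" "u \<in> N s" "u \<notin> N r" "r \<noteq> u" "N r \<noteq> N u" using g by (auto simp: good_path_def)
  have V: "r \<in> V" "s \<in> V" "u \<in> V" "r \<noteq> s" "s \<noteq> u" using N_V[OF p(1)] N_V[OF p(2)] by auto
  have "r \<in> N v" "s \<in> N v" "r \<in> N w" "u \<in> N w" using v w by auto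
  then have m: "v \<in> N r" "v \<in> N s" "w \<in> N r" "w \<in> N u" "r \<in> N s" "s \<in> N u" using N_sym p by blast+
  have Nr: "N r = {s, v, w}" by (rule N_eqI) (use m p out V d3 in auto)
  have Ns: "N s = {r, u, v}" by (rule N_eqI) (use m p out V d3 in auto)
  have "s \<noteq> w" using out by auto
  then have "card (N u - {s, w}) = 1"
    using m N_card[OF V(3)] N_fin[OF V(3)] d3 out by (simp add: card_Diff_subset)
  then obtain f where f: "N u - {s, w} = {f}" using card_1_singletonE by blast
  then have Nu: "N u = {s, w, f}" and fn: "f \<noteq> s" "f \<noteq> w" "f \<in> N u" using m by auto
  have uf: "u \<in> N f" using fn(3) by (rule N_sym)
  have fr: "f \<noteq> r" using uf p(3) by blast
  have fv: "f \<noteq> v"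
  proof
    assume "f = v"
    then have "u \<in> {w, r, s}" using uf v by blast
    then show False using out(2) V p(4) by blast
  qed
  have fu: "f \<noteq> u" using fn(3) N_irrefl by blast
  have "s \<notin> N f"
  proof
    assume "s \<in> N f"
    then have "f \<in> N s" by (rule N_sym)
    then show False using Ns fr fv fu by simp
  qed
  moreover have "N f \<noteq> N s"
  proof
    assume "N f = N s"
    then have "r \<in> N f" using Ns by simp
    then have "f \<in> N r" by (rule N_sym)
    then show False using Nr fn fv by simp
  qed
  moreover have "w \<in> N u - {f, s}" "w \<notin> N s" using m fn out Ns by auto
  ultimately have "good_path f u s"
    using uf m(6) fn(1) by (auto simp: good_path_def)
  moreover have False if "conflict {f, u, s} a b" for a b
  proof -
    have a: "a \<notin> {f, u, s}" "card (N a \<inter> {f, u, s}) = 2" using that[unfolded conflict_def] d3 by simp_all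
    show False
    proof (cases "s \<in> N a")
      case True
      then have "a \<in> N s" by (rule N_sym)
      then have "a = r \<or> a = v" using Ns a(1) by auto
      moreover have "{s, v, w} \<inter> {f, u, s} = {s}" "{w, r, s} \<inter> {f, u, s} = {s}"
        using fr fv fn V p(4) out by auto
      ultimately have "N a \<inter> {f, u, s} = {s}" using Nr v by metis
      then show False using a(2) by simp
    next
      case False
      have fu2: "f \<in> N a \<and> u \<in> N a"
      proof (rule ccontr)
        assume "\<not> ?thesis"
        then have "N a \<inter> {f, u, s} \<subseteq> {f} \<or> N a \<inter> {f, u, s} \<subseteq> {u}" using False by auto
        then have "card (N a \<inter> {f, u, s}) \<le> 1"
          using card_mono[of "{f}" "N a \<inter> {f, u, s}"] card_mono[of "{u}" "N a \<inter> {f, u, s}"] by auto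
        then show False using a(2) by simp
      qed
      then have "a \<in> N u" using N_sym by blast
      then have "a = w" using Nu a(1) by auto
      then have "f \<in> N w" using fu2 by blast
      then show False using w fr fv fu by simp
    qed
  qed
  ultimately show ?thesis by blast
qed

lemma good_path_free:
  assumes g: "good_path r s u" and big: "infinite V \<or> 7 \<le> card V"
  shows "\<exists>r s u. good_path r s u \<and> (\<forall>v w. \<not> conflict {r, s, u} v w)"
proof (cases "\<exists>v w. conflict {r, s, u} v w")
  case False
  then show ?thesis using g by blast
next
  case True
  then obtain v w where vw: "conflict {r, s, u} v w" by blast
  define S where "S = {r, s, u}"
  have p: "s \<in> N r" "u \<in> N s" "u \<notin> N r" "r \<noteq> u" "N r \<noteq> N u" using g by (auto simp: good_path_def)
  have V: "r \<in> V" "s \<in> V" "u \<in> V" "r \<noteq> s" "s \<noteq> u" using N_V[OF p(1)] N_V[OF p(2)] by auto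
  have e: "w \<in> N v" "v \<notin> S" "w \<notin> S" "card (N v \<inter> S) = d - 1" "card (N w \<inter> S) = d - 1"
    using vw by (auto simp: conflict_def S_def)
  have e': "v \<in> N w" using e(1) by (rule N_sym)
  have vV: "v \<in> V" "w \<in> V" "v \<noteq> w" using N_V[OF e(1)] by auto
  have rs: "r \<in> N s" and us: "s \<in> N u" using p N_sym by blast+
  have cS: "card S = 3" using V p(4) by (simp add: S_def)
  have finS: "finite S" by (simp add: S_def)
  have "d \<le> 4"
    using card_mono[OF finS, of "N v \<inter> S"] e(4) cS by simp
  have Nv: "N v = insert w (N v \<inter> S)" and Nw: "N w = insert v (N w \<inter> S)"
  proof -
    show "N v = insert w (N v \<inter> S)" using e finS d2 by (intro N_eqI[OF _ _ vV(1)]) auto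
    show "N w = insert v (N w \<inter> S)" using e e' finS d2 by (intro N_eqI[OF _ _ vV(2)]) auto
  qed
  \<comment> \<open>Two vertices in conflict have all neighbours among each other and the path, so
    few graphs remain. For \<open>d = 2\<close> the graph is a 5-cycle. For \<open>d = 3\<close> the
    path is moved. For \<open>d = 4\<close> both vertices see the whole path, and a class of two
    with three common neighbours violates \<open>good_path_small\<close>.\<close>
  consider "d = 2" | "d = 3" | "d = 4" using d2 \<open>d \<le> 4\<close> by linarith
  then show ?thesis
  proof cases
    case 1
    have Ns: "N s = {r, u}" by (rule N_eqI) (use rs p V 1 in auto)
    have sv: "s \<notin> N v" "s \<notin> N w" using Ns e(2,3) N_sym by (auto simp: S_def dest: N_sym)
    define T where "T = {r, s, u, v, w}"
    have cT: "card T \<le> 5" unfolding T_def by (simp add: card_insert_if)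
    have pair: "N r = {s, x}" if "r \<in> N x" "x \<noteq> s" for x
      by (rule N_eqI) (use that N_sym[OF that(1)] p V 1 in auto)
    have pair': "N u = {s, x}" if "u \<in> N x" "x \<noteq> s" for x
      by (rule N_eqI) (use that N_sym[OF that(1)] us V 1 in auto)
    have ns: "v \<noteq> s" "w \<noteq> s" using e by (auto simp: S_def)
    have one: "r \<in> N v \<or> u \<in> N v" "r \<in> N w \<or> u \<in> N w"
      using e(4,5) sv 1 by (auto simp: S_def Int_insert_right split: if_splits)
    have notboth: "\<not> (r \<in> N v \<and> r \<in> N w)" "\<not> (u \<in> N v \<and> u \<in> N w)"
      using pair[of v] pair[of w] pair'[of v] pair'[of w] ns vV(3) by (auto simp: doubleton_eq_iff)
    have "N r \<subseteq> T" "N u \<subseteq> T"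
      using one notboth pair[of v] pair[of w] pair'[of v] pair'[of w] ns by (auto simp: T_def)
    moreover have "N v \<subseteq> T" "N w \<subseteq> T" using Nv Nw by (auto simp: T_def S_def)
    moreover have "N s \<subseteq> T" using Ns by (simp add: T_def)
    ultimately have "V = T"
      using V vV by (intro closed_component[OF conn]) (auto simp: T_def)
    then show ?thesis using big cT by (auto simp: T_def)
  next
    case 2
    have c: "card (N v \<inter> S) = 2" "card (N w \<inter> S) = 2" using e 2 by auto
    \<comment> \<open>Exactly one of \<open>v\<close> and \<open>w\<close> is adjacent to
      \<open>s\<close>: with none, \<open>r\<close> and \<open>u\<close> would be twins, and with
      both, \<open>s\<close> would have degree at least 4. Up to reversing the path this is the
      configuration of \<open>cubic_conflict\<close>.\<close>
    have main: "\<exists>f. \<exists>s' u'. good_path f s' u' \<and> (\<forall>v w. \<not> conflict {f, s', u'} v w)"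
      if sa: "s \<in> N a" and sb: "s \<notin> N b" and ab: "{a, b} = {v, w}" for a b
    proof -
      have a: "N a = insert b (N a \<inter> S)" "card (N a \<inter> S) = 2" "a \<notin> S"
        and b: "N b = insert a (N b \<inter> S)" "card (N b \<inter> S) = 2" "b \<notin> S" and ne: "a \<noteq> b"
        using ab Nv Nw c e(2,3) vV(3) by (auto simp: doubleton_eq_iff)
      have "r \<in> N b \<and> u \<in> N b"
        using b(2) sb V by (auto simp: S_def Int_insert_right split: if_splits)
      then have "N b \<inter> S = {r, u}" using sb by (auto simp: S_def)
      then have Nb: "N b = {a, r, u}" using b(1) by simp
      have "(r \<in> N a) \<noteq> (u \<in> N a)"
        using a(2) sa V p(4) by (auto simp: S_def Int_insert_right split: if_splits)
      then consider "r \<in> N a" "u \<notin> N a" | "u \<in> N a" "r \<notin> N a" by blast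
      then show ?thesis
      proof cases
        case 1
        then have "N a \<inter> S = {r, s}" using sa by (auto simp: S_def)
        then have "N a = {b, r, s}" using a(1) by simp
        then show ?thesis using cubic_conflict[OF 2 g _ Nb] a(3) b(3) ne by (auto simp: S_def)
      next
        case u2: 2
        then have "N a \<inter> S = {u, s}" using sa by (auto simp: S_def)
        then have Na: "N a = {b, u, s}" using a(1) by simp
        have Nb': "N b = {a, u, r}" using Nb by auto
        from cubic_conflict[OF 2 good_path_sym[OF g] Na Nb'] a(3) b(3) ne
        show ?thesis by (auto simp: S_def)
      qed
    qed
    have "s \<in> N v \<or> s \<in> N w"
    proof (rule ccontr)
      assume "\<not> ?thesis"
      then have "r \<in> N v" "u \<in> N v" "r \<in> N w" "u \<in> N w"
        using c V by (auto simp: S_def Int_insert_right split: if_splits)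
      then have "v \<in> N r" "v \<in> N u" "w \<in> N r" "w \<in> N u" using N_sym by blast+
      then have sub: "{s, v, w} \<subseteq> N r" "{s, v, w} \<subseteq> N u" using p(1) us by auto
      have "s \<noteq> v" "s \<noteq> w" using e(2,3) by (auto simp: S_def)
      then have "card {s, v, w} = d" using vV(3) 2 by simp
      then have "N r = {s, v, w}" "N u = {s, v, w}" using N_eqI[OF sub(1)] N_eqI[OF sub(2)] V by simp_all
      then show False using p(5) by simp
    qed
    moreover have "\<not> (s \<in> N v \<and> s \<in> N w)"
    proof
      assume "s \<in> N v \<and> s \<in> N w"
      then have "{r, u, v, w} \<subseteq> N s" using rs p(2) N_sym by blast
      then have "card {r, u, v, w} \<le> card (N s)" using N_fin[OF V(2)] by (rule card_mono[rotated])
      then show False using N_card[OF V(2)] 2 e vV p(4) by (auto simp: S_def)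
    qed
    ultimately show ?thesis using main[of v w] main[of w v] by (auto simp: insert_commute)
  next
    case 3
    have "N v \<inter> S = S" "N w \<inter> S = S"
      using card_subset_eq[OF finS, of "N v \<inter> S"] card_subset_eq[OF finS, of "N w \<inter> S"] e(4,5) cS 3 by auto
    then have "{v, w} \<subseteq> {x \<in> V - S. N x \<inter> S = N v \<inter> S}" using vV e by auto
    moreover have "finite {x \<in> V - S. N x \<inter> S = N v \<inter> S}"
    proof (rule finite_subset[OF _ N_fin[OF V(2)]])
      show "{x \<in> V - S. N x \<inter> S = N v \<inter> S} \<subseteq> N s"
        using \<open>N v \<inter> S = S\<close> N_sym by (auto simp: S_def)
    qed
    ultimately have "card {v, w} \<le> card {x \<in> V - S. N x \<inter> S = N v \<inter> S}" by (rule card_mono[rotated])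
    moreover have "card {x \<in> V - S. N x \<inter> S = N v \<inter> S} + card (N v \<inter> S) \<le> d"
      unfolding S_def
    proof (rule good_path_small[OF g])
      show "v \<in> V - {r, s, u}" using vV(1) e(2) by (simp add: S_def)
      show "N v \<inter> {r, s, u} \<noteq> {}" using \<open>N v \<inter> S = S\<close> unfolding S_def by blast
    qed
    ultimately show ?thesis using \<open>N v \<inter> S = S\<close> cS 3 vV(3) by simp
  qed
qed

lemma finite_degree_colouring:
  assumes "v \<in> V" "w \<in> V" "v \<noteq> w" "w \<notin> N v" "N v \<noteq> N w" and big: "infinite V \<or> 7 \<le> card V"
  shows "dist_index_le V E 2"
proof -
  obtain r s u where g: "good_path r s u" and free: "\<And>v w. \<not> conflict {r, s, u} v w"
    using good_path_exists[OF assms(1-5)] good_path_free[OF _ big] by metis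
  show ?thesis
  proof (rule path_colouring)
    show "s \<in> N r" "u \<in> N s" "u \<notin> N r" "r \<noteq> u" using g by (auto simp: good_path_def)
    show "card {w \<in> V - {r, s, u}. N w \<inter> {r, s, u} = N v \<inter> {r, s, u}} + card (N v \<inter> {r, s, u}) \<le> d"
      if "v \<in> V - {r, s, u}" "N v \<inter> {r, s, u} \<noteq> {}" for v
      using good_path_small[OF g that] .
    show "\<not> (card (N v \<inter> {r, s, u}) = d - 1 \<and> card (N w \<inter> {r, s, u}) = d - 1)"
      if "w \<in> N v" "v \<notin> {r, s, u}" "w \<notin> {r, s, u}" for v w
      using free[of v w] that by (simp add: conflict_def)
  qed
qed

end

section \<open>Complete multipartite graphs\<close>

text \<open>The red edges will form a spider with legs of the distinct lengths \<open>1\<close>, \<open>c\<close> and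
  \<open>n - 2 - c\<close>.\<close>

definition spider :: "nat \<Rightarrow> nat \<Rightarrow> nat \<Rightarrow> nat \<Rightarrow> bool" where
  "spider n c i j \<longleftrightarrow> (j = Suc i \<and> Suc j < n) \<or> (i = Suc j \<and> Suc i < n) \<or>
     (Suc i = n \<and> j = c) \<or> (Suc j = n \<and> i = c)"

text \<open>The numbers below \<open>n - 1\<close> form a path, and the leaf \<open>n - 1\<close>
  hangs at \<open>c\<close>. The image of \<open>c\<close> is determined by degree 3, and that of
  \<open>n - 1\<close> as the leaf next to \<open>c\<close>. The legs cannot be exchanged because
  their lengths differ, and so every leg is fixed from \<open>c\<close> outwards.\<close>

lemma spider_rigid:
  assumes c: "2 \<le> c" "c + 3 < n" "n \<noteq> 2 * c + 2"
    and bij: "bij_betw \<sigma> {..<n} {..<n}"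
    and adj: "\<And>i j. i < n \<Longrightarrow> j < n \<Longrightarrow> spider n c (\<sigma> i) (\<sigma> j) \<longleftrightarrow> spider n c i j"
    and k: "k < n"
  shows "\<sigma> k = k"
proof -
  have lt: "\<sigma> i < n" if "i < n" for i using bij_betw_apply[OF bij, of i] that by simp
  have inj: "\<sigma> i = \<sigma> j \<longleftrightarrow> i = j" if "i < n" "j < n" for i j
    using bij that by (auto simp: bij_betw_def inj_on_def)
  have sur: "\<exists>i<n. \<sigma> i = j" if "j < n" for j
  proof -
    have "j \<in> \<sigma> ` {..<n}" using bij that by (simp add: bij_betw_def)
    then show ?thesis by auto
  qed
  have cn: "c < n" "c - 1 < n" "Suc c < n" "n - 1 < n" using c by auto
  have nc: "spider n c c (c - 1)" "spider n c c (Suc c)" "spider n c c (n - 1)"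
    using c by (auto simp: spider_def)
  have \<sigma>c: "\<sigma> c = c"
  proof (rule ccontr)
    assume ne: "\<sigma> c \<noteq> c"
    have "spider n c (\<sigma> c) (\<sigma> (c - 1))" "spider n c (\<sigma> c) (\<sigma> (Suc c))" "spider n c (\<sigma> c) (\<sigma> (n - 1))"
      using adj nc cn by simp_all
    moreover have "\<sigma> (c - 1) \<noteq> \<sigma> (Suc c)" "\<sigma> (c - 1) \<noteq> \<sigma> (n - 1)" "\<sigma> (Suc c) \<noteq> \<sigma> (n - 1)"
      using inj cn c by auto
    ultimately show False using ne lt[OF cn(1)] unfolding spider_def by auto
  qed
  have leaf: "\<sigma> (n - 1) = n - 1"
  proof -
    have "spider n c c (\<sigma> (n - 1))" using adj[of c "n - 1"] nc(3) cn \<sigma>c by simp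
    then have "\<sigma> (n - 1) = c - 1 \<or> \<sigma> (n - 1) = Suc c \<or> \<sigma> (n - 1) = n - 1"
      using c unfolding spider_def by auto
    moreover have no: "\<sigma> (n - 1) \<noteq> x" if h: "spider n c x y" "y < n" "y \<noteq> c" for x y
    proof
      assume x: "\<sigma> (n - 1) = x"
      obtain j where j: "j < n" "\<sigma> j = y" using sur h(2) by blast
      then have "spider n c (n - 1) j" using adj[of "n - 1" j] x h cn by simp
      then have "j = c" using c j unfolding spider_def by auto
      then show False using j \<sigma>c h(3) by simp
    qed
    moreover have "spider n c (c - 1) (c - 2)" "spider n c (Suc c) (Suc (Suc c))"
      using c by (auto simp: spider_def)
    then have "\<sigma> (n - 1) \<noteq> c - 1" "\<sigma> (n - 1) \<noteq> Suc c"
      using no[of "c - 1" "c - 2"] no[of "Suc c" "Suc (Suc c)"] c by auto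
    ultimately show ?thesis by blast
  qed
  have "\<sigma> (c - 1) = c - 1 \<or> \<sigma> (c - 1) = Suc c"
  proof -
    have "spider n c c (\<sigma> (c - 1))" using adj[of c "c - 1"] nc(1) cn \<sigma>c by simp
    moreover have "\<sigma> (c - 1) \<noteq> n - 1" using inj[of "c - 1" "n - 1"] leaf cn c by auto
    ultimately show ?thesis using c unfolding spider_def by auto
  qed
  then show ?thesis
  proof
    assume swap: "\<sigma> (c - 1) = Suc c"
    \<comment> \<open>If the leg towards 0 is mapped into the other one, its end 0 goes to
      \<open>2 * c\<close>. As \<open>n \<noteq> 2 * c + 2\<close>, the other leg continues beyond
      this point, but 0 has no further neighbour that could be mapped there.\<close>
    have step: "i \<le> c \<Longrightarrow> \<sigma> (c - i) = c + i \<and> Suc (c + i) < n" for i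
    proof (induction i rule: less_induct)
      case (less i)
      consider "i = 0" | "i = 1" | "2 \<le> i" by linarith
      then show ?case
      proof cases
        case 1
        then show ?thesis using \<sigma>c c by simp
      next
        case 2
        then show ?thesis using swap c by simp
      next
        case 3
        have ih: "\<sigma> (c - (i - 1)) = c + (i - 1)" "\<sigma> (c - (i - 2)) = c + (i - 2)"
          using less.IH[of "i - 1"] less.IH[of "i - 2"] less.prems 3 by auto
        have "spider n c (c - (i - 1)) (c - i)" using less.prems 3 c by (auto simp: spider_def)
        then have "spider n c (c + (i - 1)) (\<sigma> (c - i))"
          using adj[of "c - (i - 1)" "c - i"] ih(1) c by simp
        moreover have "\<sigma> (c - i) \<noteq> c + (i - 2)"
          using inj[of "c - i" "c - (i - 2)"] ih(2) less.prems 3 c by auto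
        moreover have "Suc (c + (i - 1)) < n"
          using less.IH[of "i - 1"] less.prems 3 by simp
        ultimately show ?thesis using 3 unfolding spider_def by auto
      qed
    qed
    have z: "\<sigma> 0 = 2 * c" "Suc (2 * c) < n" using step[of c] by auto
    have "\<sigma> 1 = c + (c - 1)" using step[of "c - 1"] c by simp
    have "Suc (Suc (2 * c)) < n" using z c by simp
    then obtain j where j: "j < n" "\<sigma> j = Suc (2 * c)" using sur[of "Suc (2 * c)"] by auto
    have "spider n c (2 * c) (Suc (2 * c))" using \<open>Suc (Suc (2 * c)) < n\<close> by (simp add: spider_def)
    then have "spider n c 0 j" using adj[of 0 j] j z c by simp
    then have "j = 1" using c unfolding spider_def by auto
    then show ?thesis using j \<open>\<sigma> 1 = c + (c - 1)\<close> by simp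
  next
    assume keep: "\<sigma> (c - 1) = c - 1"
    have \<sigma>c1: "\<sigma> (Suc c) = Suc c"
    proof -
      have "spider n c c (\<sigma> (Suc c))" using adj[of c "Suc c"] nc(2) cn \<sigma>c by simp
      moreover have "\<sigma> (Suc c) \<noteq> n - 1" "\<sigma> (Suc c) \<noteq> c - 1"
        using inj[of "Suc c" "n - 1"] inj[of "Suc c" "c - 1"] leaf keep cn c by auto
      ultimately show ?thesis using c unfolding spider_def by auto
    qed
    have up: "Suc (c + i) < n \<Longrightarrow> \<sigma> (c + i) = c + i" for i
    proof (induction i rule: less_induct)
      case (less i)
      consider "i = 0" | "i = 1" | "2 \<le> i" by linarith
      then show ?case
      proof cases
        case 1
        then show ?thesis using \<sigma>c by simp
      next
        case 2
        then show ?thesis using \<sigma>c1 by simp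
      next
        case 3
        have ih: "\<sigma> (c + (i - 1)) = c + (i - 1)" "\<sigma> (c + (i - 2)) = c + (i - 2)"
          using less.IH[of "i - 1"] less.IH[of "i - 2"] less.prems 3 by auto
        have "spider n c (c + (i - 1)) (c + i)" using less.prems 3 by (auto simp: spider_def)
        then have "spider n c (c + (i - 1)) (\<sigma> (c + i))"
          using adj[of "c + (i - 1)" "c + i"] ih(1) less.prems 3 by simp
        moreover have "\<sigma> (c + i) \<noteq> c + (i - 2)"
          using inj[of "c + i" "c + (i - 2)"] ih(2) less.prems 3 by auto
        ultimately show ?thesis using 3 less.prems unfolding spider_def by auto
      qed
    qed
    have down: "i \<le> c \<Longrightarrow> \<sigma> (c - i) = c - i" for i
    proof (induction i rule: less_induct)
      case (less i)
      consider "i = 0" | "i = 1" | "2 \<le> i" by linarith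
      then show ?case
      proof cases
        case 1
        then show ?thesis using \<sigma>c by simp
      next
        case 2
        then show ?thesis using keep by simp
      next
        case 3
        have ih: "\<sigma> (c - (i - 1)) = c - (i - 1)" "\<sigma> (c - (i - 2)) = c - (i - 2)"
          using less.IH[of "i - 1"] less.IH[of "i - 2"] less.prems 3 by auto
        have "spider n c (c - (i - 1)) (c - i)" using less.prems 3 c by (auto simp: spider_def)
        then have "spider n c (c - (i - 1)) (\<sigma> (c - i))"
          using adj[of "c - (i - 1)" "c - i"] ih(1) c by simp
        moreover have "\<sigma> (c - i) \<noteq> c - (i - 2)"
          using inj[of "c - i" "c - (i - 2)"] ih(2) less.prems 3 c by auto
        ultimately show ?thesis using 3 less.prems c unfolding spider_def by auto
      qed
    qed
    consider "k \<le> c" | "c < k" "Suc k < n" | "k = n - 1" using k by linarith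
    then show ?thesis
    proof cases
      case 1
      then show ?thesis using down[of "c - k"] by simp
    next
      case 2
      then show ?thesis using up[of "k - c"] by simp
    next
      case 3
      then show ?thesis using leaf by simp
    qed
  qed
qed

context finite_degree_graph
begin

text \<open>Nonadjacent vertices are twins, so the parts are the classes of equal neighbourhoods and
  all have \<open>card V - d\<close> vertices. Dealing the numbers cyclically to the
  \<open>q\<close> parts puts consecutive numbers into different parts, so that the spider's path
  consists of edges.\<close>

lemma multipartite_numbering:
  assumes twins: "\<And>v w. v \<in> V \<Longrightarrow> w \<in> V \<Longrightarrow> v = w \<or> w \<in> N v \<or> N v = N w" and fV: "finite V"
  obtains f q where "2 \<le> q" "q dvd card V" "bij_betw f {..<card V} V"
    "\<And>i j. i < card V \<Longrightarrow> j < card V \<Longrightarrow> f j \<in> N (f i) \<longleftrightarrow> i mod q \<noteq> j mod q"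
proof -
  have adj: "w \<in> N v \<longleftrightarrow> N v \<noteq> N w" if "v \<in> V" "w \<in> V" for v w
    using twins[OF that] N_irrefl by blast
  define t where "t = card V - d"
  define q where "q = card (N ` V)"
  have part: "card {w \<in> V. N w = N v} = t" if "v \<in> V" for v
  proof -
    have "{w \<in> V. N w = N v} = V - N v" using adj[OF that] by auto
    then show ?thesis using N_card[OF that] N_fin[OF that] neighbours_subset[OF simple]
      by (simp add: t_def card_Diff_subset)
  qed
  have nq: "card V = t * q" unfolding q_def by (rule card_fibres[OF fV part])
  obtain v0 where v0: "v0 \<in> V" using conn by (auto simp: connected_graph_def)
  have dn: "d \<le> card V" using card_mono[OF fV neighbours_subset[OF simple]] N_card[OF v0] by metis
  have tpos: "0 < t"
    using part[OF v0] fV v0 by (metis (mono_tags, lifting) card_gt_0_iff empty_iff finite_subset mem_Collect_eq subsetI)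
  have q2: "2 \<le> q"
  proof (rule ccontr)
    assume "\<not> 2 \<le> q"
    then have "q = 0 \<or> q = 1" by linarith
    then have "card V \<le> t" using nq by auto
    then show False using dn d2 tpos by (simp add: t_def)
  qed
  have "card (N ` V) = card {..<q}" by (simp add: q_def)
  from finite_same_card_bij[OF _ _ this[symmetric]] obtain \<alpha> where \<alpha>: "bij_betw \<alpha> {..<q} (N ` V)"
    using fV by auto
  have "\<forall>c\<in>N ` V. \<exists>b. bij_betw b {..<t} {w \<in> V. N w = c}"
  proof
    fix c assume "c \<in> N ` V"
    then obtain v where v: "v \<in> V" "c = N v" by blast
    then have "card {..<t} = card {w \<in> V. N w = c}" using part by simp
    from finite_same_card_bij[OF _ _ this] fV show "\<exists>b. bij_betw b {..<t} {w \<in> V. N w = c}" by simp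
  qed
  from bchoice[OF this] obtain \<beta> where \<beta>: "\<And>c. c \<in> N ` V \<Longrightarrow> bij_betw (\<beta> c) {..<t} {w \<in> V. N w = c}"
    by blast
  define f where "f i = \<beta> (\<alpha> (i mod q)) (i div q)" for i
  have \<alpha>N: "\<alpha> (i mod q) \<in> N ` V" for i using bij_betw_apply[OF \<alpha>] q2 by simp
  have divt: "i div q < t" if "i < card V" for i
    using that nq by (simp add: less_mult_imp_div_less)
  have fV': "f i \<in> V" "N (f i) = \<alpha> (i mod q)" if "i < card V" for i
    using bij_betw_apply[OF \<beta>[OF \<alpha>N], of "i div q" i] divt[OF that] by (simp_all add: f_def)
  have modq: "\<alpha> (i mod q) = \<alpha> (j mod q) \<longleftrightarrow> i mod q = j mod q" for i j
    using \<alpha> q2 by (auto simp: bij_betw_def inj_on_def)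
  have "inj_on f {..<card V}"
  proof (rule inj_onI)
    fix i j assume ij: "i \<in> {..<card V}" "j \<in> {..<card V}" "f i = f j"
    then have m: "i mod q = j mod q" using fV'(2)[of i] fV'(2)[of j] modq by simp
    have "inj_on (\<beta> (\<alpha> (i mod q))) {..<t}" using \<beta>[OF \<alpha>N] by (simp add: bij_betw_def)
    then have "i div q = j div q"
      using ij m divt[of i] divt[of j] unfolding f_def by (auto dest: inj_onD)
    then show "i = j" using m by (metis div_mult_mod_eq)
  qed
  moreover have "f ` {..<card V} = V"
    using \<open>inj_on f {..<card V}\<close> fV'(1) by (intro card_subset_eq[OF fV]) (auto simp: card_image)
  ultimately have "bij_betw f {..<card V} V" by (simp add: bij_betw_def)
  moreover have "f j \<in> N (f i) \<longleftrightarrow> i mod q \<noteq> j mod q" if "i < card V" "j < card V" for i j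
    using adj[OF fV'(1)[OF that(1)] fV'(1)[OF that(2)]] fV'(2)[OF that(1)] fV'(2)[OF that(2)] modq by simp
  moreover have "q dvd card V" using nq by simp
  ultimately show ?thesis using that q2 by blast
qed

lemma multipartite_colouring:
  assumes twins: "\<And>v w. v \<in> V \<Longrightarrow> w \<in> V \<Longrightarrow> v = w \<or> w \<in> N v \<or> N v = N w"
    and big: "infinite V \<or> 7 \<le> card V"
  shows "dist_index_le V E 2"
proof -
  have fV: "finite V"
  proof -
    obtain v where v: "v \<in> V" using conn by (auto simp: connected_graph_def)
    have "card (N v) \<noteq> 0" using N_card[OF v] d2 by simp
    then obtain a where a: "a \<in> N v" by fastforce
    \<comment> \<open>A vertex not adjacent to \<open>v\<close> is \<open>v\<close> or a twin of
      \<open>v\<close>, and a twin is adjacent to \<open>a\<close>.\<close>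
    have "V \<subseteq> insert v (N v \<union> N a)"
    proof
      fix w assume w: "w \<in> V"
      then show "w \<in> insert v (N v \<union> N a)" using twins[OF v w] a N_sym by blast
    qed
    moreover have "finite (insert v (N v \<union> N a))" using N_fin[OF v] N_fin[of a] a N_V by blast
    ultimately show ?thesis using finite_subset by blast
  qed
  define n where "n = card V"
  have n7: "7 \<le> n" using big fV by (simp add: n_def)
  obtain f q where q: "2 \<le> q" "q dvd n" and f: "bij_betw f {..<n} V"
    and adj: "\<And>i j. i < n \<Longrightarrow> j < n \<Longrightarrow> f j \<in> N (f i) \<longleftrightarrow> i mod q \<noteq> j mod q"
    using multipartite_numbering[OF twins fV] unfolding n_def by metis
  \<comment> \<open>The edge between \<open>c\<close> and \<open>n - 1\<close> needs
    \<open>c mod q \<noteq> q - 1\<close>. This holds for \<open>c = 2\<close> unless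
    \<open>q = 3\<close>; then \<open>c = 3\<close> works, and the legs still have distinct lengths
    because \<open>n\<close> is a multiple of 3 and hence neither 7 nor 8.\<close>
  define c where "c = (if q = 3 then 3 else 2 :: nat)"
  have c: "2 \<le> c" "c + 3 < n" "n \<noteq> 2 * c + 2"
  proof -
    have "n \<noteq> 7 \<and> n \<noteq> 8" if "q = 3"
      using q(2) that by (auto simp: dvd_def) presburger+
    then show "2 \<le> c" "c + 3 < n" "n \<noteq> 2 * c + 2" using n7 by (auto simp: c_def)
  qed
  have last: "(n - 1) mod q = q - 1"
  proof -
    obtain t where t: "n = q * t" using q(2) by (auto simp: dvd_def)
    then have "t \<noteq> 0" using n7 by (metis mult_is_0 not_numeral_le_zero)
    then obtain t' where "t = Suc t'" by (cases t) auto
    then have n1: "n - 1 = (q - 1) + q * t'" using t q(1) by simp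
    have "(n - 1) mod q = (q - 1) mod q" unfolding n1 by (rule mod_mult_self2)
    also have "\<dots> = q - 1" using q(1) by simp
    finally show ?thesis .
  qed
  have modSuc: "i mod q \<noteq> Suc i mod q" for i
    using q(1) by (auto simp: mod_Suc)
  have cmod: "c mod q \<noteq> (n - 1) mod q"
  proof -
    consider "q = 2" | "q = 3" | "4 \<le> q" using q(1) by linarith
    then show ?thesis unfolding last by cases (auto simp: c_def)
  qed
  have ff: "f i = f j \<longleftrightarrow> i = j" if "i < n" "j < n" for i j
    using f that by (auto simp: bij_betw_def inj_on_def)
  have fV': "f i \<in> V" if "i < n" for i using bij_betw_apply[OF f] that by simp
  have fsur: "\<exists>i<n. f i = v" if "v \<in> V" for v
  proof -
    have "v \<in> f ` {..<n}" using f that by (simp add: bij_betw_def)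
    then show ?thesis by auto
  qed
  define R where "R = {{f i, f j} | i j. i < n \<and> j < n \<and> spider n c i j}"
  have R_iff: "{f i, f j} \<in> R \<longleftrightarrow> spider n c i j" if "i < n" "j < n" for i j
  proof -
    have "spider n c i j \<longleftrightarrow> spider n c j i" by (auto simp: spider_def)
    then show ?thesis unfolding R_def using that ff by (auto simp: doubleton_eq_iff)
  qed
  show ?thesis
  proof (rule two_colours[of R])
    show "simple_graph V E" by (rule simple)
    show "R \<subseteq> E"
    proof
      fix e assume "e \<in> R"
      then obtain i j where ij: "e = {f i, f j}" "i < n" "j < n" "spider n c i j" by (auto simp: R_def)
      have "i mod q \<noteq> j mod q"
        using ij(4) modSuc[of i] modSuc[of j] cmod unfolding spider_def by auto
      then show "e \<in> E" using adj[OF ij(2,3)] ij(1) by (simp add: in_neighbours)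
    qed
    fix \<phi> v assume \<phi>: "graph_automorphism V E \<phi>" "graph_automorphism V R \<phi>" and v: "v \<in> V"
    have bij\<phi>: "bij_betw \<phi> V V" using \<phi>(1) by (simp add: graph_automorphism_def)
    define \<sigma> where "\<sigma> i = inv_into {..<n} f (\<phi> (f i))" for i
    have \<sigma>: "f (\<sigma> i) = \<phi> (f i)" "\<sigma> i < n" if "i < n" for i
    proof -
      have "\<phi> (f i) \<in> V" using bij_betw_apply[OF bij\<phi> fV'[OF that]] .
      then have "\<phi> (f i) \<in> f ` {..<n}" using f by (simp add: bij_betw_def)
      then show "f (\<sigma> i) = \<phi> (f i)" "\<sigma> i < n"
        unfolding \<sigma>_def using f_inv_into_f[of "\<phi> (f i)" f "{..<n}"] inv_into_into[of "\<phi> (f i)" f "{..<n}"] by auto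
    qed
    have "bij_betw \<sigma> {..<n} {..<n}"
    proof -
      have "bij_betw (inv_into {..<n} f \<circ> (\<phi> \<circ> f)) {..<n} {..<n}"
        using f bij\<phi> bij_betw_inv_into[OF f] by (blast intro: bij_betw_trans)
      moreover have "inv_into {..<n} f \<circ> (\<phi> \<circ> f) = \<sigma>" by (auto simp: \<sigma>_def)
      ultimately show ?thesis by simp
    qed
    moreover have "spider n c (\<sigma> i) (\<sigma> j) \<longleftrightarrow> spider n c i j" if "i < n" "j < n" for i j
    proof -
      have "{f i, f j} \<in> R \<longleftrightarrow> {\<phi> (f i), \<phi> (f j)} \<in> R"
        using \<phi>(2) fV' that by (simp add: graph_automorphism_def)
      then show ?thesis using R_iff \<sigma> that by metis
    qed
    ultimately have id: "\<sigma> i = i" if "i < n" for i using spider_rigid[OF c, of \<sigma> i] that by blast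
    obtain i where i: "i < n" "f i = v" using fsur[OF v] by blast
    then show "\<phi> v = v" using \<sigma>(1)[OF i(1)] id[OF i(1)] by simp
  qed
qed

end

section \<open>Graphs of infinite degree\<close>

context
  includes cardinal_syntax
begin

text \<open>Transfinite greedy choice along the cardinal well-order of \<open>I\<close>: fewer than
  \<open>|I|\<close> values have been chosen before any given step.\<close>

lemma injective_choice:
  assumes F: "\<And>i. i \<in> I \<Longrightarrow> |I| \<le>o |F i|"
  shows "\<exists>g. inj_on g I \<and> (\<forall>i\<in>I. g i \<in> F i)"
proof -
  define R where "R = |I| - Id"
  have wo: "well_order_on I |I|" by (rule card_of_well_order_on)
  then have wf: "wf R" by (simp add: R_def well_order_on_def)
  define P where "P g i v \<longleftrightarrow> i \<in> I \<longrightarrow> v \<in> F i \<and> v \<notin> g ` {j. (j, i) \<in> R}" for g i v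
  have "\<exists>g. \<forall>i. P g i (g i)"
  proof (rule dependent_wf_choice[OF wf])
    show "P f i v = P g i v" if "\<And>z. (z, i) \<in> R \<Longrightarrow> f z = g z" for f g i v
    proof -
      have "f ` {j. (j, i) \<in> R} = g ` {j. (j, i) \<in> R}" using that by (intro image_cong) auto
      then show ?thesis by (simp add: P_def)
    qed
    show "\<exists>v. P f i v" for f i
    proof (cases "i \<in> I")
      case True
      define W where "W = {j. (j, i) \<in> R}"
      have "W = underS |I| i" by (auto simp: W_def R_def underS_def)
      then have "|W| <o |I|" using card_of_underS[OF card_of_Card_order, of i I] True by (simp add: Field_card_of)
      then have "|f ` W| <o |I|" using card_of_image ordLeq_ordLess_trans by blast
      then have "|f ` W| <o |F i|" using F[OF True] ordLess_ordLeq_trans by blast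
      then have "\<not> F i \<subseteq> f ` W" using card_of_mono1 not_ordLess_ordLeq by blast
      then show ?thesis by (auto simp: P_def W_def)
    qed (simp add: P_def)
  qed
  then obtain g where g: "\<And>i. i \<in> I \<Longrightarrow> g i \<in> F i \<and> g i \<notin> g ` {j. (j, i) \<in> R}"
    by (auto simp: P_def)
  have "inj_on g I"
  proof (rule inj_onI, rule ccontr)
    fix i j assume ij: "i \<in> I" "j \<in> I" "g i = g j" "i \<noteq> j"
    have "total_on I |I|" using wo by (simp add: well_order_on_def linear_order_on_def)
    then have "(i, j) \<in> R \<or> (j, i) \<in> R" using ij by (auto simp: total_on_def R_def)
    then show False using g[OF ij(1)] g[OF ij(2)] ij(3) by (metis image_eqI mem_Collect_eq)
  qed
  then show ?thesis using g by blast
qed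

text \<open>The vertices at the ends of walks of length \<open>n\<close> from \<open>v\<close>
  number at most the degree, and so does their countable union over all \<open>n\<close>, which is
  \<open>V\<close> by connectedness.\<close>

lemma connected_card_le_degree:
  assumes simple: "simple_graph V E" and conn: "connected_graph V E" and reg: "regular_graph V E"
    and v: "v \<in> V" "infinite (neighbours E v)" and x: "x \<in> V"
  shows "|V| \<le>o |neighbours E x|"
proof -
  have eq: "|neighbours E a| =o |neighbours E v|" if "a \<in> V" for a
    using reg that v(1) card_of_ordIso unfolding regular_graph_def eqpoll_def by blast
  define L where "L n = ((\<lambda>S. \<Union>a\<in>S. neighbours E a) ^^ n) {v}" for n
  have LV: "L n \<subseteq> V" for n
    by (induction n) (use v neighbours_subset[OF simple] in \<open>auto simp: L_def\<close>)
  have Lc: "|L n| \<le>o |neighbours E v|" for n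
  proof (induction n)
    case 0
    have "|{v}| <o |neighbours E v|"
      using finite_ordLess_infinite[OF card_of_Well_order card_of_Well_order, of "{v}" "neighbours E v"] v(2)
      by (simp add: Field_card_of)
    then show ?case by (simp add: L_def ordLess_imp_ordLeq)
  next
    case (Suc n)
    have "L (Suc n) = (\<Union>a\<in>L n. neighbours E a)" by (simp add: L_def)
    moreover have "\<forall>a\<in>L n. |neighbours E a| \<le>o |neighbours E v|"
      using eq LV ordIso_imp_ordLeq by blast
    ultimately show ?case using card_of_UNION_ordLeq_infinite[OF v(2) Suc] by simp
  qed
  have "V \<subseteq> (\<Union>n. L n)"
  proof
    fix w assume "w \<in> V"
    then have "(\<lambda>x y. {x, y} \<in> E)\<^sup>*\<^sup>* v w" using conn v(1) by (simp add: connected_graph_def)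
    then have "\<exists>n. w \<in> L n"
    proof (induction rule: rtranclp_induct)
      case base
      then show ?case by (intro exI[of _ 0]) (simp add: L_def)
    next
      case (step y z)
      then obtain n where "y \<in> L n" by blast
      then have "z \<in> L (Suc n)" using step(2) by (auto simp: L_def in_neighbours)
      then show ?case by blast
    qed
    then show "w \<in> (\<Union>n. L n)" by blast
  qed
  then have "|V| \<le>o |\<Union>n. L n|" by (rule card_of_mono1)
  moreover have "|\<Union>n. L n| \<le>o |neighbours E v|"
    by (rule card_of_UNION_ordLeq_infinite[OF v(2)]) (use v(2) Lc infinite_iff_card_of_nat in auto)
  moreover have "|neighbours E v| \<le>o |neighbours E x|"
    using eq[OF x] ordIso_symmetric ordIso_imp_ordLeq by blast
  ultimately show ?thesis using ordLeq_transitive by blast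
qed

text \<open>Every vertex \<open>x\<close> chooses private neighbours \<open>g (x, i)\<close> above itself in a well-order of \<open>V\<close>.
  They form a spanning forest, in which we choose the red edges recursively so that the red
  children of a vertex have distinct ranks: the children of a vertex of rank \<open>k\<close> have all ranks
  below \<open>k\<close>, and the children of a root \<open>x\<close> have all ranks except \<open>x\<close>. Roots are recognised by
  their red degree, which is the cardinality of \<open>V\<close>.\<close>

lemma infinite_degree_colouring:
  assumes simple: "simple_graph V E" and conn: "connected_graph V E" and reg: "regular_graph V E"
    and v: "v \<in> V" "infinite (neighbours E v)"
  shows "dist_index_le V E 2"
proof -
  have infV: "infinite V" using v neighbours_subset[OF simple] finite_subset by blast
  define R where "R = |V| - Id"
  define lt where "lt x y \<longleftrightarrow> (x, y) \<in> R" for x y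
  have wo: "well_order_on V |V|" by (rule card_of_well_order_on)
  then have wf: "wf R" by (simp add: R_def well_order_on_def)
  have ltV: "x \<in> V \<and> y \<in> V" if "lt x y" for x y
    using that wo by (auto simp: lt_def R_def well_order_on_def linear_order_on_def partial_order_on_def
        preorder_on_def refl_on_def)
  have lt_tot: "lt x y \<or> lt y x" if "x \<in> V" "y \<in> V" "x \<noteq> y" for x y
    using that wo by (auto simp: lt_def R_def well_order_on_def linear_order_on_def total_on_def)
  have lt_asym: "\<not> lt y x" if "lt x y" for x y
    using that wf by (auto simp: lt_def wf_asym dest: wf_not_sym)
  have lt_irrefl: "\<not> lt x x" for x by (simp add: lt_def R_def)
  have under: "|{x. lt x y}| <o |V|" if "y \<in> V" for y
  proof -
    have "{x. lt x y} = underS |V| y" by (auto simp: lt_def R_def underS_def)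
    then show ?thesis using card_of_underS[OF card_of_Card_order, of y V] that by (simp add: Field_card_of)
  qed
  \<comment> \<open>Fewer than \<open>|V|\<close> vertices lie below \<open>x\<close>, so of its
    \<open>|V|\<close> neighbours \<open>|V|\<close> many lie above. As
    \<open>|V \<times> V| = |V|\<close>, every vertex can have one private upper neighbour for each
    rank in \<open>V\<close>.\<close>
  have "|V \<times> V| \<le>o |{y \<in> neighbours E x. lt x y}|" if x: "x \<in> V" for x
  proof -
    define up where "up = {y \<in> neighbours E x. lt x y}"
    have "|V| \<le>o |up|"
    proof (rule ccontr)
      assume "\<not> |V| \<le>o |up|"
      then have "|up| <o |V|"
        using not_ordLeq_iff_ordLess[OF card_of_Well_order card_of_Well_order] by blast
      then have "|up \<union> {y. lt y x}| <o |V|" using card_of_Un_ordLess_infinite[OF infV] under[OF x] by blast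
      moreover have "neighbours E x \<subseteq> up \<union> {y. lt y x}"
      proof
        fix y assume y: "y \<in> neighbours E x"
        then have "y \<in> V" "x \<noteq> y" using simple_graphD[OF simple, of x y] by (auto simp: in_neighbours)
        then show "y \<in> up \<union> {y. lt y x}" using lt_tot[OF x] y by (auto simp: up_def)
      qed
      ultimately have "|neighbours E x| <o |V|" using card_of_mono1 ordLeq_ordLess_trans by blast
      then show False
        using connected_card_le_degree[OF simple conn reg v x] not_ordLess_ordLeq by blast
    qed
    moreover have "|V \<times> V| =o |V|" by (rule card_of_Times_same_infinite[OF infV])
    ultimately show ?thesis unfolding up_def using ordIso_ordLeq_trans by blast
  qed
  then have "\<exists>g. inj_on g (V \<times> V) \<and> (\<forall>p\<in>V \<times> V. g p \<in> {y \<in> neighbours E (fst p). lt (fst p) y})"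
    by (intro injective_choice) auto
  then obtain g where g_inj: "inj_on g (V \<times> V)"
    and g: "\<And>x i. x \<in> V \<Longrightarrow> i \<in> V \<Longrightarrow> g (x, i) \<in> neighbours E x \<and> lt x (g (x, i))" by auto
  define red where "red p i \<longleftrightarrow> (if fst p then i \<noteq> snd p else lt i (snd p))" for p :: "bool \<times> 'a" and i
  \<comment> \<open>A state consists of the information whether the vertex is a root, and its rank.
    The state of a vertex depends only on that of the vertex to which it is private, which lies
    below it, so the recursion is well-founded. A vertex without a red parent becomes a root and
    takes itself as rank.\<close>
  define H where "H st y = (if \<exists>x\<in>V. \<exists>i\<in>V. y = g (x, i) \<and> red (st x) i
      then (False, snd (inv_into (V \<times> V) g y)) else (True, y))" for st y
  have "\<exists>st. \<forall>y. st y = H st y"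
  proof (rule dependent_wf_choice[OF wf])
    show "(b = H f y) = (b = H h y)" if "\<And>z. (z, y) \<in> R \<Longrightarrow> f z = h z" for f h y b
    proof -
      have "f x = h x" if "x \<in> V" "i \<in> V" "y = g (x, i)" for x i
        using g[OF that(1,2)] that(3) \<open>\<And>z. (z, y) \<in> R \<Longrightarrow> f z = h z\<close> by (simp add: lt_def)
      then have "(\<exists>x\<in>V. \<exists>i\<in>V. y = g (x, i) \<and> red (f x) i) \<longleftrightarrow> (\<exists>x\<in>V. \<exists>i\<in>V. y = g (x, i) \<and> red (h x) i)"
        by metis
      then show ?thesis by (simp add: H_def)
    qed
  qed blast
  then obtain st where st: "\<And>y. st y = H st y" by blast
  define root where "root y \<longleftrightarrow> fst (st y)" for y
  define rank where "rank y = snd (st y)" for y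
  define par where "par x y \<longleftrightarrow> x \<in> V \<and> (\<exists>i\<in>V. y = g (x, i) \<and> red (st x) i)" for x y
  have par_g: "par x (g (x, i)) \<longleftrightarrow> red (st x) i" if "x \<in> V" "i \<in> V" for x i
    using that g_inj by (auto simp: par_def inj_on_def)
  have redI: "red (st x) i \<longleftrightarrow> (if root x then i \<noteq> rank x else lt i (rank x))" for x i
    by (simp add: red_def root_def rank_def)
  have root_iff: "root y \<longleftrightarrow> (\<nexists>x. par x y)" for y
    unfolding root_def by (subst st) (auto simp: H_def par_def)
  have rank_root: "rank y = y" if "root y" for y
    using that st[of y] unfolding root_def rank_def H_def by (auto split: if_splits)
  have rank_g: "rank (g (x, i)) = i" if "x \<in> V" "i \<in> V" "red (st x) i" for x i
  proof -
    have "inv_into (V \<times> V) g (g (x, i)) = (x, i)" using g_inj that by (simp add: inv_into_f_f)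
    moreover have "\<exists>x'\<in>V. \<exists>i'\<in>V. g (x, i) = g (x', i') \<and> red (st x') i'" using that by blast
    ultimately show ?thesis using st[of "g (x, i)"] by (simp add: rank_def H_def)
  qed
  have par_lt: "lt x y" if "par x y" for x y using that g by (auto simp: par_def)
  have par_V: "x \<in> V" "y \<in> V" if "par x y" for x y using ltV[OF par_lt[OF that]] by auto
  have par_unique: "x = x'" if "par x y" "par x' y" for x x' y
    using that g_inj by (auto simp: par_def inj_on_def)
  have par_nr: "\<not> root y" if "par x y" for x y using that root_iff by blast
  have rank_V: "rank y \<in> V" if "y \<in> V" for y
  proof (cases "root y")
    case True
    then show ?thesis using that rank_root by simp
  next
    case False
    then obtain x i where "x \<in> V" "i \<in> V" "y = g (x, i)" "red (st x) i"
      using root_iff[of y] unfolding par_def by blast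
    then show ?thesis using rank_g by simp
  qed
  have par_rank: "y = y'" if "par x y" "par x y'" "rank y = rank y'" for x y y'
    using that rank_g by (auto simp: par_def)
  have kids: "rank ` {y. par x y} = (if root x then V - {x} else {i. lt i (rank x)})" if x: "x \<in> V" for x
  proof -
    have "rank ` {y. par x y} = {i \<in> V. red (st x) i}"
    proof (intro equalityI subsetI)
      fix i assume "i \<in> rank ` {y. par x y}"
      then show "i \<in> {i \<in> V. red (st x) i}" using rank_g by (auto simp: par_def)
    next
      fix i assume i: "i \<in> {i \<in> V. red (st x) i}"
      then have "par x (g (x, i))" "rank (g (x, i)) = i" using par_g[OF x] rank_g[OF x] by auto
      then show "i \<in> rank ` {y. par x y}" by (metis imageI mem_Collect_eq)
    qed
    also have "\<dots> = (if root x then V - {x} else {i. lt i (rank x)})"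
      using ltV by (auto simp: redI rank_root)
    finally show ?thesis .
  qed
  define F where "F = {{x, y} | x y. par x y}"
  have F_iff: "{x, y} \<in> F \<longleftrightarrow> par x y \<or> par y x" for x y
    by (auto simp: F_def doubleton_eq_iff)
  have FE: "F \<subseteq> E"
  proof
    fix e assume "e \<in> F"
    then obtain x y where "e = {x, y}" "par x y" by (auto simp: F_def)
    then show "e \<in> E" using g by (auto simp: par_def in_neighbours)
  qed
  have simF: "simple_graph V F" using simple_graph_mono[OF simple FE] .
  \<comment> \<open>A root has a red child of every rank but one. Any other vertex has at most one
    red child for each element of a proper initial segment, and these are fewer than
    \<open>|V|\<close> because the order is the cardinal one.\<close>
  have root_card: "root y \<longleftrightarrow> |V| \<le>o |neighbours F y|" if y: "y \<in> V" for y
  proof (cases "root y")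
    case True
    have "|V| =o |V - {y}|" using infinite_imp_bij_betw[OF infV, of y] card_of_ordIso by blast
    moreover have "|rank ` {z. par y z}| \<le>o |{z. par y z}|" by (rule card_of_image)
    moreover have "|{z. par y z}| \<le>o |neighbours F y|"
      by (rule card_of_mono1) (auto simp: in_neighbours F_iff)
    ultimately have "|V| \<le>o |neighbours F y|"
      using kids[OF y] True ordIso_ordLeq_trans ordLeq_transitive by (metis (no_types, lifting))
    then show ?thesis using True by simp
  next
    case False
    then obtain w where w: "par w y" using root_iff by blast
    have sub: "neighbours F y \<subseteq> insert w ((\<lambda>i. g (y, i)) ` {i. lt i (rank y)})"
    proof
      fix z assume "z \<in> neighbours F y"
      then have "par y z \<or> par z y" by (simp add: in_neighbours F_iff)
      then show "z \<in> insert w ((\<lambda>i. g (y, i)) ` {i. lt i (rank y)})"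
      proof
        assume "par y z"
        then show ?thesis using False redI by (auto simp: par_def)
      next
        assume "par z y"
        then show ?thesis using par_unique[OF w] by blast
      qed
    qed
    have "|(\<lambda>i. g (y, i)) ` {i. lt i (rank y)}| <o |V|"
      using card_of_image under[OF rank_V[OF y]] ordLeq_ordLess_trans by blast
    moreover have "|{w}| <o |V|"
      using finite_ordLess_infinite[OF card_of_Well_order card_of_Well_order, of "{w}" V] infV
      by (simp add: Field_card_of)
    ultimately have "|{w} \<union> (\<lambda>i. g (y, i)) ` {i. lt i (rank y)}| <o |V|"
      using card_of_Un_ordLess_infinite[OF infV] by blast
    then have "|neighbours F y| <o |V|"
      using card_of_mono1[OF sub] ordLeq_ordLess_trans by simp
    then show ?thesis using False not_ordLess_ordLeq by blast
  qed
  show ?thesis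
  proof (rule two_colours[OF FE simple])
    fix \<phi> a assume "graph_automorphism V E \<phi>" and \<phi>F: "graph_automorphism V F \<phi>" and a: "a \<in> V"
    have bij: "bij_betw \<phi> V V" using \<phi>F by (simp add: graph_automorphism_def)
    have \<phi>V: "\<phi> x \<in> V" if "x \<in> V" for x using bij_betw_apply[OF bij that] .
    have \<phi>_inj: "\<phi> x = \<phi> y \<longleftrightarrow> x = y" if "x \<in> V" "y \<in> V" for x y
      using bij that by (auto simp: bij_betw_def inj_on_def)
    have \<phi>_sur: "\<exists>x\<in>V. \<phi> x = y" if "y \<in> V" for y
    proof -
      have "y \<in> \<phi> ` V" using bij that by (simp add: bij_betw_def)
      then show ?thesis by blast
    qed
    have edge: "par x y \<or> par y x \<longleftrightarrow> par (\<phi> x) (\<phi> y) \<or> par (\<phi> y) (\<phi> x)" if "x \<in> V" "y \<in> V" for x y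
      using \<phi>F that by (simp add: graph_automorphism_def F_iff)
    have root\<phi>: "root (\<phi> y) \<longleftrightarrow> root y" if y: "y \<in> V" for y
    proof -
      have "bij_betw \<phi> (neighbours F y) (neighbours F (\<phi> y))"
        using automorphism_neighbours[OF \<phi>F simF y] bij neighbours_subset[OF simF, of y]
        by (auto simp: bij_betw_def intro: inj_on_subset)
      then have "|neighbours F y| =o |neighbours F (\<phi> y)|" by (rule card_of_ordIsoI)
      then show ?thesis
        using root_card[OF y] root_card[OF \<phi>V[OF y]] ordIso_symmetric ordLeq_ordIso_trans by blast
    qed
    \<comment> \<open>If an edge were reversed, \<open>\<phi> x\<close> would have a parent and so
      would not be a root. Then \<open>x\<close> has a parent \<open>w\<close>, and by induction
      \<open>\<phi> w\<close> is the parent of \<open>\<phi> x\<close>, that is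
      \<open>\<phi> y\<close>; but \<open>w\<close> lies below \<open>x\<close> and \<open>y\<close>
      above.\<close>
    have par1: "par x y \<Longrightarrow> par (\<phi> x) (\<phi> y)" for x y
    proof (induction y arbitrary: x rule: wf_induct_rule[OF wf])
      case (1 y)
      have V: "x \<in> V" "y \<in> V" using par_V[OF 1(2)] by auto
      show ?case
      proof (rule ccontr)
        assume "\<not> par (\<phi> x) (\<phi> y)"
        then have yx: "par (\<phi> y) (\<phi> x)" using edge[OF V] 1(2) by blast
        then have "\<not> root x" using par_nr root\<phi>[OF V(1)] by blast
        then obtain w where w: "par w x" using root_iff by blast
        have "(x, y) \<in> R" using par_lt[OF 1(2)] by (simp add: lt_def)
        then have "par (\<phi> w) (\<phi> x)" using 1(1) w by blast
        then have "\<phi> w = \<phi> y" using par_unique yx by blast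
        then have "w = y" using \<phi>_inj par_V(1)[OF w] V by blast
        then show False using par_lt[OF w] par_lt[OF 1(2)] lt_asym by blast
      qed
    qed
    have par\<phi>: "par (\<phi> x) (\<phi> y) \<longleftrightarrow> par x y" if "x \<in> V" "y \<in> V" for x y
      using par1 edge[OF that] lt_asym par_lt by blast
    have kids\<phi>: "{z. par (\<phi> y) z} = \<phi> ` {z. par y z}" if y: "y \<in> V" for y
    proof (intro equalityI subsetI)
      fix z assume z: "z \<in> {z. par (\<phi> y) z}"
      then obtain z' where z': "z' \<in> V" "\<phi> z' = z" using \<phi>_sur par_V(2) by blast
      then have "par y z'" using z par\<phi>[OF y] by blast
      then show "z \<in> \<phi> ` {z. par y z}" using z' by blast
    qed (use par1 in blast)
    \<comment> \<open>The ranks of the children are smaller, hence preserved by induction, and they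
      form the initial segment below the rank of the parent, which determines that rank.\<close>
    have rank\<phi>: "y \<in> V \<Longrightarrow> \<not> root y \<Longrightarrow> rank y = k \<Longrightarrow> rank (\<phi> y) = k" for y k
    proof (induction k arbitrary: y rule: wf_induct_rule[OF wf])
      case (1 k)
      have "rank (\<phi> z) = rank z" if z: "par y z" for z
      proof -
        have "rank z \<in> rank ` {z. par y z}" using z by blast
        then have "lt (rank z) k" using kids[OF 1(2)] 1(3,4) by simp
        then show ?thesis using 1(1)[of "rank z" z] par_V(2)[OF z] par_nr[OF z] by (simp add: lt_def)
      qed
      then have "rank ` {z. par (\<phi> y) z} = rank ` {z. par y z}"
        unfolding kids\<phi>[OF 1(2)] image_image by (intro image_cong) auto
      then have "{i. lt i (rank (\<phi> y))} = {i. lt i k}"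
        using kids[OF 1(2)] kids[OF \<phi>V[OF 1(2)]] root\<phi>[OF 1(2)] 1(3,4) by simp
      then show ?case
        using lt_tot[of "rank (\<phi> y)" k] rank_V[OF \<phi>V[OF 1(2)]] rank_V[OF 1(2)] 1(4) lt_irrefl by blast
    qed
    \<comment> \<open>The one rank missing among the children of a root is the root itself.\<close>
    have root_fix: "\<phi> y = y" if y: "y \<in> V" "root y" for y
    proof -
      have "rank (\<phi> z) = rank z" if "par y z" for z using rank\<phi> par_V(2)[OF that] par_nr[OF that] by blast
      then have "rank ` {z. par (\<phi> y) z} = rank ` {z. par y z}"
        unfolding kids\<phi>[OF y(1)] image_image by (intro image_cong) auto
      then have "V - {\<phi> y} = V - {y}"
        using kids[OF y(1)] kids[OF \<phi>V[OF y(1)]] root\<phi>[OF y(1)] y(2) by simp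
      then show ?thesis using y(1) \<phi>V[OF y(1)] by blast
    qed
    have "y \<in> V \<Longrightarrow> \<phi> y = y" for y
    proof (induction y rule: wf_induct_rule[OF wf])
      case (1 y)
      show ?case
      proof (cases "root y")
        case True
        then show ?thesis using root_fix 1(2) by blast
      next
        case False
        then obtain x where x: "par x y" using root_iff by blast
        then have "\<phi> x = x" using 1(1)[of x] par_lt[OF x] par_V(1)[OF x] by (simp add: lt_def)
        then have "par x (\<phi> y)" using par1[OF x] by simp
        then show ?thesis using par_rank[OF _ x] rank\<phi>[OF 1(2) False] by blast
      qed
    qed
    then show "\<phi> a = a" using a .
  qed
qed

end

section \<open>Infinite degree, complete multipartite graphs, all other graphs\<close>

theorem theorem4:
  fixes V :: "'a set" and E :: "'a set set"
  assumes "simple_graph V E"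
    and "connected_graph V E"
    and "regular_graph V E"
    and "infinite V \<or> card V \<ge> 7"
  shows "dist_index_le V E 2"
proof (cases "\<exists>v\<in>V. infinite (neighbours E v)")
  case True
  then show ?thesis using infinite_degree_colouring[OF assms(1-3)] by blast
next
  case False
  obtain v where v: "v \<in> V" using assms(2) by (auto simp: connected_graph_def)
  define d where "d = card (neighbours E v)"
  have degree: "finite (neighbours E w) \<and> card (neighbours E w) = d" if "w \<in> V" for w
  proof -
    have "\<exists>f. bij_betw f (neighbours E w) (neighbours E v)"
      using assms(3) that v unfolding regular_graph_def eqpoll_def by blast
    then show ?thesis using False that bij_betw_same_card unfolding d_def by blast
  qed
  have "2 \<le> d"
  proof (rule ccontr)
    assume "\<not> 2 \<le> d"
    then consider "d = 0" | "d = 1" by linarith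
    then obtain T where T: "T \<subseteq> V" "v \<in> T" "card T \<le> 2" "finite T"
      "\<And>a. a \<in> T \<Longrightarrow> neighbours E a \<subseteq> T"
    proof cases
      case 1
      then have "neighbours E v = {}" using degree[OF v] card_0_eq by metis
      then show ?thesis using that[of "{v}"] v by simp
    next
      case 2
      then obtain a where a: "neighbours E v = {a}" using degree[OF v] card_1_singletonE by metis
      then have av: "v \<in> neighbours E a" "a \<in> V"
        using neighbours_commute[of a E v] neighbours_subset[OF assms(1), of v] by auto
      obtain b where "neighbours E a = {b}" using degree[OF av(2)] 2 card_1_singletonE by metis
      then have "neighbours E a = {v}" using av by simp
      moreover have "card {v, a} \<le> 2" by (cases "v = a") auto
      ultimately show ?thesis using that[of "{v, a}"] a av v by blast
    qed
    then have "V = T" using closed_component[OF assms(2) T(1) _ T(5)] by blast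
    then show False using T(3,4) assms(4) by simp
  qed
  then interpret finite_degree_graph V E d
    using assms(1,2) degree by unfold_locales auto
  show ?thesis
  proof (cases "\<forall>v\<in>V. \<forall>w\<in>V. v = w \<or> w \<in> neighbours E v \<or> neighbours E v = neighbours E w")
    case True
    then show ?thesis using multipartite_colouring assms(4) by blast
  next
    case False
    then show ?thesis using finite_degree_colouring assms(4) by blast
  qed
qed


end
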